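(* Let $E=(E^0,E^1,r,s)$ be a graph, and suppose that $H \subseteq E^0$ is a saturated hereditary subset of vertices and $S \subseteq B_H$ is a subset of breaking vertices for $H$. Then the gauge-invariant ideal $I_{(H,S)}$ in $C^*(E)$ is isomorphic (as a $C^*$-algebra) to $C^*(\overline{E}_{(H,S)})$.
   Context: Graphs. A graph $E=(E^0,E^1,r,s)$ consists of a set $E^0$ of vertices, a set $E^1$ of edges, and maps $r,s:E^1\to E^0$ (range and source). A vertex $v$ is a sink if $s^{-1}(v)=\emptyset$, an infinite emitter if $|s^{-1}(v)|=\infty$, and regular if $0<|s^{-1}(v)|<\infty$; $E^0_{\mathrm{reg}}$ is the set of regular vertices. A path of length $n\ge 1$ is a sequence $\alpha=e_1\ldots e_n$ of edges with $r(e_i)=s(e_{i+1})$ for $1\le i\le n-1$; put $|\alpha|=n$, $s(\alpha)=s(e_1)$, $r(\alpha)=r(e_n)$. Vertices are paths of length $0$ with $r(v)=s(v)=v$. $E^*$ is the set of all finite paths. Graph $C^*$-algebra. $C^*(E)$ is the universal $C^*$-algebra generated by mutually orthogonal projections $\{p_v:v\in E^0\}$ and partial isometries with mutually orthogonal ranges $\{s_e:e\in E^1\}$ satisfying: (1) $s_e^*s_e=p_{r(e)}$ for all $e\in E^1$; (2) $s_es_e^*\le p_{s(e)}$ for all $e\in E^1$; (3) $p_v=\sum_{\{e\in E^1: s(e)=v\}}s_es_e^*$ for all $v\in E^0_{\mathrm{reg}}$. Ideals. A subset $H\subseteq E^0$ is hereditary if $e\in E^1$ and $s(e)\in H$ imply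 $r(e)\in H$; a hereditary $H$ is saturated if every $v\in E^0_{\mathrm{reg}}$ with $r(s^{-1}(v))\subseteq H$ belongs to $H$. For $H$ saturated hereditary, the set of breaking vertices is $$B_H:=\{v\in E^0: |s^{-1}(v)|=\infty \text{ and } 0<|s^{-1}(v)\cap r^{-1}(E^0\setminus H)|<\infty\}.$$ For $v\in B_H$ the gap projection is $p_v^H:=p_v-\sum_{s(e)=v,\ r(e)\notin H}s_es_e^*$. For $S\subseteq B_H$, $I_{(H,S)}$ is the closed two-sided ideal of $C^*(E)$ generated by $\{p_v:v\in H\}\cup\{p_v^H:v\in S\}$. The graph $\overline{E}_{(H,S)}$. Define $$F_1(H,S):=\{\alpha\in E^*: \alpha=e_1\ldots e_n \text{ with } n\ge 1,\ r(e_n)\in H \text{ and } s(e_n)\notin H\cup S\},$$ $$F_2(H,S):=\{\alpha\in E^*: |\alpha|\ge 1 \text{ and } r(\alpha)\in S\}.$$ These sets are disjoint. For $i=1,2$ let $\overline{F}_i(H,S)$ denote another copy of $F_i(H,S)$, and write $\overline{\alpha}$ for the copy of $\alpha$ in $\overline{F}_i(H,S)$. Then $\overline{E}_{(H,S)}$ is the graph with (disjoint unions) $$\overline{E}_{(H,S)}^0:=H\cup S\cup F_1(H,S)\cup F_2(H,S),$$ $$\overline{E}_{(H,S)}^1:=\{e\in E^1:s(e)\in H\}\cup\{e\in E^1:s(e)\in S,\ r(e)\in H\}\cup\overline{F}_1(H,S)\cup\overline{F}_2(H,S),$$ where edges coming from $E^1$ keep their source and range, and $s(\overline{\alpha})=\alpha$,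 $r(\overline{\alpha})=r(\alpha)$ for $\overline{\alpha}\in\overline{F}_1(H,S)\cup\overline{F}_2(H,S)$. Here $F_1(H,S)$ and $F_2(H,S)$ are used as sets of new vertices. *)

theory Defs
  imports Complex_Main "HOL-Algebra.Module" "Graph_Theory.Arc_Walk"
begin

section \<open>C*-algebras\<close>

definition complex_ring :: "complex ring" where
  "complex_ring = \<lparr>carrier = UNIV, monoid.mult = (*), one = 1, zero = 0, add = (+)\<rparr>"

text \<open>
  Algebras need not be unital: the field \<^term>\<open>one\<close> inherited from the record \<open>module\<close> carries no
  meaning and is not mentioned in any axiom.
\<close>

record 'a normed_star_alg = "(complex, 'a) module" +
  star :: "'a \<Rightarrow> 'a"
  nrm :: "'a \<Rightarrow> real"

locale star_algebra = Module.module complex_ring A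
  for A :: "'a normed_star_alg" (structure) +
  assumes mult_closed: "\<lbrakk>x \<in> carrier A; y \<in> carrier A\<rbrakk> \<Longrightarrow> x \<otimes> y \<in> carrier A"
    and mult_assoc: "\<lbrakk>x \<in> carrier A; y \<in> carrier A; z \<in> carrier A\<rbrakk>
          \<Longrightarrow> (x \<otimes> y) \<otimes> z = x \<otimes> (y \<otimes> z)"
    and distrib_left: "\<lbrakk>x \<in> carrier A; y \<in> carrier A; z \<in> carrier A\<rbrakk>
          \<Longrightarrow> x \<otimes> (y \<oplus> z) = x \<otimes> y \<oplus> x \<otimes> z"
    and distrib_right: "\<lbrakk>x \<in> carrier A; y \<in> carrier A; z \<in> carrier A\<rbrakk>
          \<Longrightarrow> (x \<oplus> y) \<otimes> z = x \<otimes> z \<oplus> y \<otimes> z"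
    and smult_mult_left: "\<lbrakk>x \<in> carrier A; y \<in> carrier A\<rbrakk> \<Longrightarrow> (c \<odot> x) \<otimes> y = c \<odot> (x \<otimes> y)"
    and smult_mult_right: "\<lbrakk>x \<in> carrier A; y \<in> carrier A\<rbrakk> \<Longrightarrow> x \<otimes> (c \<odot> y) = c \<odot> (x \<otimes> y)"
    and star_closed: "x \<in> carrier A \<Longrightarrow> star A x \<in> carrier A"
    and star_star: "x \<in> carrier A \<Longrightarrow> star A (star A x) = x"
    and star_add: "\<lbrakk>x \<in> carrier A; y \<in> carrier A\<rbrakk> \<Longrightarrow> star A (x \<oplus> y) = star A x \<oplus> star A y"
    and star_smult: "x \<in> carrier A \<Longrightarrow> star A (c \<odot> x) = cnj c \<odot> star A x"
    and star_mult: "\<lbrakk>x \<in> carrier A; y \<in> carrier A\<rbrakk> \<Longrightarrow> star A (x \<otimes> y) = star A y \<otimes> star A x"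

definition cauchy_seqs :: "'a normed_star_alg \<Rightarrow> (nat \<Rightarrow> 'a) set" where
  "cauchy_seqs A = {X. range X \<subseteq> carrier A \<and>
     (\<forall>\<epsilon>>0. \<exists>M. \<forall>m\<ge>M. \<forall>n\<ge>M. nrm A (X m \<ominus>\<^bsub>A\<^esub> X n) < \<epsilon>)}"

definition converges_to :: "'a normed_star_alg \<Rightarrow> (nat \<Rightarrow> 'a) \<Rightarrow> 'a \<Rightarrow> bool" where
  "converges_to A X l \<longleftrightarrow> (\<lambda>n. nrm A (X n \<ominus>\<^bsub>A\<^esub> l)) \<longlonglongrightarrow> 0"

text \<open>
  A *-algebra with a C*-seminorm. Such a seminorm is automatically *-invariant, since
  \<open>nrm x ^ 2 = nrm (x* x) \<le> nrm x* nrm x\<close>.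
\<close>

locale pre_cstar_algebra = star_algebra A for A (structure) +
  assumes nrm_nonneg: "x \<in> carrier A \<Longrightarrow> 0 \<le> nrm A x"
    and nrm_triangle: "\<lbrakk>x \<in> carrier A; y \<in> carrier A\<rbrakk> \<Longrightarrow> nrm A (x \<oplus> y) \<le> nrm A x + nrm A y"
    and nrm_smult: "x \<in> carrier A \<Longrightarrow> nrm A (c \<odot> x) = cmod c * nrm A x"
    and nrm_mult: "\<lbrakk>x \<in> carrier A; y \<in> carrier A\<rbrakk> \<Longrightarrow> nrm A (x \<otimes> y) \<le> nrm A x * nrm A y"
    and cstar_identity: "x \<in> carrier A \<Longrightarrow> nrm A (star A x \<otimes> x) = (nrm A x)\<^sup>2"

locale cstar_algebra = pre_cstar_algebra A for A (structure) +
  assumes nrm_definite: "\<lbrakk>x \<in> carrier A; nrm A x = 0\<rbrakk> \<Longrightarrow> x = \<zero>"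
    and complete: "X \<in> cauchy_seqs A \<Longrightarrow> \<exists>l\<in>carrier A. converges_to A X l"

definition star_hom :: "'a normed_star_alg \<Rightarrow> 'b normed_star_alg \<Rightarrow> ('a \<Rightarrow> 'b) set" where
  "star_hom A B = {\<phi>.
     (\<forall>x\<in>carrier A. \<phi> x \<in> carrier B) \<and>
     (\<forall>x\<in>carrier A. \<forall>y\<in>carrier A. \<phi> (x \<oplus>\<^bsub>A\<^esub> y) = \<phi> x \<oplus>\<^bsub>B\<^esub> \<phi> y) \<and>
     (\<forall>c. \<forall>x\<in>carrier A. \<phi> (c \<odot>\<^bsub>A\<^esub> x) = c \<odot>\<^bsub>B\<^esub> \<phi> x) \<and>
     (\<forall>x\<in>carrier A. \<forall>y\<in>carrier A. \<phi> (x \<otimes>\<^bsub>A\<^esub> y) = \<phi> x \<otimes>\<^bsub>B\<^esub> \<phi> y) \<and>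
     (\<forall>x\<in>carrier A. \<phi> (star A x) = star B (\<phi> x))}"

definition cstar_isomorphic :: "'a normed_star_alg \<Rightarrow> 'b normed_star_alg \<Rightarrow> bool" where
  "cstar_isomorphic A B \<longleftrightarrow> (\<exists>\<phi>\<in>star_hom A B. bij_betw \<phi> (carrier A) (carrier B))"

definition closed_ideal :: "'a normed_star_alg \<Rightarrow> 'a set \<Rightarrow> bool" where
  "closed_ideal A J \<longleftrightarrow> J \<subseteq> carrier A \<and> \<zero>\<^bsub>A\<^esub> \<in> J \<and>
     (\<forall>x\<in>J. \<forall>y\<in>J. x \<oplus>\<^bsub>A\<^esub> y \<in> J) \<and> (\<forall>c. \<forall>x\<in>J. c \<odot>\<^bsub>A\<^esub> x \<in> J) \<and>
     (\<forall>a\<in>carrier A. \<forall>x\<in>J. a \<otimes>\<^bsub>A\<^esub> x \<in> J \<and> x \<otimes>\<^bsub>A\<^esub> a \<in> J) \<and>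
     (\<forall>X. \<forall>l\<in>carrier A. range X \<subseteq> J \<and> converges_to A X l \<longrightarrow> l \<in> J)"

definition closed_ideal_gen :: "'a normed_star_alg \<Rightarrow> 'a set \<Rightarrow> 'a set" where
  "closed_ideal_gen A G = \<Inter>{J. closed_ideal A J \<and> G \<subseteq> J}"

definition is_projection :: "'a normed_star_alg \<Rightarrow> 'a \<Rightarrow> bool" where
  "is_projection A p \<longleftrightarrow> p \<in> carrier A \<and> star A p = p \<and> p \<otimes>\<^bsub>A\<^esub> p = p"

definition is_partial_isometry :: "'a normed_star_alg \<Rightarrow> 'a \<Rightarrow> bool" where
  "is_partial_isometry A s \<longleftrightarrow> s \<in> carrier A \<and> s \<otimes>\<^bsub>A\<^esub> star A s \<otimes>\<^bsub>A\<^esub> s = s"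

text \<open>The usual order of projections, applied only to projections.\<close>

definition proj_le :: "'a normed_star_alg \<Rightarrow> 'a \<Rightarrow> 'a \<Rightarrow> bool" where
  "proj_le A p q \<longleftrightarrow> p \<otimes>\<^bsub>A\<^esub> q = p \<and> q \<otimes>\<^bsub>A\<^esub> p = p"


section \<open>Completion of a *-algebra with a C*-seminorm\<close>

text \<open>
  The elements of the (Hausdorff) completion are the classes of Cauchy sequences modulo
  null sequences; the operations are induced by the pointwise ones.
\<close>

definition seq_class :: "'a normed_star_alg \<Rightarrow> (nat \<Rightarrow> 'a) \<Rightarrow> (nat \<Rightarrow> 'a) set" where
  "seq_class A X = {Y \<in> cauchy_seqs A. (\<lambda>n. nrm A (X n \<ominus>\<^bsub>A\<^esub> Y n)) \<longlonglongrightarrow> 0}"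

definition completion :: "'a normed_star_alg \<Rightarrow> (nat \<Rightarrow> 'a) set normed_star_alg" where
  "completion A = \<lparr>
     carrier = seq_class A ` cauchy_seqs A,
     monoid.mult = (\<lambda>U V. \<Union>X\<in>U. \<Union>Y\<in>V. seq_class A (\<lambda>n. X n \<otimes>\<^bsub>A\<^esub> Y n)),
     one = undefined,
     zero = seq_class A (\<lambda>n. \<zero>\<^bsub>A\<^esub>),
     add = (\<lambda>U V. \<Union>X\<in>U. \<Union>Y\<in>V. seq_class A (\<lambda>n. X n \<oplus>\<^bsub>A\<^esub> Y n)),
     smult = (\<lambda>c U. \<Union>X\<in>U. seq_class A (\<lambda>n. c \<odot>\<^bsub>A\<^esub> X n)),
     star = (\<lambda>U. \<Union>X\<in>U. seq_class A (\<lambda>n. star A (X n))),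
     nrm = (\<lambda>U. THE r. \<forall>X\<in>U. (\<lambda>n. nrm A (X n)) \<longlonglongrightarrow> r)\<rparr>"

abbreviation const_class :: "'a normed_star_alg \<Rightarrow> 'a \<Rightarrow> (nat \<Rightarrow> 'a) set" where
  "const_class A x \<equiv> seq_class A (\<lambda>n. x)"


section \<open>Free *-algebras\<close>

text \<open>
  The letter \<open>(x, False)\<close> stands for the generator \<open>x\<close> and \<open>(x, True)\<close> for its adjoint. Elements of
  the (non-unital) free *-algebra on \<open>G\<close> are finitely supported coefficient functions on nonempty
  words. The second argument \<open>N\<close> is installed as the norm field.
\<close>

type_synonym 'g words_fun = "('g \<times> bool) list \<Rightarrow> complex"

definition words :: "'g set \<Rightarrow> ('g \<times> bool) list set" where
  "words G = {w. w \<noteq> [] \<and> fst ` set w \<subseteq> G}"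

definition adj_word :: "('g \<times> bool) list \<Rightarrow> ('g \<times> bool) list" where
  "adj_word w = rev (map (\<lambda>(x, b). (x, \<not> b)) w)"

definition free_star_alg :: "'g set \<Rightarrow> ('g words_fun \<Rightarrow> real) \<Rightarrow> 'g words_fun normed_star_alg" where
  "free_star_alg G N = \<lparr>
     carrier = {f. finite {w. f w \<noteq> 0} \<and> {w. f w \<noteq> 0} \<subseteq> words G},
     monoid.mult = (\<lambda>f g w. \<Sum>i\<le>length w. f (take i w) * g (drop i w)),
     one = undefined,
     zero = (\<lambda>w. 0),
     add = (\<lambda>f g w. f w + g w),
     smult = (\<lambda>c f w. c * f w),
     star = (\<lambda>f w. cnj (f (adj_word w))),
     nrm = N\<rparr>"

definition free_gen :: "'g \<Rightarrow> 'g words_fun" where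
  "free_gen x = (\<lambda>w. if w = [(x, False)] then 1 else 0)"


section \<open>Graph C*-algebras\<close>

text \<open>
  Graphs are digraphs in the sense of \<open>Graph_Theory\<close>: source is \<^const>\<open>tail\<close>, range is
  \<^const>\<open>head\<close>.
\<close>

definition regular_vertex :: "('v, 'e) pre_digraph \<Rightarrow> 'v \<Rightarrow> bool" where
  "regular_vertex E v \<longleftrightarrow> v \<in> verts E \<and> finite (out_arcs E v) \<and> out_arcs E v \<noteq> {}"

definition ck_family ::
  "('v, 'e) pre_digraph \<Rightarrow> 'a normed_star_alg \<Rightarrow> ('v \<Rightarrow> 'a) \<Rightarrow> ('e \<Rightarrow> 'a) \<Rightarrow> bool" where
  "ck_family E A p s \<longleftrightarrow>
     (\<forall>v\<in>verts E. is_projection A (p v)) \<and>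
     (\<forall>v\<in>verts E. \<forall>w\<in>verts E. v \<noteq> w \<longrightarrow> p v \<otimes>\<^bsub>A\<^esub> p w = \<zero>\<^bsub>A\<^esub>) \<and>
     (\<forall>e\<in>arcs E. is_partial_isometry A (s e)) \<and>
     (\<forall>e\<in>arcs E. \<forall>f\<in>arcs E. e \<noteq> f \<longrightarrow>
        (s e \<otimes>\<^bsub>A\<^esub> star A (s e)) \<otimes>\<^bsub>A\<^esub> (s f \<otimes>\<^bsub>A\<^esub> star A (s f)) = \<zero>\<^bsub>A\<^esub>) \<and>
     (\<forall>e\<in>arcs E. star A (s e) \<otimes>\<^bsub>A\<^esub> s e = p (head E e)) \<and>
     (\<forall>e\<in>arcs E. proj_le A (s e \<otimes>\<^bsub>A\<^esub> star A (s e)) (p (tail E e))) \<and>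
     (\<forall>v. regular_vertex E v \<longrightarrow>
        p v = finsum A (\<lambda>e. s e \<otimes>\<^bsub>A\<^esub> star A (s e)) (out_arcs E v))"

abbreviation graph_free_alg ::
  "('v, 'e) pre_digraph \<Rightarrow> (('v + 'e) words_fun \<Rightarrow> real) \<Rightarrow> ('v + 'e) words_fun normed_star_alg" where
  "graph_free_alg E N \<equiv> free_star_alg (Inl ` verts E \<union> Inr ` arcs E) N"

text \<open>
  C*-seminorms on the free *-algebra on vertices and edges in whose completion the generators
  satisfy the defining relations. The universal C*-algebra is the completion for their supremum.
\<close>

definition graph_seminorms :: "('v, 'e) pre_digraph \<Rightarrow> (('v + 'e) words_fun \<Rightarrow> real) set" where
  "graph_seminorms E = {N. pre_cstar_algebra (graph_free_alg E N) \<and>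
     ck_family E (completion (graph_free_alg E N))
       (\<lambda>v. const_class (graph_free_alg E N) (free_gen (Inl v)))
       (\<lambda>e. const_class (graph_free_alg E N) (free_gen (Inr e)))}"

definition graph_normed_alg :: "('v, 'e) pre_digraph \<Rightarrow> ('v + 'e) words_fun normed_star_alg" where
  "graph_normed_alg E = graph_free_alg E (\<lambda>x. SUP N\<in>graph_seminorms E. N x)"

definition graph_cstar ::
  "('v, 'e) pre_digraph \<Rightarrow> (nat \<Rightarrow> ('v + 'e) words_fun) set normed_star_alg" where
  "graph_cstar E = completion (graph_normed_alg E)"

definition gp :: "('v, 'e) pre_digraph \<Rightarrow> 'v \<Rightarrow> (nat \<Rightarrow> ('v + 'e) words_fun) set" where
  "gp E v = const_class (graph_normed_alg E) (free_gen (Inl v))"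

definition gs :: "('v, 'e) pre_digraph \<Rightarrow> 'e \<Rightarrow> (nat \<Rightarrow> ('v + 'e) words_fun) set" where
  "gs E e = const_class (graph_normed_alg E) (free_gen (Inr e))"


section \<open>The ideals and the graphs attached to them\<close>

definition hereditary :: "('v, 'e) pre_digraph \<Rightarrow> 'v set \<Rightarrow> bool" where
  "hereditary E H \<longleftrightarrow> H \<subseteq> verts E \<and> (\<forall>e\<in>arcs E. tail E e \<in> H \<longrightarrow> head E e \<in> H)"

definition saturated_hereditary :: "('v, 'e) pre_digraph \<Rightarrow> 'v set \<Rightarrow> bool" where
  "saturated_hereditary E H \<longleftrightarrow> hereditary E H \<and>
     (\<forall>v. regular_vertex E v \<and> head E ` out_arcs E v \<subseteq> H \<longrightarrow> v \<in> H)"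

definition exit_arcs :: "('v, 'e) pre_digraph \<Rightarrow> 'v set \<Rightarrow> 'v \<Rightarrow> 'e set" where
  "exit_arcs E H v = {e \<in> out_arcs E v. head E e \<notin> H}"

definition breaking_vertices :: "('v, 'e) pre_digraph \<Rightarrow> 'v set \<Rightarrow> 'v set" where
  "breaking_vertices E H = {v \<in> verts E. infinite (out_arcs E v) \<and>
     exit_arcs E H v \<noteq> {} \<and> finite (exit_arcs E H v)}"

definition gap_projection ::
  "('v, 'e) pre_digraph \<Rightarrow> 'v set \<Rightarrow> 'v \<Rightarrow> (nat \<Rightarrow> ('v + 'e) words_fun) set" where
  "gap_projection E H v = gp E v \<ominus>\<^bsub>graph_cstar E\<^esub>
     finsum (graph_cstar E)
       (\<lambda>e. gs E e \<otimes>\<^bsub>graph_cstar E\<^esub> star (graph_cstar E) (gs E e)) (exit_arcs E H v)"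

definition graph_ideal ::
  "('v, 'e) pre_digraph \<Rightarrow> 'v set \<Rightarrow> 'v set \<Rightarrow> (nat \<Rightarrow> ('v + 'e) words_fun) set set" where
  "graph_ideal E H S =
     closed_ideal_gen (graph_cstar E) (gp E ` H \<union> gap_projection E H ` S)"

definition graph_ideal_alg ::
  "('v, 'e) pre_digraph \<Rightarrow> 'v set \<Rightarrow> 'v set \<Rightarrow> (nat \<Rightarrow> ('v + 'e) words_fun) set normed_star_alg" where
  "graph_ideal_alg E H S = graph_cstar E\<lparr>carrier := graph_ideal E H S\<rparr>"

text \<open>Paths of positive length are nonempty arc lists.\<close>

definition pos_paths :: "('v, 'e) pre_digraph \<Rightarrow> 'e list set" where
  "pos_paths E = {\<alpha>. \<alpha> \<noteq> [] \<and> (\<exists>u v. pre_digraph.awalk E u \<alpha> v)}"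

definition F1 :: "('v, 'e) pre_digraph \<Rightarrow> 'v set \<Rightarrow> 'v set \<Rightarrow> 'e list set" where
  "F1 E H S = {\<alpha> \<in> pos_paths E. head E (last \<alpha>) \<in> H \<and> tail E (last \<alpha>) \<notin> H \<union> S}"

definition F2 :: "('v, 'e) pre_digraph \<Rightarrow> 'v set \<Rightarrow> 'v set \<Rightarrow> 'e list set" where
  "F2 E H S = {\<alpha> \<in> pos_paths E. head E (last \<alpha>) \<in> S}"

text \<open>
  A path in \<open>F1 \<union> F2\<close> occurs as the vertex \<open>Inr \<alpha>\<close> and, as its copy, as the edge \<open>Inr \<alpha>\<close>.
\<close>

definition ideal_graph ::
  "('v, 'e) pre_digraph \<Rightarrow> 'v set \<Rightarrow> 'v set \<Rightarrow> ('v + 'e list, 'e + 'e list) pre_digraph" where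
  "ideal_graph E H S = \<lparr>
     verts = Inl ` (H \<union> S) \<union> Inr ` (F1 E H S \<union> F2 E H S),
     arcs = Inl ` ({e \<in> arcs E. tail E e \<in> H} \<union> {e \<in> arcs E. tail E e \<in> S \<and> head E e \<in> H}) \<union>
            Inr ` (F1 E H S \<union> F2 E H S),
     tail = case_sum (\<lambda>e. Inl (tail E e)) Inr,
     head = case_sum (\<lambda>e. Inl (head E e)) (\<lambda>\<alpha>. Inl (head E (last \<alpha>)))\<rparr>"


section \<open>Universality\<close>

text \<open>
  The remainder shows that \<^const>\<open>graph_cstar\<close> is the universal C*-algebra generated by a family
  satisfying the relations \<^const>\<open>ck_family\<close>: see \<open>cstar_algebra_graph_cstar\<close>,
  \<open>ck_family_graph_cstar\<close>, \<open>graph_cstar_universal\<close> (where the C*-algebra \<open>B\<close> is over an arbitrary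
  type) and \<open>graph_cstar_generated\<close>.
\<close>

lemma complex_ring_simps [simp]:
  "carrier complex_ring = UNIV" "a \<otimes>\<^bsub>complex_ring\<^esub> b = a * b" "a \<oplus>\<^bsub>complex_ring\<^esub> b = a + b"
  "\<one>\<^bsub>complex_ring\<^esub> = 1" "\<zero>\<^bsub>complex_ring\<^esub> = 0"
  by (simp_all add: complex_ring_def)

lemma cring_complex_ring: "cring complex_ring"
  by (intro cringI abelian_groupI comm_monoidI)
     (auto simp: algebra_simps intro: exI[of _ "- _"] add.left_inverse)

context star_algebra begin

lemmas sm_closed [simp] = smult_closed[simplified]
lemmas sm_ldist = smult_l_distr[simplified]
lemmas sm_rdist = smult_r_distr[simplified]
lemmas sm_assoc = smult_assoc1[simplified]
lemmas sm_one [simp] = smult_one[simplified]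

lemma sm_zero [simp]: "x \<in> carrier A \<Longrightarrow> 0 \<odot> x = \<zero>"
proof -
  assume x: "x \<in> carrier A"
  have "0 \<odot> x \<oplus> 0 \<odot> x = 0 \<odot> x" using sm_ldist[of x 0 0] x by simp
  then show ?thesis using x by (metis M.add.r_cancel_one' sm_closed)
qed

lemma neg_sm: "x \<in> carrier A \<Longrightarrow> \<ominus> x = (-1) \<odot> x"
proof -
  assume x: "x \<in> carrier A"
  have "(-1) \<odot> x \<oplus> x = \<zero>" using sm_ldist[of x "-1" 1] x by simp
  then show ?thesis using x by (metis M.minus_equality sm_closed)
qed

lemma minus_sm: "\<lbrakk>x \<in> carrier A; y \<in> carrier A\<rbrakk> \<Longrightarrow> x \<ominus> y = x \<oplus> (-1) \<odot> y"
  by (simp add: a_minus_def neg_sm)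

lemma sm_zero_right [simp]: "c \<odot> \<zero> = \<zero>"
  by (metis M.zero_closed sm_assoc mult_zero_right sm_zero)

lemma mult_zero_l [simp]: "x \<in> carrier A \<Longrightarrow> \<zero> \<otimes> x = \<zero>"
  using smult_mult_left[of x x 0] mult_closed[of x x] by simp

lemma mult_zero_r [simp]: "x \<in> carrier A \<Longrightarrow> x \<otimes> \<zero> = \<zero>"
  using smult_mult_right[of x x 0] mult_closed[of x x] by simp

lemma star_zero [simp]: "star A \<zero> = \<zero>"
  using star_smult[of \<zero> 0] star_closed[of \<zero>] by simp

lemma add_diff: "\<lbrakk>x \<in> carrier A; y \<in> carrier A; x' \<in> carrier A; y' \<in> carrier A\<rbrakk>
   \<Longrightarrow> (x \<oplus> y) \<ominus> (x' \<oplus> y') = (x \<ominus> x') \<oplus> (y \<ominus> y')"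
  by (simp add: minus_sm sm_rdist M.a_ac)

lemma sm_diff: "\<lbrakk>x \<in> carrier A; y \<in> carrier A\<rbrakk> \<Longrightarrow> c \<odot> x \<ominus> c \<odot> y = c \<odot> (x \<ominus> y)"
  by (simp add: minus_sm sm_rdist sm_assoc[symmetric])

lemma star_diff: "\<lbrakk>x \<in> carrier A; y \<in> carrier A\<rbrakk> \<Longrightarrow> star A (x \<ominus> y) = star A x \<ominus> star A y"
  by (simp add: minus_sm star_add star_smult star_closed)

lemma mult_diff: "\<lbrakk>x \<in> carrier A; y \<in> carrier A; x' \<in> carrier A; y' \<in> carrier A\<rbrakk>
   \<Longrightarrow> x \<otimes> y \<ominus> x' \<otimes> y' = (x \<ominus> x') \<otimes> y \<oplus> x' \<otimes> (y \<ominus> y')"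
proof -
  assume c: "x \<in> carrier A" "y \<in> carrier A" "x' \<in> carrier A" "y' \<in> carrier A"
  have m: "x \<otimes> y \<in> carrier A" "x' \<otimes> y \<in> carrier A" "x' \<otimes> y' \<in> carrier A" using c by (auto intro: mult_closed)
  have "(x \<ominus> x') \<otimes> y \<oplus> x' \<otimes> (y \<ominus> y')
      = (x \<otimes> y \<oplus> (-1) \<odot> (x' \<otimes> y)) \<oplus> (x' \<otimes> y \<oplus> (-1) \<odot> (x' \<otimes> y'))"
    using c by (simp add: minus_sm distrib_left distrib_right smult_mult_left smult_mult_right)
  also have "\<dots> = x \<otimes> y \<oplus> (((-1) \<odot> (x' \<otimes> y) \<oplus> x' \<otimes> y) \<oplus> (-1) \<odot> (x' \<otimes> y'))"
    using m by (simp add: M.a_assoc)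
  also have "(-1) \<odot> (x' \<otimes> y) \<oplus> x' \<otimes> y = \<zero>"
    using sm_ldist[of "x' \<otimes> y" "-1" 1] m by simp
  finally show ?thesis using m by (simp add: minus_sm)
qed

lemma diff_split: "\<lbrakk>x \<in> carrier A; y \<in> carrier A; z \<in> carrier A\<rbrakk>
   \<Longrightarrow> x \<ominus> z = (x \<ominus> y) \<oplus> (y \<ominus> z)"
proof -
  assume c: "x \<in> carrier A" "y \<in> carrier A" "z \<in> carrier A"
  have "(x \<ominus> y) \<oplus> (y \<ominus> z) = x \<oplus> (((-1) \<odot> y \<oplus> y) \<oplus> (-1) \<odot> z)"
    using c by (simp add: minus_sm M.a_assoc)
  also have "(-1) \<odot> y \<oplus> y = \<zero>" using sm_ldist[of y "-1" 1] c by simp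
  finally show ?thesis using c by (simp add: minus_sm)
qed

lemma diff_self [simp]: "x \<in> carrier A \<Longrightarrow> x \<ominus> x = \<zero>"
  by (simp add: a_minus_def M.r_neg)

lemma diff_swap: "\<lbrakk>x \<in> carrier A; y \<in> carrier A\<rbrakk> \<Longrightarrow> x \<ominus> y = (-1) \<odot> (y \<ominus> x)"
  by (simp add: minus_sm sm_rdist sm_assoc[symmetric] M.a_comm)

lemma diff_zero [simp]: "x \<in> carrier A \<Longrightarrow> x \<ominus> \<zero> = x"
  by (simp add: minus_sm)

lemma diff_eq_zero: "\<lbrakk>x \<in> carrier A; y \<in> carrier A; x \<ominus> y = \<zero>\<rbrakk> \<Longrightarrow> x = y"
  using diff_split[of x y \<zero>] by simp

end

context pre_cstar_algebra begin

lemma nrm_zero [simp]: "nrm A \<zero> = 0"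
  using nrm_smult[of \<zero> 0] by simp

lemma nrm_diff_swap: "\<lbrakk>x \<in> carrier A; y \<in> carrier A\<rbrakk> \<Longrightarrow> nrm A (x \<ominus> y) = nrm A (y \<ominus> x)"
  by (subst diff_swap) (simp_all add: nrm_smult)

lemma nrm_star_le: "x \<in> carrier A \<Longrightarrow> nrm A x \<le> nrm A (star A x)"
proof -
  assume x: "x \<in> carrier A"
  have "nrm A x * nrm A x \<le> nrm A (star A x) * nrm A x"
    using cstar_identity[OF x] nrm_mult[of "star A x" x] x star_closed[OF x] by (simp add: power2_eq_square)
  then show ?thesis using nrm_nonneg[OF x] nrm_nonneg[OF star_closed[OF x]]
    by (cases "nrm A x = 0") auto
qed

lemma nrm_star [simp]: "x \<in> carrier A \<Longrightarrow> nrm A (star A x) = nrm A x"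
  using nrm_star_le[of x] nrm_star_le[of "star A x"] star_closed[of x] star_star[of x] by simp

lemma nrm_diff_triangle: "\<lbrakk>x \<in> carrier A; y \<in> carrier A; z \<in> carrier A\<rbrakk>
   \<Longrightarrow> nrm A (x \<ominus> z) \<le> nrm A (x \<ominus> y) + nrm A (y \<ominus> z)"
  using nrm_triangle[of "x \<ominus> y" "y \<ominus> z"] by (simp add: diff_split[of x y z])

lemma nrm_rev_triangle: "\<lbrakk>x \<in> carrier A; y \<in> carrier A\<rbrakk> \<Longrightarrow> \<bar>nrm A x - nrm A y\<bar> \<le> nrm A (x \<ominus> y)"
  using nrm_diff_triangle[of x y \<zero>] nrm_diff_triangle[of y x \<zero>] nrm_diff_swap[of x y] by auto

lemma cauchy_carrier: "X \<in> cauchy_seqs A \<Longrightarrow> X n \<in> carrier A"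
  by (auto simp: cauchy_seqs_def)

lemma cauchyD: "X \<in> cauchy_seqs A \<Longrightarrow> \<epsilon> > 0 \<Longrightarrow> \<exists>M. \<forall>m\<ge>M. \<forall>n\<ge>M. nrm A (X m \<ominus> X n) < \<epsilon>"
  by (auto simp: cauchy_seqs_def)

lemma cauchyI: "(\<And>n. X n \<in> carrier A) \<Longrightarrow>
   (\<And>\<epsilon>. \<epsilon> > 0 \<Longrightarrow> \<exists>M. \<forall>m\<ge>M. \<forall>n\<ge>M. nrm A (X m \<ominus> X n) < \<epsilon>) \<Longrightarrow> X \<in> cauchy_seqs A"
  by (auto simp: cauchy_seqs_def)

lemma cauchy_const [simp]: "x \<in> carrier A \<Longrightarrow> (\<lambda>n. x) \<in> cauchy_seqs A"
  by (rule cauchyI) auto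

lemma cauchy_add: "\<lbrakk>X \<in> cauchy_seqs A; Y \<in> cauchy_seqs A\<rbrakk> \<Longrightarrow> (\<lambda>n. X n \<oplus> Y n) \<in> cauchy_seqs A"
proof (rule cauchyI)
  assume c: "X \<in> cauchy_seqs A" "Y \<in> cauchy_seqs A"
  note cc = cauchy_carrier[OF c(1)] cauchy_carrier[OF c(2)]
  show "X n \<oplus> Y n \<in> carrier A" for n by (simp add: cc)
  fix \<epsilon> :: real assume "\<epsilon> > 0"
  then obtain M N where "\<forall>m\<ge>M. \<forall>n\<ge>M. nrm A (X m \<ominus> X n) < \<epsilon>/2" "\<forall>m\<ge>N. \<forall>n\<ge>N. nrm A (Y m \<ominus> Y n) < \<epsilon>/2"
    using cauchyD[OF c(1), of "\<epsilon>/2"] cauchyD[OF c(2), of "\<epsilon>/2"] by auto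
  moreover have "nrm A ((X m \<oplus> Y m) \<ominus> (X n \<oplus> Y n)) \<le> nrm A (X m \<ominus> X n) + nrm A (Y m \<ominus> Y n)" for m n
    by (subst add_diff) (auto simp: cc intro!: nrm_triangle)
  ultimately show "\<exists>M. \<forall>m\<ge>M. \<forall>n\<ge>M. nrm A ((X m \<oplus> Y m) \<ominus> (X n \<oplus> Y n)) < \<epsilon>"
    by (intro exI[of _ "max M N"]) (smt (verit) field_sum_of_halves max.bounded_iff)
qed

lemma cauchy_star: "X \<in> cauchy_seqs A \<Longrightarrow> (\<lambda>n. star A (X n)) \<in> cauchy_seqs A"
  by (rule cauchyI)
    (auto simp: cauchy_carrier star_closed star_diff[symmetric] dest: cauchyD)

lemma cauchy_smult: "X \<in> cauchy_seqs A \<Longrightarrow> (\<lambda>n. c \<odot> X n) \<in> cauchy_seqs A"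
proof (rule cauchyI)
  assume X: "X \<in> cauchy_seqs A"
  show "c \<odot> X n \<in> carrier A" for n by (simp add: cauchy_carrier[OF X])
  fix \<epsilon> :: real assume e: "\<epsilon> > 0"
  have p: "cmod c + 1 > 0" by (simp add: add_nonneg_pos)
  obtain M where M: "\<forall>m\<ge>M. \<forall>n\<ge>M. nrm A (X m \<ominus> X n) < \<epsilon> / (cmod c + 1)"
    using cauchyD[OF X, of "\<epsilon> / (cmod c + 1)"] e p by auto
  have "nrm A (c \<odot> X m \<ominus> c \<odot> X n) < \<epsilon>" if "m \<ge> M" "n \<ge> M" for m n
  proof -
    have "nrm A (c \<odot> X m \<ominus> c \<odot> X n) = cmod c * nrm A (X m \<ominus> X n)"
      by (simp add: sm_diff cauchy_carrier[OF X] nrm_smult)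
    also have "\<dots> \<le> (cmod c + 1) * nrm A (X m \<ominus> X n)"
      by (intro mult_right_mono) (auto simp: nrm_nonneg cauchy_carrier[OF X])
    also have "\<dots> < \<epsilon>" using M that p by (simp add: pos_less_divide_eq mult.commute)
    finally show ?thesis .
  qed
  then show "\<exists>M. \<forall>m\<ge>M. \<forall>n\<ge>M. nrm A (c \<odot> X m \<ominus> c \<odot> X n) < \<epsilon>" by blast
qed

lemma nrm_Cauchy: "X \<in> cauchy_seqs A \<Longrightarrow> Cauchy (\<lambda>n. nrm A (X n))"
proof (rule metric_CauchyI)
  fix \<epsilon> :: real assume X: "X \<in> cauchy_seqs A" and e: "\<epsilon> > 0"
  obtain M where M: "\<forall>m\<ge>M. \<forall>n\<ge>M. nrm A (X m \<ominus> X n) < \<epsilon>" using cauchyD[OF X e] by auto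
  have "dist (nrm A (X m)) (nrm A (X n)) \<le> nrm A (X m \<ominus> X n)" for m n
    by (auto simp: dist_real_def intro!: nrm_rev_triangle cauchy_carrier[OF X])
  then show "\<exists>M. \<forall>m\<ge>M. \<forall>n\<ge>M. dist (nrm A (X m)) (nrm A (X n)) < \<epsilon>"
    using M by (meson order.strict_trans1)
qed

lemma nrm_convergent: "X \<in> cauchy_seqs A \<Longrightarrow> \<exists>r. (\<lambda>n. nrm A (X n)) \<longlonglongrightarrow> r"
  using nrm_Cauchy Cauchy_convergent convergent_def by blast

lemma nrm_bounded: "X \<in> cauchy_seqs A \<Longrightarrow> \<exists>B>0. \<forall>n. nrm A (X n) \<le> B"
proof -
  assume "X \<in> cauchy_seqs A"
  then have "Bseq (\<lambda>n. nrm A (X n))" using nrm_Cauchy Cauchy_Bseq by blast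
  then obtain B where B: "B > 0" "\<And>n. norm (nrm A (X n)) \<le> B" unfolding Bseq_def by auto
  show ?thesis using B by (intro exI[of _ B]) (auto intro: order_trans[OF abs_ge_self])
qed

lemma cauchy_mult: "\<lbrakk>X \<in> cauchy_seqs A; Y \<in> cauchy_seqs A\<rbrakk> \<Longrightarrow> (\<lambda>n. X n \<otimes> Y n) \<in> cauchy_seqs A"
proof (rule cauchyI)
  assume c: "X \<in> cauchy_seqs A" "Y \<in> cauchy_seqs A"
  note cc = cauchy_carrier[OF c(1)] cauchy_carrier[OF c(2)]
  show "X n \<otimes> Y n \<in> carrier A" for n by (simp add: cc mult_closed)
  obtain B C where B: "B > 0" "\<And>n. nrm A (X n) \<le> B" and C: "C > 0" "\<And>n. nrm A (Y n) \<le> C"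
    using nrm_bounded c by meson
  fix \<epsilon> :: real assume e: "\<epsilon> > 0"
  obtain M N where MN: "\<forall>m\<ge>M. \<forall>n\<ge>M. nrm A (X m \<ominus> X n) < \<epsilon>/(2*C)" "\<forall>m\<ge>N. \<forall>n\<ge>N. nrm A (Y m \<ominus> Y n) < \<epsilon>/(2*B)"
    using cauchyD[OF c(1), of "\<epsilon>/(2*C)"] cauchyD[OF c(2), of "\<epsilon>/(2*B)"] e B(1) C(1) by (auto simp: zero_less_divide_iff)
  have "nrm A ((X m \<otimes> Y m) \<ominus> (X n \<otimes> Y n)) < \<epsilon>" if "m \<ge> max M N" "n \<ge> max M N" for m n
  proof -
    have "nrm A ((X m \<otimes> Y m) \<ominus> (X n \<otimes> Y n)) \<le> nrm A ((X m \<ominus> X n) \<otimes> Y m) + nrm A (X n \<otimes> (Y m \<ominus> Y n))"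
      by (subst mult_diff) (auto simp: cc intro!: nrm_triangle mult_closed)
    also have "\<dots> \<le> nrm A (X m \<ominus> X n) * nrm A (Y m) + nrm A (X n) * nrm A (Y m \<ominus> Y n)"
      by (intro add_mono nrm_mult) (auto simp: cc)
    also have "\<dots> \<le> nrm A (X m \<ominus> X n) * C + B * nrm A (Y m \<ominus> Y n)"
      by (intro add_mono mult_mono) (use B C in \<open>auto simp: cc nrm_nonneg less_imp_le\<close>)
    also have "\<dots> < \<epsilon>/(2*C) * C + B * (\<epsilon>/(2*B))"
      by (intro add_strict_mono mult_strict_right_mono mult_strict_left_mono) (use MN that B C in auto)
    also have "\<dots> = \<epsilon>" using B C by simp
    finally show ?thesis .
  qed
  then show "\<exists>M. \<forall>m\<ge>M. \<forall>n\<ge>M. nrm A ((X m \<otimes> Y m) \<ominus> (X n \<otimes> Y n)) < \<epsilon>" by blast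
qed

definition eqv :: "(nat \<Rightarrow> 'a) \<Rightarrow> (nat \<Rightarrow> 'a) \<Rightarrow> bool" where
  "eqv X Y \<longleftrightarrow> (\<lambda>n. nrm A (X n \<ominus> Y n)) \<longlonglongrightarrow> 0"

lemma eqv_bound: "(\<And>n. X n \<in> carrier A) \<Longrightarrow> (\<And>n. Y n \<in> carrier A) \<Longrightarrow>
    (\<And>n. nrm A (X n \<ominus> Y n) \<le> f n) \<Longrightarrow> f \<longlonglongrightarrow> 0 \<Longrightarrow> eqv X Y"
  unfolding eqv_def
  by (rule real_tendsto_sandwich[where f="\<lambda>n. 0" and h=f]) (auto simp: nrm_nonneg)

lemma eqv_refl: "(\<And>n. X n \<in> carrier A) \<Longrightarrow> eqv X X"
  by (simp add: eqv_def)

lemma eqv_sym: "(\<And>n. X n \<in> carrier A) \<Longrightarrow> (\<And>n. Y n \<in> carrier A) \<Longrightarrow> eqv X Y \<Longrightarrow> eqv Y X"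
  by (simp add: eqv_def nrm_diff_swap)

lemma eqv_trans: "(\<And>n. X n \<in> carrier A) \<Longrightarrow> (\<And>n. Y n \<in> carrier A) \<Longrightarrow> (\<And>n. Z n \<in> carrier A) \<Longrightarrow>
   eqv X Y \<Longrightarrow> eqv Y Z \<Longrightarrow> eqv X Z"
  by (rule eqv_bound[where f="\<lambda>n. nrm A (X n \<ominus> Y n) + nrm A (Y n \<ominus> Z n)"])
     (auto simp: nrm_diff_triangle eqv_def intro: tendsto_add_zero)

lemma in_class: "Y \<in> seq_class A X \<longleftrightarrow> Y \<in> cauchy_seqs A \<and> eqv X Y"
  by (simp add: seq_class_def eqv_def)

lemma self_in_class: "X \<in> cauchy_seqs A \<Longrightarrow> X \<in> seq_class A X"
  by (simp add: in_class eqv_refl cauchy_carrier)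

lemma class_eqI: "X \<in> cauchy_seqs A \<Longrightarrow> Y \<in> cauchy_seqs A \<Longrightarrow> eqv X Y \<Longrightarrow> seq_class A X = seq_class A Y"
  by (auto simp: in_class) (meson eqv_sym eqv_trans cauchy_carrier)+

lemma class_eq: "X \<in> cauchy_seqs A \<Longrightarrow> Y \<in> cauchy_seqs A \<Longrightarrow> seq_class A X = seq_class A Y \<longleftrightarrow> eqv X Y"
  using class_eqI self_in_class in_class by blast

lemma eqv_add: "X \<in> cauchy_seqs A \<Longrightarrow> Y \<in> cauchy_seqs A \<Longrightarrow> X' \<in> cauchy_seqs A \<Longrightarrow> Y' \<in> cauchy_seqs A \<Longrightarrow>
   eqv X X' \<Longrightarrow> eqv Y Y' \<Longrightarrow> eqv (\<lambda>n. X n \<oplus> Y n) (\<lambda>n. X' n \<oplus> Y' n)"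
  by (rule eqv_bound[where f="\<lambda>n. nrm A (X n \<ominus> X' n) + nrm A (Y n \<ominus> Y' n)"])
     (auto simp: cauchy_carrier add_diff eqv_def intro: tendsto_add_zero nrm_triangle)

lemma eqv_smult: "X \<in> cauchy_seqs A \<Longrightarrow> X' \<in> cauchy_seqs A \<Longrightarrow>
   eqv X X' \<Longrightarrow> eqv (\<lambda>n. c \<odot> X n) (\<lambda>n. c \<odot> X' n)"
  by (rule eqv_bound[where f="\<lambda>n. cmod c * nrm A (X n \<ominus> X' n)"])
     (auto simp: cauchy_carrier sm_diff nrm_smult eqv_def intro: tendsto_mult_right_zero)

lemma eqv_star: "X \<in> cauchy_seqs A \<Longrightarrow> X' \<in> cauchy_seqs A \<Longrightarrow>
   eqv X X' \<Longrightarrow> eqv (\<lambda>n. star A (X n)) (\<lambda>n. star A (X' n))"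
  by (rule eqv_bound[where f="\<lambda>n. nrm A (X n \<ominus> X' n)"])
     (auto simp: cauchy_carrier star_diff[symmetric] star_closed eqv_def)

lemma eqv_mult:
  assumes c: "X \<in> cauchy_seqs A" "Y \<in> cauchy_seqs A" "X' \<in> cauchy_seqs A" "Y' \<in> cauchy_seqs A"
    and e: "eqv X X'" "eqv Y Y'"
  shows "eqv (\<lambda>n. X n \<otimes> Y n) (\<lambda>n. X' n \<otimes> Y' n)"
proof -
  note cc = c[THEN cauchy_carrier]
  obtain B C where B: "B > 0" "\<And>n. nrm A (X' n) \<le> B" and C: "C > 0" "\<And>n. nrm A (Y n) \<le> C"
    using nrm_bounded c by meson
  show ?thesis
  proof (rule eqv_bound[where f="\<lambda>n. nrm A (X n \<ominus> X' n) * C + B * nrm A (Y n \<ominus> Y' n)"])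
    fix n
    show "X n \<otimes> Y n \<in> carrier A" "X' n \<otimes> Y' n \<in> carrier A" by (auto simp: cc mult_closed)
    have "nrm A (X n \<otimes> Y n \<ominus> X' n \<otimes> Y' n) \<le> nrm A ((X n \<ominus> X' n) \<otimes> Y n) + nrm A (X' n \<otimes> (Y n \<ominus> Y' n))"
      by (subst mult_diff) (auto simp: cc intro!: nrm_triangle mult_closed)
    also have "\<dots> \<le> nrm A (X n \<ominus> X' n) * nrm A (Y n) + nrm A (X' n) * nrm A (Y n \<ominus> Y' n)"
      by (intro add_mono nrm_mult) (auto simp: cc)
    also have "\<dots> \<le> nrm A (X n \<ominus> X' n) * C + B * nrm A (Y n \<ominus> Y' n)"
      by (intro add_mono mult_mono) (use B C in \<open>auto simp: cc nrm_nonneg less_imp_le\<close>)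
    finally show "nrm A (X n \<otimes> Y n \<ominus> X' n \<otimes> Y' n) \<le> nrm A (X n \<ominus> X' n) * C + B * nrm A (Y n \<ominus> Y' n)" .
  next
    show "(\<lambda>n. nrm A (X n \<ominus> X' n) * C + B * nrm A (Y n \<ominus> Y' n)) \<longlonglongrightarrow> 0"
      using e unfolding eqv_def
      by (intro tendsto_add_zero tendsto_mult_left_zero tendsto_mult_right_zero)
  qed
qed

abbreviation "compl_alg \<equiv> completion A"

lemma UN1: "X \<in> S \<Longrightarrow> (\<And>Z. Z \<in> S \<Longrightarrow> f Z = T) \<Longrightarrow> (\<Union>Z\<in>S. f Z) = T"
  by auto

lemma UN2: "X \<in> S \<Longrightarrow> Y \<in> S' \<Longrightarrow> (\<And>Z W. Z \<in> S \<Longrightarrow> W \<in> S' \<Longrightarrow> f Z W = T) \<Longrightarrow>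
    (\<Union>Z\<in>S. \<Union>W\<in>S'. f Z W) = T"
  by (intro UN1) auto

lemma compl_carrier: "carrier compl_alg = seq_class A ` cauchy_seqs A"
  by (simp add: completion_def)

lemma compl_zero: "\<zero>\<^bsub>compl_alg\<^esub> = seq_class A (\<lambda>n. \<zero>)"
  by (simp add: completion_def)

lemma compl_add: "X \<in> cauchy_seqs A \<Longrightarrow> Y \<in> cauchy_seqs A \<Longrightarrow>
   seq_class A X \<oplus>\<^bsub>compl_alg\<^esub> seq_class A Y = seq_class A (\<lambda>n. X n \<oplus> Y n)"
proof -
  assume c: "X \<in> cauchy_seqs A" "Y \<in> cauchy_seqs A"
  have *: "seq_class A (\<lambda>n. X' n \<oplus> Y' n) = seq_class A (\<lambda>n. X n \<oplus> Y n)"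
    if "X' \<in> seq_class A X" "Y' \<in> seq_class A Y" for X' Y'
    using that c by (intro class_eqI cauchy_add eqv_add) (auto simp: in_class intro: eqv_sym cauchy_carrier)
  show ?thesis unfolding completion_def using c by simp (rule UN2[OF self_in_class self_in_class *])
qed

lemma compl_mult: "X \<in> cauchy_seqs A \<Longrightarrow> Y \<in> cauchy_seqs A \<Longrightarrow>
   seq_class A X \<otimes>\<^bsub>compl_alg\<^esub> seq_class A Y = seq_class A (\<lambda>n. X n \<otimes> Y n)"
proof -
  assume c: "X \<in> cauchy_seqs A" "Y \<in> cauchy_seqs A"
  have *: "seq_class A (\<lambda>n. X' n \<otimes> Y' n) = seq_class A (\<lambda>n. X n \<otimes> Y n)"
    if "X' \<in> seq_class A X" "Y' \<in> seq_class A Y" for X' Y'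
    using that c by (intro class_eqI cauchy_mult eqv_mult) (auto simp: in_class intro: eqv_sym cauchy_carrier)
  show ?thesis unfolding completion_def using c by simp (rule UN2[OF self_in_class self_in_class *])
qed

lemma compl_smult: "X \<in> cauchy_seqs A \<Longrightarrow> c \<odot>\<^bsub>compl_alg\<^esub> seq_class A X = seq_class A (\<lambda>n. c \<odot> X n)"
proof -
  assume c: "X \<in> cauchy_seqs A"
  have *: "seq_class A (\<lambda>n. c \<odot> X' n) = seq_class A (\<lambda>n. c \<odot> X n)" if "X' \<in> seq_class A X" for X'
    using that c by (intro class_eqI cauchy_smult eqv_smult) (auto simp: in_class intro: eqv_sym cauchy_carrier)
  show ?thesis unfolding completion_def using c by simp (rule UN1[OF self_in_class *])
qed

lemma compl_star: "X \<in> cauchy_seqs A \<Longrightarrow> star compl_alg (seq_class A X) = seq_class A (\<lambda>n. star A (X n))"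
proof -
  assume c: "X \<in> cauchy_seqs A"
  have *: "seq_class A (\<lambda>n. star A (X' n)) = seq_class A (\<lambda>n. star A (X n))" if "X' \<in> seq_class A X" for X'
    using that c by (intro class_eqI cauchy_star eqv_star) (auto simp: in_class intro: eqv_sym cauchy_carrier)
  show ?thesis unfolding completion_def using c by simp (rule UN1[OF self_in_class *])
qed

lemma compl_nrm: assumes X: "X \<in> cauchy_seqs A"
  shows "(\<lambda>n. nrm A (X n)) \<longlonglongrightarrow> nrm compl_alg (seq_class A X)"
proof -
  obtain r where r: "(\<lambda>n. nrm A (X n)) \<longlonglongrightarrow> r" using nrm_convergent X by blast
  have "(\<lambda>n. nrm A (Z n)) \<longlonglongrightarrow> r" if Z: "Z \<in> seq_class A X" for Z
  proof -
    have "(\<lambda>n. nrm A (Z n) - nrm A (X n)) \<longlonglongrightarrow> 0"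
    proof (rule tendsto_0_le[where f="\<lambda>n. nrm A (X n \<ominus> Z n)" and K=1])
      have "\<bar>nrm A (Z n) - nrm A (X n)\<bar> \<le> nrm A (X n \<ominus> Z n)" for n
        using Z X nrm_rev_triangle[of "X n" "Z n"] by (simp add: in_class cauchy_carrier abs_minus_commute)
      then show "\<forall>\<^sub>F n in sequentially. norm (nrm A (Z n) - nrm A (X n)) \<le> norm (nrm A (X n \<ominus> Z n)) * 1"
        by (auto intro!: always_eventually order_trans[OF _ abs_ge_self])
      show "(\<lambda>n. nrm A (X n \<ominus> Z n)) \<longlonglongrightarrow> 0" using Z by (simp add: in_class eqv_def)
    qed
    from tendsto_add[OF this r] show ?thesis by simp
  qed
  then have "(THE r. \<forall>Z\<in>seq_class A X. (\<lambda>n. nrm A (Z n)) \<longlonglongrightarrow> r) = r"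
    using self_in_class[OF X] by (intro the_equality) (auto intro: LIMSEQ_unique)
  then show ?thesis using r by (simp add: completion_def)
qed

lemma compl_nrm_const: "x \<in> carrier A \<Longrightarrow> nrm compl_alg (const_class A x) = nrm A x"
  using compl_nrm[of "\<lambda>n. x"] LIMSEQ_unique[OF _ tendsto_const] by force


lemma star_algebra_completion: "star_algebra compl_alg"
proof -
  have ag: "abelian_group compl_alg"
  proof (rule abelian_groupI)
    fix x assume "x \<in> carrier compl_alg"
    then obtain X where X: "X \<in> cauchy_seqs A" "x = seq_class A X" by (auto simp: compl_carrier)
    have "seq_class A (\<lambda>n. (-1) \<odot> X n) \<oplus>\<^bsub>compl_alg\<^esub> x = seq_class A (\<lambda>n. (-1) \<odot> X n \<oplus> X n)"
      using X by (simp add: compl_add cauchy_smult)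
    also have "(\<lambda>n. (-1) \<odot> X n \<oplus> X n) = (\<lambda>n. \<zero>)"
      using sm_ldist[of _ "-1" 1, symmetric] cauchy_carrier[OF X(1)] by simp
    finally show "\<exists>y\<in>carrier compl_alg. y \<oplus>\<^bsub>compl_alg\<^esub> x = \<zero>\<^bsub>compl_alg\<^esub>"
      using X by (auto simp: compl_zero compl_carrier intro!: bexI[of _ "seq_class A (\<lambda>n. (-1) \<odot> X n)"] imageI cauchy_smult)
  qed (auto simp: compl_carrier compl_zero compl_add cauchy_add cauchy_carrier M.a_ac cong: )
  have m: "Module.module complex_ring compl_alg"
    by (rule Module.moduleI[OF cring_complex_ring ag])
       (auto simp: compl_carrier compl_add compl_smult cauchy_add cauchy_smult cauchy_carrier sm_ldist sm_rdist sm_assoc)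
  note cl = cauchy_carrier cauchy_add cauchy_smult cauchy_mult cauchy_star
  note op = compl_add compl_smult compl_mult compl_star
  show ?thesis
  proof (rule star_algebra.intro[OF m], rule star_algebra_axioms.intro)
    fix x y z c
    assume "x \<in> carrier compl_alg"
    then obtain X where X: "X \<in> cauchy_seqs A" "x = seq_class A X" by (auto simp: compl_carrier)
    show "star compl_alg x \<in> carrier compl_alg" "star compl_alg (star compl_alg x) = x" "star compl_alg (c \<odot>\<^bsub>compl_alg\<^esub> x) = cnj c \<odot>\<^bsub>compl_alg\<^esub> star compl_alg x"
      using X by (simp_all add: op cl compl_carrier star_star star_smult)
    assume "y \<in> carrier compl_alg"
    then obtain Y where Y: "Y \<in> cauchy_seqs A" "y = seq_class A Y" by (auto simp: compl_carrier)
    show "x \<otimes>\<^bsub>compl_alg\<^esub> y \<in> carrier compl_alg"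
      "c \<odot>\<^bsub>compl_alg\<^esub> x \<otimes>\<^bsub>compl_alg\<^esub> y = c \<odot>\<^bsub>compl_alg\<^esub> (x \<otimes>\<^bsub>compl_alg\<^esub> y)"
      "x \<otimes>\<^bsub>compl_alg\<^esub> (c \<odot>\<^bsub>compl_alg\<^esub> y) = c \<odot>\<^bsub>compl_alg\<^esub> (x \<otimes>\<^bsub>compl_alg\<^esub> y)"
      "star compl_alg (x \<oplus>\<^bsub>compl_alg\<^esub> y) = star compl_alg x \<oplus>\<^bsub>compl_alg\<^esub> star compl_alg y"
      "star compl_alg (x \<otimes>\<^bsub>compl_alg\<^esub> y) = star compl_alg y \<otimes>\<^bsub>compl_alg\<^esub> star compl_alg x"
      using X Y by (simp_all add: op cl compl_carrier star_add star_mult smult_mult_left smult_mult_right)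
    assume "z \<in> carrier compl_alg"
    then obtain Z where Z: "Z \<in> cauchy_seqs A" "z = seq_class A Z" by (auto simp: compl_carrier)
    show "x \<otimes>\<^bsub>compl_alg\<^esub> y \<otimes>\<^bsub>compl_alg\<^esub> z = x \<otimes>\<^bsub>compl_alg\<^esub> (y \<otimes>\<^bsub>compl_alg\<^esub> z)"
      "x \<otimes>\<^bsub>compl_alg\<^esub> (y \<oplus>\<^bsub>compl_alg\<^esub> z) = x \<otimes>\<^bsub>compl_alg\<^esub> y \<oplus>\<^bsub>compl_alg\<^esub> x \<otimes>\<^bsub>compl_alg\<^esub> z"
      "(x \<oplus>\<^bsub>compl_alg\<^esub> y) \<otimes>\<^bsub>compl_alg\<^esub> z = x \<otimes>\<^bsub>compl_alg\<^esub> z \<oplus>\<^bsub>compl_alg\<^esub> y \<otimes>\<^bsub>compl_alg\<^esub> z"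
      using X Y Z by (simp_all add: op cl mult_assoc distrib_left distrib_right)
  qed
qed


interpretation compl: star_algebra compl_alg by (rule star_algebra_completion)

lemma compl_minus: "X \<in> cauchy_seqs A \<Longrightarrow> Y \<in> cauchy_seqs A \<Longrightarrow>
   seq_class A X \<ominus>\<^bsub>compl_alg\<^esub> seq_class A Y = seq_class A (\<lambda>n. X n \<ominus> Y n)"
  by (simp add: compl.minus_sm compl_carrier compl_smult cauchy_smult compl_add minus_sm cauchy_carrier)

lemma cauchy_minus: "X \<in> cauchy_seqs A \<Longrightarrow> Y \<in> cauchy_seqs A \<Longrightarrow> (\<lambda>n. X n \<ominus> Y n) \<in> cauchy_seqs A"
  using cauchy_add[of X "\<lambda>n. (-1) \<odot> Y n"] cauchy_smult[of Y "-1"] by (simp add: minus_sm cauchy_carrier)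

lemma pre_cstar_completion: "pre_cstar_algebra compl_alg"
proof
  fix x y c
  assume "x \<in> carrier compl_alg"
  then obtain X where X: "X \<in> cauchy_seqs A" "x = seq_class A X" by (auto simp: compl_carrier)
  note nX = compl_nrm[OF X(1)]
  show "0 \<le> nrm compl_alg x" using nX X by (auto intro!: LIMSEQ_le_const[OF nX] nrm_nonneg cauchy_carrier)
  show "nrm compl_alg (c \<odot>\<^bsub>compl_alg\<^esub> x) = cmod c * nrm compl_alg x"
    using compl_nrm[OF cauchy_smult[OF X(1), of c]] tendsto_mult_left[OF nX, of "cmod c"] X
    by (simp add: compl_smult nrm_smult cauchy_carrier LIMSEQ_unique)
  have "(\<lambda>n. nrm A (star A (X n) \<otimes> X n)) \<longlonglongrightarrow> nrm compl_alg (star compl_alg x \<otimes>\<^bsub>compl_alg\<^esub> x)"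
    using compl_nrm[OF cauchy_mult[OF cauchy_star[OF X(1)] X(1)]] X by (simp add: compl_star compl_mult cauchy_star)
  moreover have "(\<lambda>n. nrm A (star A (X n) \<otimes> X n)) \<longlonglongrightarrow> (nrm compl_alg x)\<^sup>2"
    using tendsto_power[OF nX, of 2] X by (simp add: cstar_identity cauchy_carrier)
  ultimately show "nrm compl_alg (star compl_alg x \<otimes>\<^bsub>compl_alg\<^esub> x) = (nrm compl_alg x)\<^sup>2" using LIMSEQ_unique by blast
  assume "y \<in> carrier compl_alg"
  then obtain Y where Y: "Y \<in> cauchy_seqs A" "y = seq_class A Y" by (auto simp: compl_carrier)
  note nY = compl_nrm[OF Y(1)]
  show "nrm compl_alg (x \<oplus>\<^bsub>compl_alg\<^esub> y) \<le> nrm compl_alg x + nrm compl_alg y"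
    using tendsto_add[OF nX nY] compl_nrm[OF cauchy_add[OF X(1) Y(1)]] X Y
    by (auto simp: compl_add intro!: LIMSEQ_le nrm_triangle cauchy_carrier)
  show "nrm compl_alg (x \<otimes>\<^bsub>compl_alg\<^esub> y) \<le> nrm compl_alg x * nrm compl_alg y"
    using tendsto_mult[OF nX nY] compl_nrm[OF cauchy_mult[OF X(1) Y(1)]] X Y
    by (auto simp: compl_mult intro!: LIMSEQ_le nrm_mult cauchy_carrier)
qed

interpretation compl: pre_cstar_algebra compl_alg by (rule pre_cstar_completion)

lemma const_class_carrier [simp]: "x \<in> carrier A \<Longrightarrow> const_class A x \<in> carrier compl_alg"
  by (simp add: compl_carrier)

lemma const_approx: assumes X: "X \<in> cauchy_seqs A"
  shows "converges_to compl_alg (\<lambda>k. const_class A (X k)) (seq_class A X)"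
  unfolding converges_to_def
proof (rule LIMSEQ_I)
  fix e :: real assume e: "e > 0"
  obtain M where M: "\<forall>m\<ge>M. \<forall>n\<ge>M. nrm A (X m \<ominus> X n) < e/2" using cauchyD[OF X, of "e/2"] e by auto
  have "nrm compl_alg (const_class A (X k) \<ominus>\<^bsub>compl_alg\<^esub> seq_class A X) \<le> e/2" if k: "k \<ge> M" for k
  proof -
    have "(\<lambda>n. nrm A (X k \<ominus> X n)) \<longlonglongrightarrow> nrm compl_alg (const_class A (X k) \<ominus>\<^bsub>compl_alg\<^esub> seq_class A X)"
      using compl_nrm[OF cauchy_minus[OF cauchy_const X]] X by (simp add: compl_minus cauchy_carrier)
    then show ?thesis by (rule LIMSEQ_le_const2) (use M k less_imp_le in blast)
  qed
  moreover have "0 \<le> nrm compl_alg (const_class A (X k) \<ominus>\<^bsub>compl_alg\<^esub> seq_class A X)" for k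
    using X by (intro compl.nrm_nonneg compl.M.minus_closed) (auto simp: compl_carrier cauchy_carrier)
  ultimately show "\<exists>no. \<forall>n\<ge>no. norm (nrm compl_alg (const_class A (X n) \<ominus>\<^bsub>compl_alg\<^esub> seq_class A X) - 0) < e"
    using e by (intro exI[of _ M]) (auto intro: order.strict_trans1[of _ "e/2"])
qed

theorem cstar_completion: "cstar_algebra compl_alg"
proof
  fix x assume "x \<in> carrier compl_alg" and n: "nrm compl_alg x = 0"
  then obtain X where X: "X \<in> cauchy_seqs A" "x = seq_class A X" by (auto simp: compl_carrier)
  show "x = \<zero>\<^bsub>compl_alg\<^esub>" using X n compl_nrm[OF X(1)] unfolding X(2) compl_zero
    by (intro class_eqI) (auto simp: eqv_def cauchy_carrier)
next
  fix U assume U: "U \<in> cauchy_seqs compl_alg"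
  have Uc: "U k \<in> carrier compl_alg" for k using U by (auto simp: cauchy_seqs_def)
  have "\<exists>y\<in>carrier A. nrm compl_alg (const_class A y \<ominus>\<^bsub>compl_alg\<^esub> U k) < 1 / Suc k" for k
  proof -
    obtain X where X: "X \<in> cauchy_seqs A" "U k = seq_class A X" using Uc[of k] by (auto simp: compl_carrier)
    from const_approx[OF X(1)] have "\<exists>j. norm (nrm compl_alg (const_class A (X j) \<ominus>\<^bsub>compl_alg\<^esub> U k) - 0) < 1 / Suc k"
      unfolding converges_to_def X(2) using LIMSEQ_D[of _ 0 "1 / Suc k"] by fastforce
    then show ?thesis using cauchy_carrier[OF X(1)] by (auto dest!: abs_less_iff[THEN iffD1])
  qed
  then obtain y where y: "\<And>k. y k \<in> carrier A" "\<And>k. nrm compl_alg (const_class A (y k) \<ominus>\<^bsub>compl_alg\<^esub> U k) < 1 / Suc k"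
    by metis
  let ?c = "\<lambda>k. const_class A (y k)"
  have cc: "?c k \<in> carrier compl_alg" for k using y by simp
  have lim: "(\<lambda>k. nrm compl_alg (?c k \<ominus>\<^bsub>compl_alg\<^esub> U k)) \<longlonglongrightarrow> 0"
  proof (rule real_tendsto_sandwich[where f="\<lambda>n. 0" and h="\<lambda>k. 1 / Suc k"])
    show "\<forall>\<^sub>F k in sequentially. 0 \<le> nrm compl_alg (?c k \<ominus>\<^bsub>compl_alg\<^esub> U k)"
      using cc Uc by (intro always_eventually allI compl.nrm_nonneg compl.M.minus_closed)
    show "\<forall>\<^sub>F k in sequentially. nrm compl_alg (?c k \<ominus>\<^bsub>compl_alg\<^esub> U k) \<le> 1 / Suc k"
      by (intro always_eventually allI less_imp_le y(2))
    show "(\<lambda>k. 1 / real (Suc k)) \<longlonglongrightarrow> 0" by (rule LIMSEQ_Suc[OF lim_inverse_n'])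
  qed simp
  have Y: "y \<in> cauchy_seqs A"
  proof (rule cauchyI[OF y(1)])
    fix e :: real assume e: "e > 0"
    obtain M where M: "\<forall>m\<ge>M. \<forall>n\<ge>M. nrm compl_alg (U m \<ominus>\<^bsub>compl_alg\<^esub> U n) < e/3" using compl.cauchyD[OF U, of "e/3"] e by auto
    obtain N where N: "\<forall>k\<ge>N. norm (nrm compl_alg (?c k \<ominus>\<^bsub>compl_alg\<^esub> U k) - 0) < e/3" using LIMSEQ_D[OF lim, of "e/3"] e by auto
    have "nrm A (y m \<ominus> y n) < e" if "m \<ge> max M N" "n \<ge> max M N" for m n
    proof -
      have "nrm A (y m \<ominus> y n) = nrm compl_alg (?c m \<ominus>\<^bsub>compl_alg\<^esub> ?c n)"
        using y by (simp add: compl_minus compl_nrm_const)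
      also have "\<dots> \<le> nrm compl_alg (?c m \<ominus>\<^bsub>compl_alg\<^esub> U m) + (nrm compl_alg (U m \<ominus>\<^bsub>compl_alg\<^esub> U n) + nrm compl_alg (U n \<ominus>\<^bsub>compl_alg\<^esub> ?c n))"
        using compl.nrm_diff_triangle[OF cc[of m] Uc[of m] cc[of n]] compl.nrm_diff_triangle[OF Uc[of m] Uc[of n] cc[of n]] by linarith
      also have "nrm compl_alg (U n \<ominus>\<^bsub>compl_alg\<^esub> ?c n) = nrm compl_alg (?c n \<ominus>\<^bsub>compl_alg\<^esub> U n)" by (rule compl.nrm_diff_swap[OF Uc cc])
      also have "nrm compl_alg (?c m \<ominus>\<^bsub>compl_alg\<^esub> U m) + (nrm compl_alg (U m \<ominus>\<^bsub>compl_alg\<^esub> U n) + nrm compl_alg (?c n \<ominus>\<^bsub>compl_alg\<^esub> U n)) < e/3 + (e/3 + e/3)"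
        using M N that by (intro add_strict_mono) auto
      finally show ?thesis by simp
    qed
    then show "\<exists>M. \<forall>m\<ge>M. \<forall>n\<ge>M. nrm A (y m \<ominus> y n) < e" by blast
  qed
  let ?l = "seq_class A y"
  have l: "?l \<in> carrier compl_alg" using Y by (simp add: compl_carrier)
  have "converges_to compl_alg U ?l" unfolding converges_to_def
  proof (rule real_tendsto_sandwich[where f="\<lambda>n. 0" and h="\<lambda>k. nrm compl_alg (?c k \<ominus>\<^bsub>compl_alg\<^esub> U k) + nrm compl_alg (?c k \<ominus>\<^bsub>compl_alg\<^esub> ?l)"])
    show "(\<lambda>k. nrm compl_alg (?c k \<ominus>\<^bsub>compl_alg\<^esub> U k) + nrm compl_alg (?c k \<ominus>\<^bsub>compl_alg\<^esub> ?l)) \<longlonglongrightarrow> 0"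
      using lim const_approx[OF Y] unfolding converges_to_def by (rule tendsto_add_zero)
    have "nrm compl_alg (U k \<ominus>\<^bsub>compl_alg\<^esub> ?l) \<le> nrm compl_alg (?c k \<ominus>\<^bsub>compl_alg\<^esub> U k) + nrm compl_alg (?c k \<ominus>\<^bsub>compl_alg\<^esub> ?l)" for k
      using compl.nrm_diff_triangle[OF Uc[of k] cc[of k] l] compl.nrm_diff_swap[OF Uc[of k] cc[of k]] by simp
    then show "\<forall>\<^sub>F k in sequentially. nrm compl_alg (U k \<ominus>\<^bsub>compl_alg\<^esub> ?l) \<le> nrm compl_alg (?c k \<ominus>\<^bsub>compl_alg\<^esub> U k) + nrm compl_alg (?c k \<ominus>\<^bsub>compl_alg\<^esub> ?l)" by simp
  qed (auto intro!: eventuallyI compl.nrm_nonneg compl.M.minus_closed Uc l)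
  then show "\<exists>l\<in>carrier compl_alg. converges_to compl_alg U l" using l by blast
qed


end

definition monomial :: "complex \<Rightarrow> ('g \<times> bool) list \<Rightarrow> 'g words_fun" where
  "monomial c w = (\<lambda>u. if u = w then c else 0)"

lemma free_simps:
  "carrier (free_star_alg G N) = {f. finite {w. f w \<noteq> 0} \<and> {w. f w \<noteq> 0} \<subseteq> words G}"
  "f \<otimes>\<^bsub>free_star_alg G N\<^esub> g = (\<lambda>w. \<Sum>i\<le>length w. f (take i w) * g (drop i w))"
  "f \<oplus>\<^bsub>free_star_alg G N\<^esub> g = (\<lambda>w. f w + g w)"
  "c \<odot>\<^bsub>free_star_alg G N\<^esub> f = (\<lambda>w. c * f w)"
  "star (free_star_alg G N) f = (\<lambda>w. cnj (f (adj_word w)))"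
  "\<zero>\<^bsub>free_star_alg G N\<^esub> = (\<lambda>w. 0)"
  "nrm (free_star_alg G N) = N"
  by (simp_all add: free_star_alg_def)

lemma adj_adj [simp]: "adj_word (adj_word w) = w"
  by (simp add: adj_word_def rev_map comp_def case_prod_unfold)

lemma adj_append: "adj_word (u @ v) = adj_word v @ adj_word u"
  by (simp add: adj_word_def)

lemma adj_words: "w \<in> words G \<Longrightarrow> adj_word w \<in> words G"
  by (force simp: words_def adj_word_def)

lemma append_words: "u \<in> words G \<Longrightarrow> v \<in> words G \<Longrightarrow> u @ v \<in> words G"
  by (auto simp: words_def)

lemma free_gen_mono: "free_gen x = monomial 1 [(x, False)]"
  by (simp add: free_gen_def monomial_def)

context fixes G :: "'g set" and N :: "'g words_fun \<Rightarrow> real" begin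

abbreviation "falg \<equiv> free_star_alg G N"

lemma mono_carrier [simp]: "w \<in> words G \<Longrightarrow> monomial c w \<in> carrier falg"
  by (auto simp: free_simps monomial_def)

lemma free_add_closed: "f \<in> carrier falg \<Longrightarrow> g \<in> carrier falg \<Longrightarrow> f \<oplus>\<^bsub>falg\<^esub> g \<in> carrier falg"
proof -
  assume "f \<in> carrier falg" "g \<in> carrier falg"
  moreover have "{w. f w + g w \<noteq> 0} \<subseteq> {w. f w \<noteq> 0} \<union> {w. g w \<noteq> 0}" by auto
  ultimately show ?thesis by (auto simp: free_simps intro: finite_subset)
qed

lemma free_smult_closed: "f \<in> carrier falg \<Longrightarrow> c \<odot>\<^bsub>falg\<^esub> f \<in> carrier falg"
proof -
  assume "f \<in> carrier falg"
  moreover have "{w. c * f w \<noteq> 0} \<subseteq> {w. f w \<noteq> 0}" by auto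
  ultimately show ?thesis by (auto simp: free_simps intro: finite_subset)
qed

lemma free_mult_closed: "f \<in> carrier falg \<Longrightarrow> g \<in> carrier falg \<Longrightarrow> f \<otimes>\<^bsub>falg\<^esub> g \<in> carrier falg"
proof -
  assume f: "f \<in> carrier falg" and g: "g \<in> carrier falg"
  have s: "{w. (f \<otimes>\<^bsub>falg\<^esub> g) w \<noteq> 0} \<subseteq> (\<lambda>(u, v). u @ v) ` ({w. f w \<noteq> 0} \<times> {w. g w \<noteq> 0})"
  proof
    fix w assume "w \<in> {w. (f \<otimes>\<^bsub>falg\<^esub> g) w \<noteq> 0}"
    then have "(\<Sum>i\<le>length w. f (take i w) * g (drop i w)) \<noteq> 0" by (simp add: free_simps)
    then obtain i where "f (take i w) * g (drop i w) \<noteq> 0" by (meson sum.not_neutral_contains_not_neutral)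
    then show "w \<in> (\<lambda>(u, v). u @ v) ` ({w. f w \<noteq> 0} \<times> {w. g w \<noteq> 0})"
      by (intro image_eqI[of _ _ "(take i w, drop i w)"]) auto
  qed
  then have "finite {w. (f \<otimes>\<^bsub>falg\<^esub> g) w \<noteq> 0}" using f g by (auto simp: free_simps(1) intro: finite_subset)
  moreover have "{w. (f \<otimes>\<^bsub>falg\<^esub> g) w \<noteq> 0} \<subseteq> words G"
    using s f g by (auto simp: free_simps(1) intro!: append_words)
  ultimately show ?thesis by (simp add: free_simps(1))
qed

lemma free_star_closed: "f \<in> carrier falg \<Longrightarrow> star falg f \<in> carrier falg"
proof -
  assume f: "f \<in> carrier falg"
  have s: "{w. star falg f w \<noteq> 0} \<subseteq> adj_word ` {w. f w \<noteq> 0}"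
  proof
    fix w assume "w \<in> {w. star falg f w \<noteq> 0}"
    then show "w \<in> adj_word ` {w. f w \<noteq> 0}"
      by (intro image_eqI[of w adj_word "adj_word w"]) (auto simp: free_simps)
  qed
  have f1: "finite {w. f w \<noteq> 0}" "{w. f w \<noteq> 0} \<subseteq> words G" using f by (simp_all add: free_simps(1))
  have "finite {w. star falg f w \<noteq> 0}" by (rule finite_subset[OF s finite_imageI[OF f1(1)]])
  moreover have "{w. star falg f w \<noteq> 0} \<subseteq> words G" using s f1(2) adj_words by blast
  ultimately show ?thesis unfolding free_simps(1) by blast
qed

lemma free_induct [consumes 1, case_names zero add]:
  assumes f: "f \<in> carrier falg" and z: "P (\<lambda>w. 0)"
    and a: "\<And>f c w. f \<in> carrier falg \<Longrightarrow> w \<in> words G \<Longrightarrow> P f \<Longrightarrow> P (f \<oplus>\<^bsub>falg\<^esub> monomial c w)"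
  shows "P f"
proof -
  have "\<forall>f. {w. f w \<noteq> 0} \<subseteq> S \<longrightarrow> P f" if "finite S" "S \<subseteq> words G" for S
    using that
  proof (induction S)
    case empty
    show ?case
    proof (intro allI impI)
      fix f :: "'g words_fun" assume "{w. f w \<noteq> 0} \<subseteq> {}"
      then have "f = (\<lambda>w. 0)" by (intro ext) blast
      then show "P f" using z by simp
    qed
  next
    case (insert x S)
    show ?case
    proof (intro allI impI)
      fix f :: "'g words_fun" assume fs: "{w. f w \<noteq> 0} \<subseteq> insert x S"
      let ?g = "f(x := 0)"
      have gs: "{w. ?g w \<noteq> 0} \<subseteq> S" using fs by auto
      have "finite {w. ?g w \<noteq> 0}" by (rule finite_subset[OF gs insert.hyps(1)])
      moreover have "{w. ?g w \<noteq> 0} \<subseteq> words G" using gs insert.prems by blast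
      ultimately have "?g \<in> carrier falg" unfolding free_simps(1) by blast
      moreover have "P ?g" using insert.IH insert.prems gs by blast
      moreover have "x \<in> words G" using insert.prems by blast
      ultimately have "P (?g \<oplus>\<^bsub>falg\<^esub> monomial (f x) x)" using a by blast
      moreover have "?g \<oplus>\<^bsub>falg\<^esub> monomial (f x) x = f" by (auto simp: free_simps monomial_def)
      ultimately show "P f" by simp
    qed
  qed
  from this[of "{w. f w \<noteq> 0}"] show ?thesis using f by (simp add: free_simps(1))
qed

lemma mono_mult: "monomial c u \<otimes>\<^bsub>falg\<^esub> monomial d v = monomial (c * d) (u @ v)"
proof
  fix w
  have "(\<Sum>i\<le>length w. monomial c u (take i w) * monomial d v (drop i w)) = (if w = u @ v then c * d else 0)"
  proof (cases "w = u @ v")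
    case True
    have "(\<Sum>i\<le>length w. monomial c u (take i w) * monomial d v (drop i w)) = (\<Sum>i\<in>{length u}. monomial c u (take i w) * monomial d v (drop i w))"
    proof (rule sum.mono_neutral_right)
      have False if "i \<le> length w" "i \<noteq> length u" "take i w = u" for i
        using that by (metis length_take min.absorb2)
      then show "\<forall>i\<in>{..length w} - {length u}. monomial c u (take i w) * monomial d v (drop i w) = 0"
        by (auto simp: monomial_def)
    qed (use True in auto)
    then show ?thesis using True by (simp add: monomial_def)
  next
    case False
    then have "\<not> (take i w = u \<and> drop i w = v)" for i by (metis append_take_drop_id)
    then show ?thesis using False by (auto simp: monomial_def intro!: sum.neutral)
  qed
  then show "(monomial c u \<otimes>\<^bsub>falg\<^esub> monomial d v) w = monomial (c * d) (u @ v) w" by (simp add: free_simps monomial_def)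
qed

lemma mono_star: "star falg (monomial c u) = monomial (cnj c) (adj_word u)"
  by (auto simp: free_simps monomial_def fun_eq_iff)

lemma mono_smult: "c \<odot>\<^bsub>falg\<^esub> monomial d u = monomial (c * d) u"
  by (auto simp: free_simps monomial_def)

lemma free_ldist: "f \<otimes>\<^bsub>falg\<^esub> (g \<oplus>\<^bsub>falg\<^esub> h) = f \<otimes>\<^bsub>falg\<^esub> g \<oplus>\<^bsub>falg\<^esub> f \<otimes>\<^bsub>falg\<^esub> h"
  by (simp add: free_simps fun_eq_iff algebra_simps sum.distrib)

lemma free_rdist: "(g \<oplus>\<^bsub>falg\<^esub> h) \<otimes>\<^bsub>falg\<^esub> f = g \<otimes>\<^bsub>falg\<^esub> f \<oplus>\<^bsub>falg\<^esub> h \<otimes>\<^bsub>falg\<^esub> f"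
  by (simp add: free_simps fun_eq_iff algebra_simps sum.distrib)

lemma free_zmult: "(\<lambda>w. 0) \<otimes>\<^bsub>falg\<^esub> f = (\<lambda>w. 0)" "f \<otimes>\<^bsub>falg\<^esub> (\<lambda>w. 0) = (\<lambda>w. 0)"
  by (simp_all add: free_simps)

lemma free_assoc:
  assumes "f \<in> carrier falg" "g \<in> carrier falg" "h \<in> carrier falg"
  shows "(f \<otimes>\<^bsub>falg\<^esub> g) \<otimes>\<^bsub>falg\<^esub> h = f \<otimes>\<^bsub>falg\<^esub> (g \<otimes>\<^bsub>falg\<^esub> h)"
  using assms(1)
proof (induction f rule: free_induct)
  case (add f c u)
  have "(monomial c u \<otimes>\<^bsub>falg\<^esub> g) \<otimes>\<^bsub>falg\<^esub> h = monomial c u \<otimes>\<^bsub>falg\<^esub> (g \<otimes>\<^bsub>falg\<^esub> h)"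
    using assms(2)
  proof (induction g rule: free_induct)
    case (add g d v)
    have "(monomial c u \<otimes>\<^bsub>falg\<^esub> monomial d v) \<otimes>\<^bsub>falg\<^esub> h = monomial c u \<otimes>\<^bsub>falg\<^esub> (monomial d v \<otimes>\<^bsub>falg\<^esub> h)"
      using assms(3)
      by (induction h rule: free_induct) (simp_all only: free_zmult free_ldist mono_mult append_assoc mult.assoc)
    then show ?case using add by (simp only: free_ldist free_rdist)
  qed (simp only: free_zmult)
  then show ?case using add by (simp only: free_rdist)
qed (simp only: free_zmult)

lemma free_star_add: "star falg (f \<oplus>\<^bsub>falg\<^esub> g) = star falg f \<oplus>\<^bsub>falg\<^esub> star falg g"
  by (simp add: free_simps)

lemma free_star_zero: "star falg (\<lambda>w. 0) = (\<lambda>w. 0)"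
  by (simp add: free_simps)

lemma free_star_mult:
  assumes "f \<in> carrier falg" "g \<in> carrier falg"
  shows "star falg (f \<otimes>\<^bsub>falg\<^esub> g) = star falg g \<otimes>\<^bsub>falg\<^esub> star falg f"
  using assms(1)
proof (induction f rule: free_induct)
  case (add f c u)
  have "star falg (monomial c u \<otimes>\<^bsub>falg\<^esub> g) = star falg g \<otimes>\<^bsub>falg\<^esub> star falg (monomial c u)"
    using assms(2)
    by (induction g rule: free_induct)
      (simp_all only: free_zmult free_star_zero free_star_add free_ldist free_rdist mono_mult mono_star adj_append complex_cnj_mult mult.commute)
  then show ?case using add by (simp only: free_rdist free_ldist free_star_add)
qed (simp only: free_zmult free_star_zero)

lemma star_algebra_free: "star_algebra falg"
proof -
  have ag: "abelian_group falg"
  proof (rule abelian_groupI)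
    fix f assume f: "f \<in> carrier falg"
    show "\<exists>g\<in>carrier falg. g \<oplus>\<^bsub>falg\<^esub> f = \<zero>\<^bsub>falg\<^esub>"
      using free_smult_closed[OF f, of "-1"] by (intro bexI) (auto simp: free_simps(2-))
  next
    show "\<zero>\<^bsub>falg\<^esub> \<in> carrier falg" by (simp add: free_simps)
  qed (use free_add_closed in \<open>auto simp: free_simps(2-) add.assoc add.commute\<close>)
  have m: "Module.module complex_ring falg"
    by (rule Module.moduleI[OF cring_complex_ring ag])
       (use free_smult_closed in \<open>auto simp: free_simps(2-) algebra_simps\<close>)
  show ?thesis
  proof (rule star_algebra.intro[OF m], rule star_algebra_axioms.intro)
    fix f g h c assume f: "f \<in> carrier falg"
    show "star falg f \<in> carrier falg" using free_star_closed[OF f] .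
    show "star falg (star falg f) = f" by (simp add: free_simps)
    show "star falg (c \<odot>\<^bsub>falg\<^esub> f) = cnj c \<odot>\<^bsub>falg\<^esub> star falg f" by (simp add: free_simps)
    assume g: "g \<in> carrier falg"
    show "f \<otimes>\<^bsub>falg\<^esub> g \<in> carrier falg" using free_mult_closed[OF f g] .
    show "c \<odot>\<^bsub>falg\<^esub> f \<otimes>\<^bsub>falg\<^esub> g = c \<odot>\<^bsub>falg\<^esub> (f \<otimes>\<^bsub>falg\<^esub> g)" "f \<otimes>\<^bsub>falg\<^esub> (c \<odot>\<^bsub>falg\<^esub> g) = c \<odot>\<^bsub>falg\<^esub> (f \<otimes>\<^bsub>falg\<^esub> g)"
      by (simp_all add: free_simps sum_distrib_left algebra_simps)
    show "star falg (f \<oplus>\<^bsub>falg\<^esub> g) = star falg f \<oplus>\<^bsub>falg\<^esub> star falg g" by (rule free_star_add)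
    show "star falg (f \<otimes>\<^bsub>falg\<^esub> g) = star falg g \<otimes>\<^bsub>falg\<^esub> star falg f" by (rule free_star_mult[OF f g])
    assume h: "h \<in> carrier falg"
    show "f \<otimes>\<^bsub>falg\<^esub> g \<otimes>\<^bsub>falg\<^esub> h = f \<otimes>\<^bsub>falg\<^esub> (g \<otimes>\<^bsub>falg\<^esub> h)" by (rule free_assoc[OF f g h])
  qed (rule free_ldist free_rdist)+
qed

end

text \<open>Evaluation in a *-algebra.\<close>

context star_algebra begin

fun leval :: "('g \<Rightarrow> 'a) \<Rightarrow> 'g \<times> bool \<Rightarrow> 'a" where
  "leval g (x, b) = (if b then star A (g x) else g x)"

fun weval :: "('g \<Rightarrow> 'a) \<Rightarrow> ('g \<times> bool) list \<Rightarrow> 'a" where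
  "weval g [] = \<zero>" |
  "weval g [l] = leval g l" |
  "weval g (l # w) = leval g l \<otimes> weval g w"

definition feval :: "('g \<Rightarrow> 'a) \<Rightarrow> 'g words_fun \<Rightarrow> 'a" where
  "feval g f = finsum A (\<lambda>w. f w \<odot> weval g w) {w. f w \<noteq> 0}"

context
  fixes G :: "'g set" and g :: "'g \<Rightarrow> 'a" and N :: "'g words_fun \<Rightarrow> real"
  assumes gc: "\<And>x. x \<in> G \<Longrightarrow> g x \<in> carrier A"
begin

lemma leval_closed: "fst l \<in> G \<Longrightarrow> leval g l \<in> carrier A"
  by (cases l) (auto simp: gc star_closed)

lemma weval_closed0: "fst ` set w \<subseteq> G \<Longrightarrow> weval g w \<in> carrier A"
proof (induction w)
  case (Cons l w)
  then show ?case by (cases w) (auto intro!: mult_closed leval_closed simp del: leval.simps)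
qed simp

lemma weval_closed [simp]: "w \<in> words G \<Longrightarrow> weval g w \<in> carrier A"
  by (simp add: words_def weval_closed0)

lemma weval_Cons: "w \<noteq> [] \<Longrightarrow> weval g (l # w) = leval g l \<otimes> weval g w"
  by (cases w) auto

lemma weval_append: "u \<in> words G \<Longrightarrow> v \<in> words G \<Longrightarrow> weval g (u @ v) = weval g u \<otimes> weval g v"
proof (induction u)
  case (Cons l u)
  show ?case
  proof (cases "u = []")
    case True
    then show ?thesis using Cons.prems by (simp add: weval_Cons words_def)
  next
    case False
    then have u: "u \<in> words G" and l: "fst l \<in> G" using Cons.prems by (auto simp: words_def)
    show ?thesis using Cons.IH[OF u Cons.prems(2)] False u l Cons.prems
      by (simp add: weval_Cons mult_assoc leval_closed)
  qed
qed (simp add: words_def)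

lemma leval_adj: "fst l \<in> G \<Longrightarrow> leval g (fst l, \<not> snd l) = star A (leval g l)"
  by (cases l) (auto simp: star_star gc)

lemma weval_adj: "w \<in> words G \<Longrightarrow> weval g (adj_word w) = star A (weval g w)"
proof (induction w)
  case (Cons l w)
  have l: "fst l \<in> G" using Cons.prems by (auto simp: words_def)
  have a1: "adj_word [l] = [(fst l, \<not> snd l)]" by (simp add: adj_word_def case_prod_unfold)
  show ?case
  proof (cases "w = []")
    case True
    then show ?thesis using leval_adj[OF l] a1 by simp
  next
    case False
    then have w: "w \<in> words G" using Cons.prems by (auto simp: words_def)
    have lw: "[(fst l, \<not> snd l)] \<in> words G" using l by (simp add: words_def)
    have "weval g (adj_word (l # w)) = weval g (adj_word w @ adj_word [l])"
      using adj_append[of "[l]" w] by simp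
    also have "\<dots> = star A (weval g w) \<otimes> star A (leval g l)"
      unfolding a1 using weval_append[OF adj_words[OF w] lw] Cons.IH[OF w] leval_adj[OF l] by simp
    also have "\<dots> = star A (weval g (l # w))"
      using False w l by (simp add: weval_Cons star_mult leval_closed)
    finally show ?thesis .
  qed
qed (simp add: words_def)

lemma feval_superset:
  assumes "finite S" "S \<subseteq> words G" "{w. f w \<noteq> 0} \<subseteq> S"
  shows "feval g f = finsum A (\<lambda>w. f w \<odot> weval g w) S"
  unfolding feval_def
  by (rule M.add.finprod_mono_neutral_cong_left) (use assms in auto)

lemma feval_closed: "f \<in> carrier (free_star_alg G N) \<Longrightarrow> feval g f \<in> carrier A"
  unfolding feval_def by (rule M.finsum_closed) (auto simp: free_simps)

lemma feval_add:
  assumes "f \<in> carrier (free_star_alg G N)" "h \<in> carrier (free_star_alg G N)"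
  shows "feval g (f \<oplus>\<^bsub>free_star_alg G N\<^esub> h) = feval g f \<oplus> feval g h"
proof -
  let ?S = "{w. f w \<noteq> 0} \<union> {w. h w \<noteq> 0}"
  have S: "finite ?S" "?S \<subseteq> words G" using assms by (auto simp: free_simps)
  have "feval g (f \<oplus>\<^bsub>free_star_alg G N\<^esub> h) = finsum A (\<lambda>w. (f w + h w) \<odot> weval g w) ?S"
    using S by (subst feval_superset[of ?S]) (auto simp: free_simps)
  also have "\<dots> = finsum A (\<lambda>w. f w \<odot> weval g w \<oplus> h w \<odot> weval g w) ?S"
    using S by (intro M.finsum_cong') (auto simp: sm_ldist)
  also have "\<dots> = feval g f \<oplus> feval g h"
    using S by (subst M.finsum_addf) (auto simp: feval_superset[of ?S])
  finally show ?thesis .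
qed

lemma feval_zero: "feval g (\<lambda>w. 0) = \<zero>"
  by (simp add: feval_def)

lemma feval_mono: "w \<in> words G \<Longrightarrow> feval g (monomial c w) = c \<odot> weval g w"
  by (subst feval_superset[of "{w}"]) (auto simp: monomial_def)

lemma feval_hom: "feval g \<in> star_hom (free_star_alg G N) A"
proof -
  let ?F = "free_star_alg G N"
  interpret F: star_algebra ?F by (rule star_algebra_free)
  have sm: "feval g (c \<odot>\<^bsub>?F\<^esub> f) = c \<odot> feval g f" if "f \<in> carrier ?F" for c f
    using that
  proof (induction f rule: free_induct)
    case zero then show ?case by (simp add: free_simps feval_zero)
  next
    case (add f d w)
    then show ?case
      by (simp add: F.sm_rdist feval_add feval_closed sm_rdist mono_smult feval_mono sm_assoc)
  qed
  have st: "feval g (star ?F f) = star A (feval g f)" if "f \<in> carrier ?F" for f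
    using that
  proof (induction f rule: free_induct)
    case zero then show ?case by (simp add: free_star_zero feval_zero)
  next
    case (add f d w)
    then show ?case
      by (simp add: F.star_add feval_add feval_closed F.star_closed star_add mono_star feval_mono adj_words weval_adj star_smult)
  qed
  have mu: "feval g (f \<otimes>\<^bsub>?F\<^esub> h) = feval g f \<otimes> feval g h" if f: "f \<in> carrier ?F" and h: "h \<in> carrier ?F" for f h
    using f
  proof (induction f rule: free_induct)
    case zero then show ?case by (simp add: free_zmult feval_zero feval_closed h)
  next
    case (add f c u)
    have "feval g (monomial c u \<otimes>\<^bsub>?F\<^esub> h) = feval g (monomial c u) \<otimes> feval g h"
      using h
    proof (induction h rule: free_induct)
      case zero then show ?case using add by (simp add: free_zmult feval_zero feval_closed)
    next
      case (add h d v)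
      have "feval g (monomial c u \<otimes>\<^bsub>?F\<^esub> monomial d v) = feval g (monomial c u) \<otimes> feval g (monomial d v)"
        using add \<open>u \<in> words G\<close>
        by (simp add: mono_mult feval_mono append_words weval_append smult_mult_left smult_mult_right mult_closed sm_assoc[symmetric] mult.commute)
      then show ?case using add \<open>u \<in> words G\<close>
        by (simp add: F.distrib_left feval_add feval_closed F.mult_closed distrib_left)
    qed
    then show ?case using add h
      by (simp add: F.distrib_right feval_add feval_closed F.mult_closed distrib_right)
  qed
  show ?thesis unfolding star_hom_def by (simp add: feval_closed feval_add sm st mu)
qed

lemma feval_gen: "x \<in> G \<Longrightarrow> feval g (free_gen x) = g x"
  by (simp add: free_gen_mono feval_mono words_def gc)

end
end

lemma star_homD:
  assumes "\<phi> \<in> star_hom A B"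
  shows "x \<in> carrier A \<Longrightarrow> \<phi> x \<in> carrier B"
    "\<lbrakk>x \<in> carrier A; y \<in> carrier A\<rbrakk> \<Longrightarrow> \<phi> (x \<oplus>\<^bsub>A\<^esub> y) = \<phi> x \<oplus>\<^bsub>B\<^esub> \<phi> y"
    "x \<in> carrier A \<Longrightarrow> \<phi> (c \<odot>\<^bsub>A\<^esub> x) = c \<odot>\<^bsub>B\<^esub> \<phi> x"
    "\<lbrakk>x \<in> carrier A; y \<in> carrier A\<rbrakk> \<Longrightarrow> \<phi> (x \<otimes>\<^bsub>A\<^esub> y) = \<phi> x \<otimes>\<^bsub>B\<^esub> \<phi> y"
    "x \<in> carrier A \<Longrightarrow> \<phi> (star A x) = star B (\<phi> x)"
  using assms by (auto simp: star_hom_def)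

locale star_hom_pair = A: star_algebra A + B: star_algebra B
  for A :: "'a normed_star_alg" (structure) and B :: "'b normed_star_alg" (structure) +
  fixes \<phi> assumes hom: "\<phi> \<in> star_hom A B"
begin

lemmas h = star_homD[OF hom]

lemma h_zero: "\<phi> \<zero>\<^bsub>A\<^esub> = \<zero>\<^bsub>B\<^esub>"
  using h(3)[of "\<zero>\<^bsub>A\<^esub>" 0] h(1)[of "\<zero>\<^bsub>A\<^esub>"] by simp

lemma h_minus: "\<lbrakk>x \<in> carrier A; y \<in> carrier A\<rbrakk> \<Longrightarrow> \<phi> (x \<ominus>\<^bsub>A\<^esub> y) = \<phi> x \<ominus>\<^bsub>B\<^esub> \<phi> y"
  by (simp add: A.minus_sm B.minus_sm h)

lemma h_finsum: "finite S \<Longrightarrow> (\<And>i. i \<in> S \<Longrightarrow> f i \<in> carrier A) \<Longrightarrow>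
   \<phi> (finsum A f S) = finsum B (\<lambda>i. \<phi> (f i)) S"
proof (induction S rule: finite_induct)
  case empty then show ?case by (simp add: h_zero)
next
  case (insert i S)
  have "finsum A f (insert i S) = f i \<oplus>\<^bsub>A\<^esub> finsum A f S"
    using insert by (intro A.M.finsum_insert) auto
  moreover have "finsum B (\<lambda>i. \<phi> (f i)) (insert i S) = \<phi> (f i) \<oplus>\<^bsub>B\<^esub> finsum B (\<lambda>i. \<phi> (f i)) S"
    using insert h(1) by (intro B.M.finsum_insert) auto
  moreover have "finsum A f S \<in> carrier A" using insert by (intro A.M.finsum_closed) auto
  ultimately show ?case using insert h(2) by simp
qed

end

abbreviation "vgen v \<equiv> free_gen (Inl v)"
abbreviation "egen e \<equiv> free_gen (Inr e)"

inductive ckrel :: "('v, 'e) pre_digraph \<Rightarrow> ('v + 'e) words_fun normed_star_alg \<Rightarrow>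
   ('v + 'e) words_fun \<Rightarrow> ('v + 'e) words_fun \<Rightarrow> bool" for E F where
  r1: "v \<in> verts E \<Longrightarrow> ckrel E F (star F (vgen v)) (vgen v)"
| r2: "v \<in> verts E \<Longrightarrow> ckrel E F (vgen v \<otimes>\<^bsub>F\<^esub> vgen v) (vgen v)"
| r3: "v \<in> verts E \<Longrightarrow> w \<in> verts E \<Longrightarrow> v \<noteq> w \<Longrightarrow> ckrel E F (vgen v \<otimes>\<^bsub>F\<^esub> vgen w) \<zero>\<^bsub>F\<^esub>"
| r4: "e \<in> arcs E \<Longrightarrow> ckrel E F (egen e \<otimes>\<^bsub>F\<^esub> star F (egen e) \<otimes>\<^bsub>F\<^esub> egen e) (egen e)"
| r5: "e \<in> arcs E \<Longrightarrow> f \<in> arcs E \<Longrightarrow> e \<noteq> f \<Longrightarrow>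
    ckrel E F ((egen e \<otimes>\<^bsub>F\<^esub> star F (egen e)) \<otimes>\<^bsub>F\<^esub> (egen f \<otimes>\<^bsub>F\<^esub> star F (egen f))) \<zero>\<^bsub>F\<^esub>"
| r6: "e \<in> arcs E \<Longrightarrow> ckrel E F (star F (egen e) \<otimes>\<^bsub>F\<^esub> egen e) (vgen (head E e))"
| r7: "e \<in> arcs E \<Longrightarrow> ckrel E F ((egen e \<otimes>\<^bsub>F\<^esub> star F (egen e)) \<otimes>\<^bsub>F\<^esub> vgen (tail E e)) (egen e \<otimes>\<^bsub>F\<^esub> star F (egen e))"
| r8: "e \<in> arcs E \<Longrightarrow> ckrel E F (vgen (tail E e) \<otimes>\<^bsub>F\<^esub> (egen e \<otimes>\<^bsub>F\<^esub> star F (egen e))) (egen e \<otimes>\<^bsub>F\<^esub> star F (egen e))"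
| r9: "regular_vertex E v \<Longrightarrow> ckrel E F (vgen v) (finsum F (\<lambda>e. egen e \<otimes>\<^bsub>F\<^esub> star F (egen e)) (out_arcs E v))"

lemma free_gen_carrier: "x \<in> G \<Longrightarrow> free_gen x \<in> carrier (free_star_alg G N)"
  by (simp add: free_gen_mono words_def)

context
  fixes E :: "('v, 'e) pre_digraph"
  assumes wf: "wf_digraph E"
begin

abbreviation "FE \<equiv> graph_free_alg E"

lemma P_carrier [simp]: "v \<in> verts E \<Longrightarrow> vgen v \<in> carrier (FE N)"
  and T_carrier [simp]: "e \<in> arcs E \<Longrightarrow> egen e \<in> carrier (FE N)"
  by (auto intro: free_gen_carrier)

lemma ends [simp]: "e \<in> arcs E \<Longrightarrow> head E e \<in> verts E" "e \<in> arcs E \<Longrightarrow> tail E e \<in> verts E"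
  using wf by (auto simp: wf_digraph_def)

lemma FE_N: "carrier (FE N) = carrier (FE M)" "x \<otimes>\<^bsub>FE N\<^esub> y = x \<otimes>\<^bsub>FE M\<^esub> y"
   "x \<oplus>\<^bsub>FE N\<^esub> y = x \<oplus>\<^bsub>FE M\<^esub> y" "c \<odot>\<^bsub>FE N\<^esub> y = c \<odot>\<^bsub>FE M\<^esub> y" "star (FE N) x = star (FE M) x"
   "\<zero>\<^bsub>FE N\<^esub> = \<zero>\<^bsub>FE M\<^esub>" "finsum (FE N) g S = finsum (FE M) g S" "x \<ominus>\<^bsub>FE N\<^esub> y = x \<ominus>\<^bsub>FE M\<^esub> y"
  by (simp_all add: free_star_alg_def finsum_def a_minus_def a_inv_def)

lemma FE_alg: "star_algebra (FE N)"
  by (rule star_algebra_free)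

lemma FE_star: "x \<in> carrier (FE N) \<Longrightarrow> star (FE N) x \<in> carrier (FE N)"
  and FE_mult: "x \<in> carrier (FE N) \<Longrightarrow> y \<in> carrier (FE N) \<Longrightarrow> x \<otimes>\<^bsub>FE N\<^esub> y \<in> carrier (FE N)"
  by (auto intro: star_algebra.star_closed star_algebra.mult_closed FE_alg)

lemma FE_zero: "\<zero>\<^bsub>FE N\<^esub> \<in> carrier (FE N)"
  by (simp add: free_simps)

lemma FE_finsum: "(\<And>i. i \<in> S \<Longrightarrow> f i \<in> carrier (FE N)) \<Longrightarrow> finsum (FE N) f S \<in> carrier (FE N)"
proof -
  interpret star_algebra "FE N" by (rule FE_alg)
  show "(\<And>i. i \<in> S \<Longrightarrow> f i \<in> carrier (FE N)) \<Longrightarrow> finsum (FE N) f S \<in> carrier (FE N)"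
    by (intro M.finsum_closed) auto
qed

lemma ckrel_carrier: "ckrel E (FE N) x y \<Longrightarrow> x \<in> carrier (FE N) \<and> y \<in> carrier (FE N)"
  by (erule ckrel.cases)
     (auto simp del: ends simp: regular_vertex_def FE_zero intro!: FE_star FE_mult FE_finsum P_carrier T_carrier ends)

lemma ck_family_iff:
  assumes B: "star_algebra B" and hom: "\<phi> \<in> star_hom (FE N) B"
  shows "ck_family E B (\<lambda>v. \<phi> (vgen v)) (\<lambda>e. \<phi> (egen e)) \<longleftrightarrow> (\<forall>x y. ckrel E (FE N) x y \<longrightarrow> \<phi> x = \<phi> y)"
proof -
  interpret star_hom_pair "FE N" B \<phi>
    by (rule star_hom_pair.intro[OF FE_alg B]) (unfold_locales, rule hom)
  have fs: "\<phi> (finsum (FE N) (\<lambda>e. egen e \<otimes>\<^bsub>FE N\<^esub> star (FE N) (egen e)) (out_arcs E v))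
     = finsum B (\<lambda>e. \<phi> (egen e) \<otimes>\<^bsub>B\<^esub> star B (\<phi> (egen e))) (out_arcs E v)" if "regular_vertex E v" for v
  proof -
    have "\<phi> (finsum (FE N) (\<lambda>e. egen e \<otimes>\<^bsub>FE N\<^esub> star (FE N) (egen e)) (out_arcs E v))
       = finsum B (\<lambda>e. \<phi> (egen e \<otimes>\<^bsub>FE N\<^esub> star (FE N) (egen e))) (out_arcs E v)"
      using that by (intro h_finsum) (auto simp: regular_vertex_def intro!: FE_mult FE_star T_carrier)
    also have "\<dots> = finsum B (\<lambda>e. \<phi> (egen e) \<otimes>\<^bsub>B\<^esub> star B (\<phi> (egen e))) (out_arcs E v)"
      by (intro B.M.finsum_cong') (auto simp: h FE_star intro!: B.mult_closed B.star_closed h(1) T_carrier)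
    finally show ?thesis .
  qed
  have rv: "regular_vertex E v \<Longrightarrow> v \<in> verts E" for v by (simp add: regular_vertex_def)
  note S = h FE_star FE_mult h_zero fs rv
  show ?thesis
  proof (intro iffI allI impI)
    fix x y assume ck: "ck_family E B (\<lambda>v. \<phi> (vgen v)) (\<lambda>e. \<phi> (egen e))" and r: "ckrel E (FE N) x y"
    show "\<phi> x = \<phi> y"
      using r ck unfolding ck_family_def is_projection_def is_partial_isometry_def proj_le_def
      by cases (simp_all add: S)
  next
    assume R: "\<forall>x y. ckrel E (FE N) x y \<longrightarrow> \<phi> x = \<phi> y"
    note r = R[rule_format]
    show "ck_family E B (\<lambda>v. \<phi> (vgen v)) (\<lambda>e. \<phi> (egen e))"
      unfolding ck_family_def is_projection_def is_partial_isometry_def proj_le_def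
    proof (intro conjI ballI allI impI)
      show "v \<in> verts E \<Longrightarrow> star B (\<phi> (vgen v)) = \<phi> (vgen v)" for v using r[OF r1] by (simp add: S)
      show "v \<in> verts E \<Longrightarrow> \<phi> (vgen v) \<otimes>\<^bsub>B\<^esub> \<phi> (vgen v) = \<phi> (vgen v)" for v using r[OF r2] by (simp add: S)
      show "v \<in> verts E \<Longrightarrow> w \<in> verts E \<Longrightarrow> v \<noteq> w \<Longrightarrow> \<phi> (vgen v) \<otimes>\<^bsub>B\<^esub> \<phi> (vgen w) = \<zero>\<^bsub>B\<^esub>" for v w
        using r[OF r3] by (simp add: S)
      show "e \<in> arcs E \<Longrightarrow> \<phi> (egen e) \<otimes>\<^bsub>B\<^esub> star B (\<phi> (egen e)) \<otimes>\<^bsub>B\<^esub> \<phi> (egen e) = \<phi> (egen e)" for e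
        using r[OF r4] by (simp add: S)
      show "e \<in> arcs E \<Longrightarrow> f \<in> arcs E \<Longrightarrow> e \<noteq> f \<Longrightarrow>
        (\<phi> (egen e) \<otimes>\<^bsub>B\<^esub> star B (\<phi> (egen e))) \<otimes>\<^bsub>B\<^esub> (\<phi> (egen f) \<otimes>\<^bsub>B\<^esub> star B (\<phi> (egen f))) = \<zero>\<^bsub>B\<^esub>" for e f
        using r[OF r5] by (simp add: S)
      show "e \<in> arcs E \<Longrightarrow> star B (\<phi> (egen e)) \<otimes>\<^bsub>B\<^esub> \<phi> (egen e) = \<phi> (vgen (head E e))" for e
        using r[OF r6] by (simp add: S)
      show "e \<in> arcs E \<Longrightarrow> \<phi> (egen e) \<otimes>\<^bsub>B\<^esub> star B (\<phi> (egen e)) \<otimes>\<^bsub>B\<^esub> \<phi> (vgen (tail E e)) = \<phi> (egen e) \<otimes>\<^bsub>B\<^esub> star B (\<phi> (egen e))" for e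
        using r[OF r7] by (simp add: S)
      show "e \<in> arcs E \<Longrightarrow> \<phi> (vgen (tail E e)) \<otimes>\<^bsub>B\<^esub> (\<phi> (egen e) \<otimes>\<^bsub>B\<^esub> star B (\<phi> (egen e))) = \<phi> (egen e) \<otimes>\<^bsub>B\<^esub> star B (\<phi> (egen e))" for e
        using r[OF r8] by (simp add: S)
      show "regular_vertex E v \<Longrightarrow> \<phi> (vgen v) = finsum B (\<lambda>e. \<phi> (egen e) \<otimes>\<^bsub>B\<^esub> star B (\<phi> (egen e))) (out_arcs E v)" for v
        using r[OF r9] by (simp add: S)
    qed (auto intro: h(1) P_carrier T_carrier)
  qed
qed

lemma const_hom: "pre_cstar_algebra A \<Longrightarrow> const_class A \<in> star_hom A (completion A)"
proof -
  assume "pre_cstar_algebra A"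
  then interpret pre_cstar_algebra A .
  show ?thesis
    by (auto simp: star_hom_def compl_add compl_mult compl_smult compl_star compl_carrier)
qed

lemma const_eq_iff:
  assumes "pre_cstar_algebra A" "x \<in> carrier A" "y \<in> carrier A"
  shows "const_class A x = const_class A y \<longleftrightarrow> nrm A (x \<ominus>\<^bsub>A\<^esub> y) = 0"
proof -
  interpret pre_cstar_algebra A by fact
  show ?thesis using assms(2,3) by (simp add: class_eq eqv_def LIMSEQ_const_iff)
qed

lemma FE_nrm: "nrm (FE N) = N"
  by (simp add: free_simps)

lemma graph_seminorms_iff:
  "N \<in> graph_seminorms E \<longleftrightarrow>
     pre_cstar_algebra (FE N) \<and> (\<forall>x y. ckrel E (FE N) x y \<longrightarrow> N (x \<ominus>\<^bsub>FE N\<^esub> y) = 0)"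
proof (cases "pre_cstar_algebra (FE N)")
  case True
  then interpret pre_cstar_algebra "FE N" .
  have "ck_family E (completion (FE N)) (\<lambda>v. const_class (FE N) (vgen v)) (\<lambda>e. const_class (FE N) (egen e))
     \<longleftrightarrow> (\<forall>x y. ckrel E (FE N) x y \<longrightarrow> const_class (FE N) x = const_class (FE N) y)"
    by (rule ck_family_iff[OF star_algebra_completion const_hom[OF True]])
  also have "\<dots> \<longleftrightarrow> (\<forall>x y. ckrel E (FE N) x y \<longrightarrow> N (x \<ominus>\<^bsub>FE N\<^esub> y) = 0)"
    using const_eq_iff[OF True] ckrel_carrier by (metis FE_nrm)
  finally show ?thesis using True by (simp add: graph_seminorms_def)
qed (simp add: graph_seminorms_def)

lemma zero_seminorm: "(\<lambda>_. 0) \<in> graph_seminorms E"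
proof -
  have "pre_cstar_algebra (FE (\<lambda>_. 0))"
    by (rule pre_cstar_algebra.intro[OF FE_alg]) (unfold_locales, auto simp: FE_nrm)
  then show ?thesis by (simp add: graph_seminorms_iff)
qed

lemma projection_nrm:
  assumes "pre_cstar_algebra A" "is_projection A p" shows "nrm A p \<le> 1"
proof -
  interpret pre_cstar_algebra A by fact
  have "nrm A p = (nrm A p)\<^sup>2" using cstar_identity[of p] assms(2) by (simp add: is_projection_def)
  then show ?thesis by (metis mult_cancel_left1 order.refl power2_eq_square zero_le_one)
qed

lemma partial_isometry_nrm:
  assumes "pre_cstar_algebra A" "is_partial_isometry A s" shows "nrm A s \<le> 1"
proof -
  interpret pre_cstar_algebra A by fact
  have s: "s \<in> carrier A" "s \<otimes>\<^bsub>A\<^esub> star A s \<otimes>\<^bsub>A\<^esub> s = s" using assms(2) by (auto simp: is_partial_isometry_def)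
  note c = s(1) star_closed[OF s(1)]
  have "is_projection A (star A s \<otimes>\<^bsub>A\<^esub> s)"
    using c s(2) by (simp add: is_projection_def star_mult star_star mult_closed mult_assoc)
  then have "(nrm A s)\<^sup>2 \<le> 1" using projection_nrm assms(1) cstar_identity[OF s(1)] by metis
  then show ?thesis by (simp add: abs_le_square_iff[of _ 1, simplified, symmetric] nrm_nonneg[OF s(1)])
qed

lemma seminorm_gen: assumes N: "N \<in> graph_seminorms E" and x: "x \<in> Inl ` verts E \<union> Inr ` arcs E"
  shows "N (free_gen x) \<le> 1"
proof -
  have pc: "pre_cstar_algebra (FE N)" using N by (simp add: graph_seminorms_def)
  interpret pre_cstar_algebra "FE N" by (rule pc)
  have ck: "ck_family E (completion (FE N)) (\<lambda>v. const_class (FE N) (vgen v)) (\<lambda>e. const_class (FE N) (egen e))"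
    using N by (simp add: graph_seminorms_def)
  have "nrm (completion (FE N)) (const_class (FE N) (free_gen x)) \<le> 1"
    using x ck projection_nrm[OF pre_cstar_completion] partial_isometry_nrm[OF pre_cstar_completion]
    unfolding ck_family_def by fast
  then show ?thesis using compl_nrm_const[OF free_gen_carrier[OF x]] FE_nrm by metis
qed

lemma seminorm_word: assumes N: "N \<in> graph_seminorms E" and "w \<in> words (Inl ` verts E \<union> Inr ` arcs E)"
  shows "N (monomial 1 w) \<le> 1"
  using assms(2)
proof (induction w)
  case (Cons l w)
  have pc: "pre_cstar_algebra (FE N)" using N by (simp add: graph_seminorms_def)
  interpret pre_cstar_algebra "FE N" by (rule pc)
  obtain x b where l: "l = (x, b)" by force
  have x: "x \<in> Inl ` verts E \<union> Inr ` arcs E" using Cons.prems l by (auto simp: words_def)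
  note g = free_gen_carrier[OF x, of N]
  have st: "star (FE N) (free_gen x) = monomial 1 [(x, True)]"
    unfolding free_gen_mono mono_star by (simp add: adj_word_def)
  have "N (monomial 1 [(x, True)]) = N (free_gen x)" using nrm_star[OF g] by (simp only: st FE_nrm)
  then have l1: "N (monomial 1 [l]) \<le> 1" using seminorm_gen[OF N x] by (cases b) (auto simp: l free_gen_mono)
  show ?case
  proof (cases "w = []")
    case False
    then have w: "w \<in> words (Inl ` verts E \<union> Inr ` arcs E)" using Cons.prems by (auto simp: words_def)
    have lw: "[l] \<in> words (Inl ` verts E \<union> Inr ` arcs E)" using x l by (auto simp: words_def)
    have "N (monomial 1 (l # w)) = N (monomial 1 [l] \<otimes>\<^bsub>FE N\<^esub> monomial 1 w)" by (simp only: mono_mult) simp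
    also have "\<dots> \<le> N (monomial 1 [l]) * N (monomial 1 w)"
      using nrm_mult[OF mono_carrier[OF lw] mono_carrier[OF w]] by (simp only: FE_nrm)
    also have "\<dots> \<le> 1 * 1"
      using l1 Cons.IH[OF w] nrm_nonneg[OF mono_carrier[OF w]] nrm_nonneg[OF mono_carrier[OF lw]]
      by (intro mult_mono) (simp_all add: FE_nrm)
    finally show ?thesis by simp
  qed (use l1 in simp)
qed (simp add: words_def)

lemma seminorm_bdd: assumes "f \<in> carrier (FE M)" shows "\<exists>K. \<forall>N\<in>graph_seminorms E. N f \<le> K"
  using assms
proof (induction f rule: free_induct)
  case zero
  have "N (\<lambda>w. 0) = 0" if "N \<in> graph_seminorms E" for N
  proof -
    interpret pre_cstar_algebra "FE N" using that by (simp add: graph_seminorms_def)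
    show ?thesis using nrm_zero by (simp add: free_simps)
  qed
  then have "\<forall>N\<in>graph_seminorms E. N (\<lambda>w. 0) \<le> 0" using order.eq_iff by blast
  then show ?case by (rule exI)
next
  case (add f c w)
  then obtain K where K: "\<And>N. N \<in> graph_seminorms E \<Longrightarrow> N f \<le> K" by auto
  have "N (f \<oplus>\<^bsub>FE M\<^esub> monomial c w) \<le> K + cmod c * 1" if N: "N \<in> graph_seminorms E" for N
  proof -
    interpret pre_cstar_algebra "FE N" using N by (simp add: graph_seminorms_def)
    have f: "f \<in> carrier (FE N)" using add.hyps(1) FE_N(1) by blast
    have m1: "monomial 1 w \<in> carrier (FE N)" for c :: complex using add.hyps(2) by simp
    have mc: "monomial c w = c \<odot>\<^bsub>FE N\<^esub> monomial 1 w" by (simp add: mono_smult)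
    have "N (f \<oplus>\<^bsub>FE M\<^esub> monomial c w) = N (f \<oplus>\<^bsub>FE N\<^esub> monomial c w)" by (simp add: free_simps)
    also have "\<dots> \<le> N f + N (monomial c w)"
      using nrm_triangle[OF f mono_carrier[OF add.hyps(2)]] by (simp only: FE_nrm)
    also have "N (monomial c w) = cmod c * N (monomial 1 w)"
      using nrm_smult[OF m1, of c] by (simp only: mc FE_nrm)
    also have "N f + cmod c * N (monomial 1 w) \<le> K + cmod c * 1"
      by (intro add_mono mult_left_mono K seminorm_word N add.hyps) simp
    finally show ?thesis .
  qed
  then show ?case by blast
qed

abbreviation "univ_nrm \<equiv> \<lambda>x. SUP N\<in>graph_seminorms E. N x"

lemma uN_upper: "f \<in> carrier (FE M) \<Longrightarrow> N \<in> graph_seminorms E \<Longrightarrow> N f \<le> univ_nrm f"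
  using seminorm_bdd[of f M] by (intro cSUP_upper) (auto simp: bdd_above_def)

lemma uN_least: "(\<And>N. N \<in> graph_seminorms E \<Longrightarrow> N f \<le> K) \<Longrightarrow> univ_nrm f \<le> K"
  using zero_seminorm by (intro cSUP_least) auto

lemma uN_nonneg: "f \<in> carrier (FE M) \<Longrightarrow> 0 \<le> univ_nrm f"
  using uN_upper[OF _ zero_seminorm] by blast

lemma seminormD:
  assumes N: "N \<in> graph_seminorms E"
  shows "x \<in> carrier (FE M) \<Longrightarrow> 0 \<le> N x"
   "\<lbrakk>x \<in> carrier (FE M); y \<in> carrier (FE M)\<rbrakk> \<Longrightarrow> N (x \<oplus>\<^bsub>FE M\<^esub> y) \<le> N x + N y"
   "x \<in> carrier (FE M) \<Longrightarrow> N (c \<odot>\<^bsub>FE M\<^esub> x) = cmod c * N x"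
   "\<lbrakk>x \<in> carrier (FE M); y \<in> carrier (FE M)\<rbrakk> \<Longrightarrow> N (x \<otimes>\<^bsub>FE M\<^esub> y) \<le> N x * N y"
   "x \<in> carrier (FE M) \<Longrightarrow> N (star (FE M) x \<otimes>\<^bsub>FE M\<^esub> x) = (N x)\<^sup>2"
proof -
  interpret pre_cstar_algebra "FE N" using N by (simp add: graph_seminorms_def)
  note FM = FE_N[where N=M and M=N]
  show "x \<in> carrier (FE M) \<Longrightarrow> 0 \<le> N x" using nrm_nonneg unfolding FM FE_nrm by blast
  show "\<lbrakk>x \<in> carrier (FE M); y \<in> carrier (FE M)\<rbrakk> \<Longrightarrow> N (x \<oplus>\<^bsub>FE M\<^esub> y) \<le> N x + N y"
    using nrm_triangle unfolding FM FE_nrm by blast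
  show "x \<in> carrier (FE M) \<Longrightarrow> N (c \<odot>\<^bsub>FE M\<^esub> x) = cmod c * N x"
    using nrm_smult unfolding FM FE_nrm by blast
  show "\<lbrakk>x \<in> carrier (FE M); y \<in> carrier (FE M)\<rbrakk> \<Longrightarrow> N (x \<otimes>\<^bsub>FE M\<^esub> y) \<le> N x * N y"
    using nrm_mult unfolding FM FE_nrm by blast
  show "x \<in> carrier (FE M) \<Longrightarrow> N (star (FE M) x \<otimes>\<^bsub>FE M\<^esub> x) = (N x)\<^sup>2"
    using cstar_identity unfolding FM FE_nrm by blast
qed

lemma uN_pre: "pre_cstar_algebra (FE univ_nrm)"
proof (rule pre_cstar_algebra.intro[OF FE_alg], rule pre_cstar_algebra_axioms.intro, unfold FE_nrm)
  fix x y c assume x: "x \<in> carrier (FE univ_nrm)"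
  let ?F = "FE univ_nrm"
  interpret F: star_algebra ?F by (rule FE_alg)
  show "0 \<le> univ_nrm x" by (rule uN_nonneg[OF x])
  have smle: "univ_nrm (c \<odot>\<^bsub>?F\<^esub> z) \<le> cmod c * univ_nrm z" if z: "z \<in> carrier ?F" for c z
  proof (rule uN_least)
    fix N assume N: "N \<in> graph_seminorms E"
    show "N (c \<odot>\<^bsub>?F\<^esub> z) \<le> cmod c * univ_nrm z"
      unfolding seminormD(3)[OF N z] by (intro mult_left_mono uN_upper[OF z N]) simp
  qed
  show "univ_nrm (c \<odot>\<^bsub>?F\<^esub> x) = cmod c * univ_nrm x"
  proof (cases "c = 0")
    case True
    then show ?thesis using smle[OF x, of 0] uN_nonneg[OF F.sm_closed[OF x], of c] by simp
  next
    case False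
    have "x = inverse c \<odot>\<^bsub>?F\<^esub> (c \<odot>\<^bsub>?F\<^esub> x)" using False x by (simp add: F.sm_assoc[symmetric])
    then have "univ_nrm x \<le> cmod (inverse c) * univ_nrm (c \<odot>\<^bsub>?F\<^esub> x)" using smle[OF F.sm_closed[OF x], of "inverse c" c] by metis
    then have "cmod c * univ_nrm x \<le> cmod c * (cmod (inverse c) * univ_nrm (c \<odot>\<^bsub>?F\<^esub> x))" by (rule mult_left_mono) simp
    also have "\<dots> = (cmod c * cmod (inverse c)) * univ_nrm (c \<odot>\<^bsub>?F\<^esub> x)" by (rule mult.assoc[symmetric])
    also have "cmod c * cmod (inverse c) = 1" using False by (simp add: norm_inverse)
    finally have "cmod c * univ_nrm x \<le> univ_nrm (c \<odot>\<^bsub>?F\<^esub> x)" by simp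
    then show ?thesis using smle[OF x, of c] by linarith
  qed
  show "univ_nrm (star ?F x \<otimes>\<^bsub>?F\<^esub> x) = (univ_nrm x)\<^sup>2"
  proof (rule antisym)
    show "univ_nrm (star ?F x \<otimes>\<^bsub>?F\<^esub> x) \<le> (univ_nrm x)\<^sup>2"
    proof (rule uN_least)
      fix N assume N: "N \<in> graph_seminorms E"
      show "N (star ?F x \<otimes>\<^bsub>?F\<^esub> x) \<le> (univ_nrm x)\<^sup>2"
        unfolding seminormD(5)[OF N x] by (intro power_mono uN_upper[OF x N] seminormD(1)[OF N x])
    qed
    have "univ_nrm x \<le> sqrt (univ_nrm (star ?F x \<otimes>\<^bsub>?F\<^esub> x))"
    proof (rule uN_least)
      fix N assume N: "N \<in> graph_seminorms E"
      have "(N x)\<^sup>2 \<le> univ_nrm (star ?F x \<otimes>\<^bsub>?F\<^esub> x)"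
        using uN_upper[OF FE_mult[OF FE_star[OF x] x] N] seminormD(5)[OF N x] by simp
      then show "N x \<le> sqrt (univ_nrm (star ?F x \<otimes>\<^bsub>?F\<^esub> x))" by (rule real_le_rsqrt)
    qed
    then show "(univ_nrm x)\<^sup>2 \<le> univ_nrm (star ?F x \<otimes>\<^bsub>?F\<^esub> x)"
      using uN_nonneg[OF x] uN_nonneg[OF FE_mult[OF FE_star[OF x] x]] by (metis real_sqrt_le_iff real_sqrt_abs abs_of_nonneg)
  qed
  assume y: "y \<in> carrier (FE univ_nrm)"
  show "univ_nrm (x \<oplus>\<^bsub>?F\<^esub> y) \<le> univ_nrm x + univ_nrm y"
  proof (rule uN_least)
    fix N assume N: "N \<in> graph_seminorms E"
    show "N (x \<oplus>\<^bsub>?F\<^esub> y) \<le> univ_nrm x + univ_nrm y"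
      using seminormD(2)[OF N x y] uN_upper[OF x N] uN_upper[OF y N] by linarith
  qed
  show "univ_nrm (x \<otimes>\<^bsub>?F\<^esub> y) \<le> univ_nrm x * univ_nrm y"
  proof (rule uN_least)
    fix N assume N: "N \<in> graph_seminorms E"
    have "N x * N y \<le> univ_nrm x * univ_nrm y"
      by (intro mult_mono uN_upper[OF x N] uN_upper[OF y N] uN_nonneg[OF x] seminormD(1)[OF N y])
    then show "N (x \<otimes>\<^bsub>?F\<^esub> y) \<le> univ_nrm x * univ_nrm y" using seminormD(4)[OF N x y] by linarith
  qed
qed

lemma ckrel_N: "ckrel E (FE N) x y \<longleftrightarrow> ckrel E (FE M) x y"
proof -
  have "ckrel E (FE N) x y \<Longrightarrow> ckrel E (FE M) x y" for N M
    by (erule ckrel.cases; simp only: FE_N[where N=N and M=M]; rule ckrel.intros; simp)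
  then show ?thesis by blast
qed

lemma uN_seminorm: "univ_nrm \<in> graph_seminorms E"
  unfolding graph_seminorms_iff
proof (intro conjI allI impI uN_pre)
  fix x y assume r: "ckrel E (FE univ_nrm) x y"
  interpret F: star_algebra "FE univ_nrm" by (rule FE_alg)
  have c: "x \<ominus>\<^bsub>FE univ_nrm\<^esub> y \<in> carrier (FE univ_nrm)" using ckrel_carrier[OF r] by (auto intro: F.M.minus_closed)
  have "univ_nrm (x \<ominus>\<^bsub>FE univ_nrm\<^esub> y) \<le> 0"
  proof (rule uN_least)
    fix N assume "N \<in> graph_seminorms E"
    moreover have "ckrel E (FE N) x y" using r ckrel_N by blast
    ultimately have "N (x \<ominus>\<^bsub>FE N\<^esub> y) = 0" by (simp add: graph_seminorms_iff)
    moreover have "x \<ominus>\<^bsub>FE N\<^esub> y = x \<ominus>\<^bsub>FE univ_nrm\<^esub> y" by (rule FE_N(8))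
    ultimately show "N (x \<ominus>\<^bsub>FE univ_nrm\<^esub> y) \<le> 0" by simp
  qed
  then show "univ_nrm (x \<ominus>\<^bsub>FE univ_nrm\<^esub> y) = 0" using uN_nonneg[OF c] by simp
qed

theorem cstar_algebra_graph_cstar: "cstar_algebra (graph_cstar E)"
  using pre_cstar_algebra.cstar_completion[OF uN_pre] by (simp add: graph_cstar_def graph_normed_alg_def)

theorem ck_family_graph_cstar: "ck_family E (graph_cstar E) (gp E) (gs E)"
  using uN_seminorm
  by (simp add: graph_seminorms_def graph_cstar_def graph_normed_alg_def gp_def[abs_def] gs_def[abs_def])

lemma cstar_lim_unique:
  assumes B: "cstar_algebra B" and X: "\<And>n. X n \<in> carrier B" and l: "l \<in> carrier B" "l' \<in> carrier B"
    and c: "converges_to B X l" "converges_to B X l'"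
  shows "l = l'"
proof -
  interpret cstar_algebra B by fact
  have s: "(\<lambda>n. nrm B (X n \<ominus>\<^bsub>B\<^esub> l) + nrm B (X n \<ominus>\<^bsub>B\<^esub> l')) \<longlonglongrightarrow> 0"
    using c unfolding converges_to_def by (rule tendsto_add_zero)
  have "nrm B (l \<ominus>\<^bsub>B\<^esub> l') \<le> nrm B (X n \<ominus>\<^bsub>B\<^esub> l) + nrm B (X n \<ominus>\<^bsub>B\<^esub> l')" for n
    using nrm_diff_triangle[OF l(1) X[of n] l(2)] nrm_diff_swap[OF l(1) X[of n]] by simp
  then have "nrm B (l \<ominus>\<^bsub>B\<^esub> l') \<le> 0" by (intro LIMSEQ_le_const[OF s]) auto
  then have "nrm B (l \<ominus>\<^bsub>B\<^esub> l') = 0" using nrm_nonneg[OF M.minus_closed[OF l]] by linarith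
  then show ?thesis using nrm_definite[OF M.minus_closed[OF l]] diff_eq_zero l by blast
qed

text \<open>Contractive *-homomorphisms from a pre-C*-algebra extend to the completion.\<close>

lemma extend_hom:
  assumes A: "pre_cstar_algebra A" and B: "cstar_algebra B" and hom: "\<psi> \<in> star_hom A B"
    and contr: "\<And>x. x \<in> carrier A \<Longrightarrow> nrm B (\<psi> x) \<le> nrm A x"
  shows "\<exists>\<phi>\<in>star_hom (completion A) B. \<forall>x\<in>carrier A. \<phi> (const_class A x) = \<psi> x"
proof -
  interpret A: pre_cstar_algebra A by fact
  interpret B: cstar_algebra B by fact
  interpret star_hom_pair A B \<psi>
    by (rule star_hom_pair.intro[OF A.star_algebra_axioms B.star_algebra_axioms]) (unfold_locales, rule hom)
  note unique = cstar_lim_unique[OF B]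
  have psiC: "(\<lambda>n. \<psi> (X n)) \<in> cauchy_seqs B" if X: "X \<in> cauchy_seqs A" for X
  proof (rule B.cauchyI)
    show "\<psi> (X n) \<in> carrier B" for n by (intro h(1) A.cauchy_carrier[OF X])
    fix e :: real assume "e > 0"
    then obtain M where M: "\<forall>m\<ge>M. \<forall>n\<ge>M. nrm A (X m \<ominus>\<^bsub>A\<^esub> X n) < e" using A.cauchyD[OF X] by blast
    have "nrm B (\<psi> (X m) \<ominus>\<^bsub>B\<^esub> \<psi> (X n)) \<le> nrm A (X m \<ominus>\<^bsub>A\<^esub> X n)" for m n
      using contr[of "X m \<ominus>\<^bsub>A\<^esub> X n"] by (simp add: h_minus A.cauchy_carrier[OF X])
    then show "\<exists>M. \<forall>m\<ge>M. \<forall>n\<ge>M. nrm B (\<psi> (X m) \<ominus>\<^bsub>B\<^esub> \<psi> (X n)) < e" using M by (meson order.strict_trans1)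
  qed
  define L where "L X = (SOME l. l \<in> carrier B \<and> converges_to B (\<lambda>n. \<psi> (X n)) l)" for X
  have L: "L X \<in> carrier B \<and> converges_to B (\<lambda>n. \<psi> (X n)) (L X)" if "X \<in> cauchy_seqs A" for X
    unfolding L_def by (rule someI_ex) (use B.complete[OF psiC[OF that]] in blast)
  have Leq: "L X = l" if X: "X \<in> cauchy_seqs A" and "l \<in> carrier B" "converges_to B (\<lambda>n. \<psi> (X n)) l" for X l
    using L[OF X] that A.cauchy_carrier[OF X] h(1) by (intro unique[of "\<lambda>n. \<psi> (X n)"]) auto
  have eqvB: "B.eqv (\<lambda>n. \<psi> (X n)) (\<lambda>n. L X)" if X: "X \<in> cauchy_seqs A" for X
    using L[OF X] by (simp add: B.eqv_def converges_to_def)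
  have Lcl: "L X = L Y" if X: "X \<in> cauchy_seqs A" and Y: "Y \<in> seq_class A X" for X Y
  proof -
    have Yc: "Y \<in> cauchy_seqs A" and e: "A.eqv X Y" using Y by (auto simp: A.in_class)
    note cc = A.cauchy_carrier[OF X] A.cauchy_carrier[OF Yc] h(1) L[OF X] L[OF Yc]
    have "B.eqv (\<lambda>n. \<psi> (X n)) (\<lambda>n. \<psi> (Y n))"
    proof (rule B.eqv_bound)
      show "nrm B (\<psi> (X n) \<ominus>\<^bsub>B\<^esub> \<psi> (Y n)) \<le> nrm A (X n \<ominus>\<^bsub>A\<^esub> Y n)" for n
        using contr[of "X n \<ominus>\<^bsub>A\<^esub> Y n"] cc by (simp add: h_minus)
      show "(\<lambda>n. nrm A (X n \<ominus>\<^bsub>A\<^esub> Y n)) \<longlonglongrightarrow> 0" using e by (simp add: A.eqv_def)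
    qed (use cc in auto)
    then have "B.eqv (\<lambda>n. \<psi> (X n)) (\<lambda>n. L Y)"
      by (rule B.eqv_trans[rotated 3]) (use cc eqvB[OF Yc] in auto)
    then show ?thesis using cc by (intro Leq[OF X]) (auto simp: B.eqv_def converges_to_def)
  qed
  define \<phi> where "\<phi> U = L (SOME X. X \<in> U)" for U
  have phi: "\<phi> (seq_class A X) = L X" if X: "X \<in> cauchy_seqs A" for X
  proof -
    have "(SOME Y. Y \<in> seq_class A X) \<in> seq_class A X" by (rule someI[where P="\<lambda>Y. Y \<in> seq_class A X"]) (rule A.self_in_class[OF X])
    then show ?thesis unfolding \<phi>_def using Lcl[OF X] by metis
  qed
  have "\<phi> \<in> star_hom (completion A) B"
    unfolding star_hom_def
  proof (intro CollectI conjI ballI allI)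
    fix U c assume "U \<in> carrier (completion A)"
    then obtain X where X: "X \<in> cauchy_seqs A" "U = seq_class A X" by (auto simp: A.compl_carrier)
    note cX = A.cauchy_carrier[OF X(1)] h(1)[OF A.cauchy_carrier[OF X(1)]] L[OF X(1), THEN conjunct1]
    show "\<phi> U \<in> carrier B" using X cX by (simp add: phi)
    have "L (\<lambda>n. c \<odot>\<^bsub>A\<^esub> X n) = c \<odot>\<^bsub>B\<^esub> L X"
      using B.eqv_smult[OF psiC[OF X(1)] B.cauchy_const[OF cX(3)] eqvB[OF X(1)], of c] cX
      by (intro Leq A.cauchy_smult X) (auto simp: B.eqv_def converges_to_def h)
    then show "\<phi> (c \<odot>\<^bsub>completion A\<^esub> U) = c \<odot>\<^bsub>B\<^esub> \<phi> U" using X by (simp add: A.compl_smult phi A.cauchy_smult)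
    have "L (\<lambda>n. star A (X n)) = star B (L X)"
      using B.eqv_star[OF psiC[OF X(1)] B.cauchy_const[OF cX(3)] eqvB[OF X(1)]] cX
      by (intro Leq A.cauchy_star X) (auto simp: B.eqv_def converges_to_def h B.star_closed)
    then show "\<phi> (star (completion A) U) = star B (\<phi> U)" using X by (simp add: A.compl_star phi A.cauchy_star)
    fix V assume "V \<in> carrier (completion A)"
    then obtain Y where Y: "Y \<in> cauchy_seqs A" "V = seq_class A Y" by (auto simp: A.compl_carrier)
    note cY = A.cauchy_carrier[OF Y(1)] h(1)[OF A.cauchy_carrier[OF Y(1)]] L[OF Y(1), THEN conjunct1]
    have "L (\<lambda>n. X n \<oplus>\<^bsub>A\<^esub> Y n) = L X \<oplus>\<^bsub>B\<^esub> L Y"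
      using B.eqv_add[OF psiC[OF X(1)] psiC[OF Y(1)] B.cauchy_const[OF cX(3)] B.cauchy_const[OF cY(3)] eqvB[OF X(1)] eqvB[OF Y(1)]] cX cY
      by (intro Leq A.cauchy_add X Y) (auto simp: B.eqv_def converges_to_def h)
    then show "\<phi> (U \<oplus>\<^bsub>completion A\<^esub> V) = \<phi> U \<oplus>\<^bsub>B\<^esub> \<phi> V" using X Y by (simp add: A.compl_add phi A.cauchy_add)
    have "L (\<lambda>n. X n \<otimes>\<^bsub>A\<^esub> Y n) = L X \<otimes>\<^bsub>B\<^esub> L Y"
      using B.eqv_mult[OF psiC[OF X(1)] psiC[OF Y(1)] B.cauchy_const[OF cX(3)] B.cauchy_const[OF cY(3)] eqvB[OF X(1)] eqvB[OF Y(1)]] cX cY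
      by (intro Leq A.cauchy_mult X Y) (auto simp: B.eqv_def converges_to_def h B.mult_closed)
    then show "\<phi> (U \<otimes>\<^bsub>completion A\<^esub> V) = \<phi> U \<otimes>\<^bsub>B\<^esub> \<phi> V" using X Y by (simp add: A.compl_mult phi A.cauchy_mult)
  qed
  moreover have "\<phi> (const_class A x) = \<psi> x" if "x \<in> carrier A" for x
    using that h(1)[OF that] by (subst phi) (auto intro!: Leq simp: converges_to_def)
  ultimately show ?thesis by blast
qed

theorem graph_cstar_universal:
  fixes B :: "'b normed_star_alg"
  assumes B: "cstar_algebra B" and ck: "ck_family E B q t"
  shows "\<exists>\<phi>\<in>star_hom (graph_cstar E) B.
    (\<forall>v\<in>verts E. \<phi> (gp E v) = q v) \<and> (\<forall>e\<in>arcs E. \<phi> (gs E e) = t e)"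
proof -
  interpret B: cstar_algebra B by fact
  let ?G = "Inl ` verts E \<union> Inr ` arcs E"
  let ?g = "case_sum q t"
  have gc: "\<And>x. x \<in> ?G \<Longrightarrow> ?g x \<in> carrier B"
    using ck by (auto simp: ck_family_def is_projection_def is_partial_isometry_def)
  let ?N = "\<lambda>f. nrm B (B.feval ?g f)"
  have hom: "B.feval ?g \<in> star_hom (FE M) B" for M by (rule B.feval_hom[OF gc])
  have gP: "B.feval ?g (vgen v) = q v" if "v \<in> verts E" for v
    using B.feval_gen[where G="?G" and g="?g", OF gc, of "Inl v"] that by simp
  have gT: "B.feval ?g (egen e) = t e" if "e \<in> arcs E" for e
    using B.feval_gen[where G="?G" and g="?g", OF gc, of "Inr e"] that by simp
  note hD = star_homD[OF hom]
  have pre: "pre_cstar_algebra (FE ?N)"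
    by (rule pre_cstar_algebra.intro[OF FE_alg], rule pre_cstar_algebra_axioms.intro)
       (simp_all add: FE_nrm hD[of _ ?N] FE_star B.nrm_nonneg B.nrm_triangle B.nrm_smult B.nrm_mult B.cstar_identity)
  have ckB: "ck_family E B (\<lambda>v. B.feval ?g (vgen v)) (\<lambda>e. B.feval ?g (egen e))"
  proof -
    have tc: "e \<in> arcs E \<Longrightarrow> t e \<in> carrier B" for e using gc[of "Inr e"] by simp
    have fs: "finsum B (\<lambda>e. t e \<otimes>\<^bsub>B\<^esub> star B (t e)) (out_arcs E v)
       = finsum B (\<lambda>e. B.feval ?g (egen e) \<otimes>\<^bsub>B\<^esub> star B (B.feval ?g (egen e))) (out_arcs E v)" for v
      using tc by (intro B.M.finsum_cong') (auto simp: gT intro!: B.mult_closed B.star_closed)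
    have rv: "regular_vertex E v \<Longrightarrow> v \<in> verts E" for v by (simp add: regular_vertex_def)
    show ?thesis using ck by (simp add: ck_family_def gP gT fs rv)
  qed
  have "?N \<in> graph_seminorms E"
    unfolding graph_seminorms_iff
  proof (intro conjI allI impI pre)
    fix x y assume r: "ckrel E (FE ?N) x y"
    interpret sh: star_hom_pair "FE ?N" B "B.feval ?g"
      by (rule star_hom_pair.intro[OF FE_alg B.star_algebra_axioms]) (unfold_locales, rule hom)
    note c = ckrel_carrier[OF r]
    have "B.feval ?g x = B.feval ?g y" using ck_family_iff[OF B.star_algebra_axioms hom] ckB r by blast
    then show "?N (x \<ominus>\<^bsub>FE ?N\<^esub> y) = 0" using c by (simp add: sh.h_minus sh.h)
  qed
  then have "?N f \<le> univ_nrm f" if "f \<in> carrier (FE univ_nrm)" for f by (rule uN_upper[OF that])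
  then obtain \<phi> where "\<phi> \<in> star_hom (completion (FE univ_nrm)) B"
      "\<forall>x\<in>carrier (FE univ_nrm). \<phi> (const_class (FE univ_nrm) x) = B.feval ?g x"
    using extend_hom[OF uN_pre B hom] unfolding FE_nrm by blast
  then show ?thesis using gP gT
    by (intro bexI[of _ \<phi>]) (auto simp: graph_cstar_def graph_normed_alg_def gp_def gs_def P_carrier[of _ univ_nrm] T_carrier[of _ univ_nrm])
qed

theorem graph_cstar_generated:
  assumes D: "D \<subseteq> carrier (graph_cstar E)"
    and add: "\<And>x y. x \<in> D \<Longrightarrow> y \<in> D \<Longrightarrow> x \<oplus>\<^bsub>graph_cstar E\<^esub> y \<in> D"
    and smult: "\<And>c x. x \<in> D \<Longrightarrow> c \<odot>\<^bsub>graph_cstar E\<^esub> x \<in> D"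
    and mult: "\<And>x y. x \<in> D \<Longrightarrow> y \<in> D \<Longrightarrow> x \<otimes>\<^bsub>graph_cstar E\<^esub> y \<in> D"
    and star: "\<And>x. x \<in> D \<Longrightarrow> star (graph_cstar E) x \<in> D"
    and zero: "\<zero>\<^bsub>graph_cstar E\<^esub> \<in> D"
    and closed: "\<And>X l. range X \<subseteq> D \<Longrightarrow> l \<in> carrier (graph_cstar E) \<Longrightarrow> converges_to (graph_cstar E) X l \<Longrightarrow> l \<in> D"
    and gens: "gp E ` verts E \<subseteq> D" "gs E ` arcs E \<subseteq> D"
  shows "D = carrier (graph_cstar E)"
proof -
  let ?F = "FE univ_nrm" let ?c = "const_class (FE univ_nrm)"
  interpret F: pre_cstar_algebra ?F by (rule uN_pre)
  have C: "graph_cstar E = completion ?F" by (simp add: graph_cstar_def graph_normed_alg_def)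
  note cD = star_homD[OF const_hom[OF uN_pre]]
  have gen: "?c (free_gen x) \<in> D" if "x \<in> Inl ` verts E \<union> Inr ` arcs E" for x
    using that gens by (auto simp: gp_def gs_def graph_normed_alg_def)
  have let1: "?c (monomial 1 [l]) \<in> D" if l: "fst l \<in> Inl ` verts E \<union> Inr ` arcs E" for l
  proof (cases "snd l")
    case True
    have "monomial 1 [l] = star ?F (free_gen (fst l))"
      unfolding free_gen_mono mono_star using True by (cases l) (simp add: adj_word_def)
    then show ?thesis using star[OF gen[OF l]] cD(5)[OF free_gen_carrier[OF l]] C by simp
  next
    case False
    then have "monomial 1 [l] = free_gen (fst l)" by (cases l) (simp add: free_gen_mono)
    then show ?thesis using gen[OF l] by simp
  qed
  have word: "?c (monomial 1 w) \<in> D" if "w \<in> words (Inl ` verts E \<union> Inr ` arcs E)" for w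
    using that
  proof (induction w)
    case (Cons l w)
    have l: "fst l \<in> Inl ` verts E \<union> Inr ` arcs E" using Cons.prems by (auto simp: words_def)
    show ?case
    proof (cases "w = []")
      case False
      then have w: "w \<in> words (Inl ` verts E \<union> Inr ` arcs E)" using Cons.prems by (auto simp: words_def)
      have lw: "[l] \<in> words (Inl ` verts E \<union> Inr ` arcs E)" using l by (auto simp: words_def)
      have "monomial 1 (l # w) = monomial 1 [l] \<otimes>\<^bsub>?F\<^esub> monomial 1 w" by (simp only: mono_mult) simp
      then show ?thesis using mult[OF let1[OF l] Cons.IH[OF w]] cD(4)[OF mono_carrier[OF lw] mono_carrier[OF w]] C by simp
    qed (use let1[OF l] in simp)
  qed (simp add: words_def)
  have const: "?c f \<in> D" if "f \<in> carrier ?F" for f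
    using that
  proof (induction f rule: free_induct)
    case zero
    then show ?case using assms(6) unfolding C F.compl_zero by (simp add: free_simps)
  next
    case (add f c w)
    have m: "?c (monomial c w) \<in> D"
      using smult[OF word[OF add.hyps(2)], of c] cD(3)[OF mono_carrier[OF add.hyps(2)], of c 1] C by (simp add: mono_smult)
    show ?case using assms(2)[OF add.IH m] cD(2)[OF add.hyps(1) mono_carrier[OF add.hyps(2)]] C by simp
  qed
  have "U \<in> D" if U: "U \<in> carrier (graph_cstar E)" for U
  proof -
    obtain X where X: "X \<in> cauchy_seqs ?F" "U = seq_class ?F X" using U by (auto simp: C F.compl_carrier)
    show ?thesis using F.const_approx[OF X(1)] X U const F.cauchy_carrier[OF X(1)]
      by (intro closed[of "\<lambda>k. ?c (X k)"]) (auto simp: C)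
  qed
  then show ?thesis using D by blast
qed

end

end

(*
  The formulas v |-> p_v or p_v^H, alpha |-> s_alpha Q_{r(alpha)} define a Cuntz-Krieger family of the
  ideal graph in C*(E), hence a *-homomorphism from the free *-algebra of that graph to C*(E) whose
  image is dense in the ideal. Injectivity is obtained without a uniqueness theorem: B = C*(ideal graph)
  should be an ideal of C*(E), so C*(E) should act on B by multipliers. Those multipliers are
  written down as infinite sums of partial isometries of B; they converge on the right B-module X of
  elements supported under finitely many vertex projections. The bounded adjointable operators on X
  form a pre-C*-algebra in which they are a Cuntz-Krieger E-family, and the composite of the
  two representations is left multiplication of B on X. Left multiplication is isometric, so the
  first map is isometric for the universal norms.
*)

theory Submission
  imports Defs
begin

section \<open>Sums with finitely many nonzero terms\<close>

text \<open>The universal norm is a supremum of C*-seminorms on a free *-algebra, so a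
  representation in any pre-C*-algebra bounds it from below. Injectivity thus becomes an inequality
  between seminorms of *-polynomials, and the operators on X never have to be completed. The
  obstacle is that infinitely many vertices of the ideal graph may lie over one vertex of E, and the
  corresponding sums of partial isometries need not converge in norm. An element of X meets only
  finitely many of the orthogonal vertex projections, so every such sum is finite when applied to
  it. X is still large enough to see the norm: it contains every *-polynomial b in the generators of
  B, so left multiplication by b can be tested on the adjoint of b. The formulas of the action are
  read off inside C*(E): s_e times the corner projection at r(e) is again a generator of the ideal,
  and s_e T_\<alpha> = T_{e\<alpha>}. Hence s_e moves the vertex projection of \<alpha> to that of
  e\<alpha> by T_{e\<alpha>} times the adjoint of T_\<alpha>, an expression that makes sense in
  B.\<close>

context star_algebra begin

declare mult_closed [simp] star_closed [simp] star_star [simp]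

text \<open>Stated for an arbitrary additive map so that multiplication from either side and the
  adjoint become instances. For infinite \<open>I\<close> both sides collapse to \<zero>, because
  \<open>finsum\<close> does.\<close>

lemma map_finsum:
  assumes closed: "\<And>x. x \<in> carrier A \<Longrightarrow> F x \<in> carrier A" and zero: "F \<zero> = \<zero>"
    and add: "\<And>x y. \<lbrakk>x \<in> carrier A; y \<in> carrier A\<rbrakk> \<Longrightarrow> F (x \<oplus> y) = F x \<oplus> F y"
    and f: "\<And>i. i \<in> I \<Longrightarrow> f i \<in> carrier A"
  shows "F (finsum A f I) = finsum A (\<lambda>i. F (f i)) I"
proof (cases "finite I")
  case True
  then show ?thesis using f
  proof (induction I)
    case (insert i I)
    then have "finsum A f I \<in> carrier A" by (intro M.finsum_closed) auto
    then show ?case using insert closed add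
      by (subst M.finsum_insert) (auto simp: Pi_iff M.finsum_insert)
  qed (simp add: zero)
qed (simp add: zero)

lemma mult_finsum:
  "\<lbrakk>m \<in> carrier A; \<And>i. i \<in> I \<Longrightarrow> f i \<in> carrier A\<rbrakk> \<Longrightarrow> m \<otimes> finsum A f I = finsum A (\<lambda>i. m \<otimes> f i) I"
  by (rule map_finsum) (auto simp: distrib_left)

lemma finsum_mult:
  "\<lbrakk>m \<in> carrier A; \<And>i. i \<in> I \<Longrightarrow> f i \<in> carrier A\<rbrakk> \<Longrightarrow> finsum A f I \<otimes> m = finsum A (\<lambda>i. f i \<otimes> m) I"
  by (rule map_finsum[of "\<lambda>x. x \<otimes> m"]) (auto simp: distrib_right)

lemma star_finsum:
  "(\<And>i. i \<in> I \<Longrightarrow> f i \<in> carrier A) \<Longrightarrow> star A (finsum A f I) = finsum A (\<lambda>i. star A (f i)) I"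
  by (rule map_finsum) (auto simp: star_add)

lemma finsum_single:
  assumes "finite I" "i \<in> I" "f i \<in> carrier A" "\<And>j. j \<in> I \<Longrightarrow> j \<noteq> i \<Longrightarrow> f j = \<zero>"
  shows "finsum A f I = f i"
proof -
  have "finsum A f I = finsum A f {i}"
    by (rule M.add.finprod_mono_neutral_cong_right) (use assms in \<open>auto simp: Pi_iff, metis M.zero_closed\<close>)
  then show ?thesis using assms by simp
qed

text \<open>On an infinite index set \<open>finsum\<close> is \<zero> by convention. Cutting down to
  the support gives the intended value for families with finitely many nonzero terms.\<close>

definition fsum :: "('i \<Rightarrow> 'a) \<Rightarrow> 'i set \<Rightarrow> 'a" where
  "fsum f D = finsum A f {i \<in> D. f i \<noteq> \<zero>}"

lemma fsum_cong: "D = D' \<Longrightarrow> (\<And>i. i \<in> D' \<Longrightarrow> f i \<in> carrier A) \<Longrightarrow> (\<And>i. i \<in> D' \<Longrightarrow> f i = g i)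
    \<Longrightarrow> fsum f D = fsum g D'"
  unfolding fsum_def by (rule M.add.finprod_cong') auto

lemma fsum_eq_finsum:
  assumes "finite W" "{i \<in> D. f i \<noteq> \<zero>} \<subseteq> W" "W \<subseteq> D" "\<And>i. i \<in> W \<Longrightarrow> f i \<in> carrier A"
  shows "fsum f D = finsum A f W"
  unfolding fsum_def by (rule M.add.finprod_mono_neutral_cong_left) (use assms in auto)

lemma fsum_zero: "(\<And>i. i \<in> D \<Longrightarrow> f i = \<zero>) \<Longrightarrow> fsum f D = \<zero>"
  unfolding fsum_def by (rule M.add.finprod_one_eqI) auto

lemma fsum_single:
  assumes "i \<in> D" "f i \<in> carrier A" "\<And>j. j \<in> D \<Longrightarrow> j \<noteq> i \<Longrightarrow> f j = \<zero>"
  shows "fsum f D = f i"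
proof -
  have "fsum f D = finsum A f {i}" by (rule fsum_eq_finsum) (use assms in auto)
  then show ?thesis using assms by simp
qed

lemma map_fsum:
  assumes closed: "\<And>x. x \<in> carrier A \<Longrightarrow> F x \<in> carrier A" and zero: "F \<zero> = \<zero>"
    and add: "\<And>x y. \<lbrakk>x \<in> carrier A; y \<in> carrier A\<rbrakk> \<Longrightarrow> F (x \<oplus> y) = F x \<oplus> F y"
    and f: "\<And>i. i \<in> D \<Longrightarrow> f i \<in> carrier A" and fin: "finite {i \<in> D. f i \<noteq> \<zero>}"
  shows "F (fsum f D) = fsum (\<lambda>i. F (f i)) D"
proof -
  have "F (fsum f D) = finsum A (\<lambda>i. F (f i)) {i \<in> D. f i \<noteq> \<zero>}"
    unfolding fsum_def by (rule map_finsum) (use assms in auto)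
  \<comment> \<open>\<open>F\<close> may kill terms, so the support on the right can be smaller; the
    old support still covers it.\<close>
  also have "\<dots> = fsum (\<lambda>i. F (f i)) D"
    by (rule fsum_eq_finsum[symmetric]) (use assms in auto)
  finally show ?thesis .
qed

lemma mult_fsum:
  "\<lbrakk>m \<in> carrier A; \<And>i. i \<in> D \<Longrightarrow> f i \<in> carrier A; finite {i \<in> D. f i \<noteq> \<zero>}\<rbrakk>
    \<Longrightarrow> m \<otimes> fsum f D = fsum (\<lambda>i. m \<otimes> f i) D"
  by (rule map_fsum) (auto simp: distrib_left)

lemma fsum_mult:
  "\<lbrakk>m \<in> carrier A; \<And>i. i \<in> D \<Longrightarrow> f i \<in> carrier A; finite {i \<in> D. f i \<noteq> \<zero>}\<rbrakk>
    \<Longrightarrow> fsum f D \<otimes> m = fsum (\<lambda>i. f i \<otimes> m) D"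
  by (rule map_fsum[of "\<lambda>x. x \<otimes> m"]) (auto simp: distrib_right)

lemma star_fsum:
  "\<lbrakk>\<And>i. i \<in> D \<Longrightarrow> f i \<in> carrier A; finite {i \<in> D. f i \<noteq> \<zero>}\<rbrakk>
    \<Longrightarrow> star A (fsum f D) = fsum (\<lambda>i. star A (f i)) D"
  by (rule map_fsum) (auto simp: star_add)

lemma smult_fsum:
  "\<lbrakk>\<And>i. i \<in> D \<Longrightarrow> f i \<in> carrier A; finite {i \<in> D. f i \<noteq> \<zero>}\<rbrakk>
    \<Longrightarrow> c \<odot> fsum f D = fsum (\<lambda>i. c \<odot> f i) D"
  by (rule map_fsum) (auto simp: sm_rdist)

lemma fsum_add:
  assumes "\<And>i. i \<in> D \<Longrightarrow> f i \<in> carrier A" "\<And>i. i \<in> D \<Longrightarrow> g i \<in> carrier A"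
    and "finite {i \<in> D. f i \<noteq> \<zero>}" "finite {i \<in> D. g i \<noteq> \<zero>}"
  shows "fsum f D \<oplus> fsum g D = fsum (\<lambda>i. f i \<oplus> g i) D"
proof -
  let ?W = "{i \<in> D. f i \<noteq> \<zero>} \<union> {i \<in> D. g i \<noteq> \<zero>}"
  have "fsum f D = finsum A f ?W" "fsum g D = finsum A g ?W"
    by (rule fsum_eq_finsum; use assms in auto)+
  moreover have "fsum (\<lambda>i. f i \<oplus> g i) D = finsum A (\<lambda>i. f i \<oplus> g i) ?W"
    by (rule fsum_eq_finsum) (use assms in auto)
  ultimately show ?thesis using assms by (subst (asm) M.finsum_addf) auto
qed

end

section \<open>Bounded adjointable operators on a subspace of a C*-algebra\<close>

text \<open>
  A subspace \<open>X\<close> of a C*-algebra carries the algebra-valued inner product \<open>star x \<otimes> y\<close>, which makes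
  it a pre-Hilbert module. Operators are extended by zero outside \<open>X\<close>, so that pointwise operations
  and composition need no restriction.
\<close>

definition adj_pair :: "'a normed_star_alg \<Rightarrow> 'a set \<Rightarrow> ('a \<Rightarrow> 'a) \<Rightarrow> ('a \<Rightarrow> 'a) \<Rightarrow> bool" where
  "adj_pair B X T T' \<longleftrightarrow> T ` X \<subseteq> X \<and> T' ` X \<subseteq> X \<and>
     (\<forall>x. x \<notin> X \<longrightarrow> T x = \<zero>\<^bsub>B\<^esub> \<and> T' x = \<zero>\<^bsub>B\<^esub>) \<and>
     (\<forall>x\<in>X. \<forall>y\<in>X. star B (T x) \<otimes>\<^bsub>B\<^esub> y = star B x \<otimes>\<^bsub>B\<^esub> T' y)"

definition op_bounds :: "'a normed_star_alg \<Rightarrow> 'a set \<Rightarrow> ('a \<Rightarrow> 'a) \<Rightarrow> real set" where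
  "op_bounds B X T = {K. 0 \<le> K \<and> (\<forall>x\<in>X. nrm B (T x) \<le> K * nrm B x)}"

text \<open>\<open>X\<close> need not be complete, so an adjoint does not force boundedness and the
  carrier asks for both. The choice in \<open>star\<close> is harmless because adjoints are
  unique.\<close>

definition adj_alg :: "'a normed_star_alg \<Rightarrow> 'a set \<Rightarrow> ('a \<Rightarrow> 'a) normed_star_alg" where
  "adj_alg B X = \<lparr>
     carrier = {T. (\<exists>T'. adj_pair B X T T') \<and> op_bounds B X T \<noteq> {}},
     monoid.mult = (\<lambda>S T x. S (T x)),
     one = undefined,
     zero = (\<lambda>x. \<zero>\<^bsub>B\<^esub>),
     add = (\<lambda>S T x. S x \<oplus>\<^bsub>B\<^esub> T x),
     smult = (\<lambda>c T x. c \<odot>\<^bsub>B\<^esub> T x),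
     star = (\<lambda>T. SOME T'. adj_pair B X T T'),
     nrm = (\<lambda>T. Inf (op_bounds B X T))\<rparr>"

lemma adj_alg_simps:
  "carrier (adj_alg B X) = {T. (\<exists>T'. adj_pair B X T T') \<and> op_bounds B X T \<noteq> {}}"
  "S \<otimes>\<^bsub>adj_alg B X\<^esub> T = (\<lambda>x. S (T x))"
  "S \<oplus>\<^bsub>adj_alg B X\<^esub> T = (\<lambda>x. S x \<oplus>\<^bsub>B\<^esub> T x)"
  "c \<odot>\<^bsub>adj_alg B X\<^esub> T = (\<lambda>x. c \<odot>\<^bsub>B\<^esub> T x)"
  "\<zero>\<^bsub>adj_alg B X\<^esub> = (\<lambda>x. \<zero>\<^bsub>B\<^esub>)"
  "nrm (adj_alg B X) T = Inf (op_bounds B X T)"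
  by (simp_all add: adj_alg_def)

locale cstar_subspace = cstar_algebra B for B (structure) +
  fixes X
  assumes X_carrier: "X \<subseteq> carrier B" and X_zero [simp]: "\<zero> \<in> X"
    and X_add [simp]: "\<lbrakk>x \<in> X; y \<in> X\<rbrakk> \<Longrightarrow> x \<oplus> y \<in> X"
    and X_smult [simp]: "x \<in> X \<Longrightarrow> c \<odot> x \<in> X"
begin

abbreviation "\<A> \<equiv> adj_alg B X"

lemma X_in_carrier [simp]: "x \<in> X \<Longrightarrow> x \<in> carrier B"
  using X_carrier by blast

lemma X_minus [simp]: "\<lbrakk>x \<in> X; y \<in> X\<rbrakk> \<Longrightarrow> x \<ominus> y \<in> X"
  by (simp add: minus_sm)

text \<open>The difference \<open>y \<ominus> y'\<close> lies in \<open>X\<close> and can be used as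
  the test vector; the C*-identity then makes it vanish.\<close>

lemma nondegenerate:
  assumes "y \<in> X" "y' \<in> X" "\<And>x. x \<in> X \<Longrightarrow> star B x \<otimes> y = star B x \<otimes> y'"
  shows "y = y'"
proof -
  let ?z = "y \<ominus> y'"
  have "star B ?z \<otimes> ?z = star B ?z \<otimes> y \<oplus> (-1) \<odot> (star B ?z \<otimes> y')"
    using assms(1,2) by (simp add: minus_sm distrib_left smult_mult_right)
  also have "\<dots> = star B ?z \<otimes> y \<ominus> star B ?z \<otimes> y'" using assms(1,2) by (simp add: minus_sm)
  also have "\<dots> = \<zero>" using assms by simp
  finally have "nrm B ?z = 0" using cstar_identity[of ?z] assms(1,2) by simp
  then have "?z = \<zero>" by (rule nrm_definite[rotated]) (use assms(1,2) \<open>nrm B ?z = 0\<close> in auto)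
  then show ?thesis by (rule diff_eq_zero[rotated 2]) (use assms(1,2) in auto)
qed

lemma adj_pairD:
  assumes "adj_pair B X T T'"
  shows "x \<in> X \<Longrightarrow> T x \<in> X" "x \<in> X \<Longrightarrow> T' x \<in> X" "x \<notin> X \<Longrightarrow> T x = \<zero>" "x \<notin> X \<Longrightarrow> T' x = \<zero>"
    "\<lbrakk>x \<in> X; y \<in> X\<rbrakk> \<Longrightarrow> star B (T x) \<otimes> y = star B x \<otimes> T' y"
  using assms unfolding adj_pair_def by blast+

lemma adj_pair_sym: assumes "adj_pair B X T T'" shows "adj_pair B X T' T"
proof -
  note a = adj_pairD[OF assms]
  have "star B (T' x) \<otimes> y = star B x \<otimes> T y" if "x \<in> X" "y \<in> X" for x y
  proof -
    have "star B (T' x) \<otimes> y = star B (star B y \<otimes> T' x)" using that a(1,2) by (simp add: star_mult)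
    also have "\<dots> = star B (star B (T y) \<otimes> x)" using a(5)[OF that(2,1)] by simp
    also have "\<dots> = star B x \<otimes> T y" using that a(1,2) by (simp add: star_mult)
    finally show ?thesis .
  qed
  then show ?thesis using assms unfolding adj_pair_def by blast
qed

lemma adj_pair_unique: assumes "adj_pair B X T T'" "adj_pair B X T T''" shows "T' = T''"
proof
  fix y
  note a = adj_pairD[OF assms(1)] adj_pairD[OF assms(2)]
  show "T' y = T'' y"
  proof (cases "y \<in> X")
    case True
    show ?thesis
      by (rule nondegenerate) (use True a(2,7) a(5)[OF _ True] a(10)[OF _ True] in simp_all)
  qed (use a in auto)
qed

lemma star_eq: "adj_pair B X T T' \<Longrightarrow> star \<A> T = T'"
  unfolding adj_alg_def by simp (rule some_equality, auto intro: adj_pair_unique)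

lemma adj_pair_star: "T \<in> carrier \<A> \<Longrightarrow> adj_pair B X T (star \<A> T)"
  using star_eq by (auto simp: adj_alg_simps)

text \<open>Having an adjoint forces linearity: move the operator to the other side of the inner
  product, add there, and move it back. This is why \<open>adj_pair\<close> does not demand
  it.\<close>

lemma pair_add: assumes "adj_pair B X T T'" "x \<in> X" "y \<in> X" shows "T (x \<oplus> y) = T x \<oplus> T y"
proof -
  note a = adj_pairD[OF adj_pair_sym[OF assms(1)]]
  show ?thesis
    by (rule nondegenerate) (use assms(2,3) a(1,2) in \<open>simp_all add: a(5)[symmetric] distrib_left\<close>)
qed

lemma pair_smult: assumes "adj_pair B X T T'" "x \<in> X" shows "T (c \<odot> x) = c \<odot> T x"
proof -
  note a = adj_pairD[OF adj_pair_sym[OF assms(1)]]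
  show ?thesis
    by (rule nondegenerate) (use assms(2) a(1,2) in \<open>simp_all add: a(5)[symmetric] smult_mult_right\<close>)
qed

lemma pair_zero: "adj_pair B X T T' \<Longrightarrow> T \<zero> = \<zero>"
  using pair_smult[of T T' \<zero> 0] adj_pairD(1)[of T T' \<zero>] by simp

text \<open>The infimum defining the norm is itself a bound: every member of
  \<open>op_bounds\<close> lies above the quotient of \<open>nrm B (T x)\<close> by
  \<open>nrm B x\<close>, hence so does their infimum.\<close>

lemma op_bound:
  assumes "op_bounds B X T \<noteq> {}" "x \<in> X"
  shows "nrm B (T x) \<le> nrm \<A> T * nrm B x"
proof (cases "nrm B x = 0")
  case True
  then show ?thesis using assms by (auto simp: op_bounds_def)
next
  case False
  then have p: "nrm B x > 0" using nrm_nonneg[of x] assms by simp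
  have "nrm B (T x) / nrm B x \<le> nrm \<A> T" unfolding adj_alg_simps
    by (rule cInf_greatest[OF assms(1)]) (use assms(2) p in \<open>auto simp: op_bounds_def divide_le_eq\<close>)
  then show ?thesis using p by (simp add: divide_le_eq)
qed

lemma op_nrm_le: "0 \<le> K \<Longrightarrow> (\<And>x. x \<in> X \<Longrightarrow> nrm B (T x) \<le> K * nrm B x) \<Longrightarrow> nrm \<A> T \<le> K"
  unfolding adj_alg_simps by (rule cInf_lower) (auto simp: op_bounds_def bdd_below_def)

lemma op_nrm_nonneg: "op_bounds B X T \<noteq> {} \<Longrightarrow> 0 \<le> nrm \<A> T"
  unfolding adj_alg_simps by (rule cInf_greatest) (auto simp: op_bounds_def)

lemma op_boundsI: "0 \<le> K \<Longrightarrow> (\<And>x. x \<in> X \<Longrightarrow> nrm B (T x) \<le> K * nrm B x) \<Longrightarrow> op_bounds B X T \<noteq> {}"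
  by (auto simp: op_bounds_def)

text \<open>The square of the norm of \<open>T' x\<close> is the norm of the inner product of
  \<open>T (T' x)\<close> with \<open>x\<close>, which is at most
  \<open>nrm \<A> T * nrm B (T' x) * nrm B x\<close>; cancel one factor. Submultiplicativity of the
  norm of \<open>B\<close> plays the part of the Cauchy-Schwarz inequality.\<close>

lemma adj_bound:
  assumes "adj_pair B X T T'" "op_bounds B X T \<noteq> {}" "x \<in> X"
  shows "nrm B (T' x) \<le> nrm \<A> T * nrm B x"
proof (cases "nrm B (T' x) = 0")
  case True
  then show ?thesis using op_nrm_nonneg[OF assms(2)] nrm_nonneg assms(3) by simp
next
  case False
  note a = adj_pairD[OF assms(1)]
  have p: "nrm B (T' x) > 0" using False nrm_nonneg[of "T' x"] a assms(3) by simp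
  have "nrm B (T' x) * nrm B (T' x) = nrm B (star B (T' x) \<otimes> T' x)"
    using a assms(3) by (simp add: cstar_identity power2_eq_square)
  also have "\<dots> = nrm B (star B (T (T' x)) \<otimes> x)" using a assms(3) by simp
  also have "\<dots> \<le> nrm B (T (T' x)) * nrm B x"
    using a assms(3) nrm_mult[of "star B (T (T' x))" x] by simp
  also have "\<dots> \<le> (nrm \<A> T * nrm B (T' x)) * nrm B x"
    using a assms(3) by (intro mult_right_mono op_bound[OF assms(2)] nrm_nonneg) auto
  finally show ?thesis using p by (simp add: mult.commute mult.left_commute)
qed

lemma mult_pair: "adj_pair B X S S' \<Longrightarrow> adj_pair B X T T' \<Longrightarrow> adj_pair B X (\<lambda>x. S (T x)) (\<lambda>x. T' (S' x))"
  \<comment> \<open>Outside \<open>X\<close> the inner operator returns \<zero>, so the outer one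
    has to fix \<zero> for the composite to vanish there.\<close>
  using pair_zero[of S S'] pair_zero[OF adj_pair_sym, of T T']
  by (auto simp: adj_pair_def image_subset_iff)

lemma add_pair: "adj_pair B X S S' \<Longrightarrow> adj_pair B X T T' \<Longrightarrow> adj_pair B X (\<lambda>x. S x \<oplus> T x) (\<lambda>x. S' x \<oplus> T' x)"
  by (auto simp: adj_pair_def image_subset_iff star_add distrib_left distrib_right)

lemma smult_pair: "adj_pair B X T T' \<Longrightarrow> adj_pair B X (\<lambda>x. c \<odot> T x) (\<lambda>x. cnj c \<odot> T' x)"
  by (auto simp: adj_pair_def image_subset_iff star_smult smult_mult_left smult_mult_right)

lemma zero_pair: "adj_pair B X (\<lambda>x. \<zero>) (\<lambda>x. \<zero>)"
  by (auto simp: adj_pair_def)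

lemma adj_carrierI: "adj_pair B X T T' \<Longrightarrow> 0 \<le> K \<Longrightarrow> (\<And>x. x \<in> X \<Longrightarrow> nrm B (T x) \<le> K * nrm B x) \<Longrightarrow> T \<in> carrier \<A>"
  using op_boundsI[of K T] by (auto simp: adj_alg_simps)

lemma adj_closed: assumes "T \<in> carrier \<A>" shows "star \<A> T \<in> carrier \<A>"
proof -
  have b: "op_bounds B X T \<noteq> {}" using assms by (simp add: adj_alg_simps)
  note p = adj_pair_star[OF assms]
  show ?thesis by (rule adj_carrierI[OF adj_pair_sym[OF p] op_nrm_nonneg[OF b] adj_bound[OF p b]])
qed

lemma adj_carrierD: assumes "T \<in> carrier \<A>"
  shows "x \<in> X \<Longrightarrow> T x \<in> X" "x \<notin> X \<Longrightarrow> T x = \<zero>" "op_bounds B X T \<noteq> {}"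
  using adj_pairD[OF adj_pair_star[OF assms]] assms by (auto simp: adj_alg_simps)

lemma op_ext: "S \<in> carrier \<A> \<Longrightarrow> T \<in> carrier \<A> \<Longrightarrow> (\<And>x. x \<in> X \<Longrightarrow> S x = T x) \<Longrightarrow> S = T"
  using adj_carrierD(2) by (intro ext) metis

lemma mult_bound:
  assumes "S \<in> carrier \<A>" "T \<in> carrier \<A>" "x \<in> X"
  shows "nrm B (S (T x)) \<le> (nrm \<A> S * nrm \<A> T) * nrm B x"
proof -
  note c = adj_carrierD[OF assms(1)] adj_carrierD[OF assms(2)]
  have "nrm B (S (T x)) \<le> nrm \<A> S * nrm B (T x)" using c assms by (intro op_bound) auto
  also have "\<dots> \<le> nrm \<A> S * (nrm \<A> T * nrm B x)"
    using c assms by (intro mult_left_mono op_bound op_nrm_nonneg) auto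
  finally show ?thesis by (simp add: mult.assoc)
qed

lemma add_bound:
  assumes "S \<in> carrier \<A>" "T \<in> carrier \<A>" "x \<in> X"
  shows "nrm B (S x \<oplus> T x) \<le> (nrm \<A> S + nrm \<A> T) * nrm B x"
proof -
  note c = adj_carrierD[OF assms(1)] adj_carrierD[OF assms(2)]
  show ?thesis using nrm_triangle[of "S x" "T x"] op_bound[OF c(3), of x] op_bound[OF c(6), of x] c assms
    by (simp add: ring_class.ring_distribs)
qed

lemma smult_bound:
  assumes "T \<in> carrier \<A>" "x \<in> X"
  shows "nrm B (c \<odot> T x) \<le> (cmod c * nrm \<A> T) * nrm B x"
  using op_bound[of T x] adj_carrierD[OF assms(1)] assms(2)
  by (simp add: nrm_smult mult_left_mono mult.assoc)

lemma adj_alg_closed: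
  assumes "S \<in> carrier \<A>" "T \<in> carrier \<A>"
  shows "(\<lambda>x. S (T x)) \<in> carrier \<A>" "(\<lambda>x. S x \<oplus> T x) \<in> carrier \<A>" "(\<lambda>x. c \<odot> T x) \<in> carrier \<A>"
    "(\<lambda>x. \<zero>) \<in> carrier \<A>"
proof -
  note n = op_nrm_nonneg[OF adj_carrierD(3)[OF assms(1)]] op_nrm_nonneg[OF adj_carrierD(3)[OF assms(2)]]
  note p = adj_pair_star[OF assms(1)] adj_pair_star[OF assms(2)]
  show "(\<lambda>x. S (T x)) \<in> carrier \<A>"
    by (rule adj_carrierI[OF mult_pair[OF p] _ mult_bound[OF assms]]) (use n in auto)
  show "(\<lambda>x. S x \<oplus> T x) \<in> carrier \<A>"
    by (rule adj_carrierI[OF add_pair[OF p] _ add_bound[OF assms]]) (use n in auto)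
  show "(\<lambda>x. c \<odot> T x) \<in> carrier \<A>"
    by (rule adj_carrierI[OF smult_pair[OF p(2)] _ smult_bound[OF assms(2)]]) (use n in auto)
  show "(\<lambda>x. \<zero>) \<in> carrier \<A>"
    by (rule adj_carrierI[OF zero_pair, of 0]) auto
qed

lemma op_closed [simp]: "T \<in> carrier \<A> \<Longrightarrow> T x \<in> X"
  using adj_carrierD(1,2)[of T x] by (cases "x \<in> X") auto

lemma star_algebra_adj: "star_algebra \<A>"
proof -
  have ag: "abelian_group \<A>"
  proof (rule abelian_groupI)
    fix T assume T: "T \<in> carrier \<A>"
    show "\<exists>S\<in>carrier \<A>. S \<oplus>\<^bsub>\<A>\<^esub> T = \<zero>\<^bsub>\<A>\<^esub>"
    proof (rule bexI[of _ "\<lambda>x. (-1) \<odot> T x"])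
      show "(\<lambda>x. - 1 \<odot> T x) \<oplus>\<^bsub>\<A>\<^esub> T = \<zero>\<^bsub>\<A>\<^esub>"
        unfolding adj_alg_simps using sm_ldist[of _ "-1" 1, symmetric] T by (intro ext) simp
    qed (rule adj_alg_closed(3)[OF T T])
  next
    show "\<zero>\<^bsub>\<A>\<^esub> \<in> carrier \<A>"
      unfolding adj_alg_simps(5) by (rule adj_carrierI[OF zero_pair, of 0]) auto
  qed (auto simp: adj_alg_simps(2-5) adj_alg_closed M.a_ac)
  have m: "Module.module complex_ring \<A>"
    by (rule Module.moduleI[OF cring_complex_ring ag])
       (auto simp: adj_alg_simps(2-5) adj_alg_closed sm_ldist sm_rdist sm_assoc)
  show ?thesis
  proof (rule star_algebra.intro[OF m], rule star_algebra_axioms.intro)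
    fix S T U c assume S: "S \<in> carrier \<A>"
    note pS = adj_pair_star[OF S]
    show "star \<A> S \<in> carrier \<A>" by (rule adj_closed[OF S])
    show "star \<A> (star \<A> S) = S" using star_eq[OF adj_pair_sym[OF pS]] .
    show "star \<A> (c \<odot>\<^bsub>\<A>\<^esub> S) = cnj c \<odot>\<^bsub>\<A>\<^esub> star \<A> S"
      unfolding adj_alg_simps by (rule star_eq[OF smult_pair[OF pS]])
    assume T: "T \<in> carrier \<A>"
    note pT = adj_pair_star[OF T]
    show "S \<otimes>\<^bsub>\<A>\<^esub> T \<in> carrier \<A>" using adj_alg_closed(1)[OF S T] by (simp add: adj_alg_simps(2))
    show "c \<odot>\<^bsub>\<A>\<^esub> S \<otimes>\<^bsub>\<A>\<^esub> T = c \<odot>\<^bsub>\<A>\<^esub> (S \<otimes>\<^bsub>\<A>\<^esub> T)" by (simp add: adj_alg_simps)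
    show "S \<otimes>\<^bsub>\<A>\<^esub> (c \<odot>\<^bsub>\<A>\<^esub> T) = c \<odot>\<^bsub>\<A>\<^esub> (S \<otimes>\<^bsub>\<A>\<^esub> T)"
      using pair_smult[OF pS] T by (simp add: adj_alg_simps(2-5))
    show "star \<A> (S \<oplus>\<^bsub>\<A>\<^esub> T) = star \<A> S \<oplus>\<^bsub>\<A>\<^esub> star \<A> T"
      unfolding adj_alg_simps by (rule star_eq[OF add_pair[OF pS pT]])
    show "star \<A> (S \<otimes>\<^bsub>\<A>\<^esub> T) = star \<A> T \<otimes>\<^bsub>\<A>\<^esub> star \<A> S"
      unfolding adj_alg_simps by (rule star_eq[OF mult_pair[OF pS pT]])
    assume U: "U \<in> carrier \<A>"
    show "S \<otimes>\<^bsub>\<A>\<^esub> T \<otimes>\<^bsub>\<A>\<^esub> U = S \<otimes>\<^bsub>\<A>\<^esub> (T \<otimes>\<^bsub>\<A>\<^esub> U)" by (simp add: adj_alg_simps)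
    show "S \<otimes>\<^bsub>\<A>\<^esub> (T \<oplus>\<^bsub>\<A>\<^esub> U) = S \<otimes>\<^bsub>\<A>\<^esub> T \<oplus>\<^bsub>\<A>\<^esub> S \<otimes>\<^bsub>\<A>\<^esub> U"
      using pair_add[OF pS] T U by (simp add: adj_alg_simps(2-5))
    show "(S \<oplus>\<^bsub>\<A>\<^esub> T) \<otimes>\<^bsub>\<A>\<^esub> U = S \<otimes>\<^bsub>\<A>\<^esub> U \<oplus>\<^bsub>\<A>\<^esub> T \<otimes>\<^bsub>\<A>\<^esub> U" by (simp add: adj_alg_simps)
  qed
qed

lemma pre_cstar_adj: "pre_cstar_algebra \<A>"
proof (rule pre_cstar_algebra.intro[OF star_algebra_adj], rule pre_cstar_algebra_axioms.intro)
  fix S T c assume S: "S \<in> carrier \<A>"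
  note cS = adj_carrierD[OF S]
  show n0: "0 \<le> nrm \<A> S" by (rule op_nrm_nonneg[OF cS(3)])
  \<comment> \<open>Only one inequality is direct; for nonzero \<open>c\<close> the other is the
    same bound for \<open>inverse c\<close> applied to \<open>c \<odot> S\<close>.\<close>
  have smle: "nrm \<A> (\<lambda>x. c \<odot> S x) \<le> cmod c * nrm \<A> S" if "S \<in> carrier \<A>" for c S
    using that op_nrm_nonneg[OF adj_carrierD(3)[OF that]] smult_bound[OF that] by (intro op_nrm_le) auto
  show "nrm \<A> (c \<odot>\<^bsub>\<A>\<^esub> S) = cmod c * nrm \<A> S"
  proof (cases "c = 0")
    case True
    then show ?thesis using smle[OF S, of 0] op_nrm_nonneg[OF adj_carrierD(3)[OF adj_alg_closed(3)[OF S S]], of 0]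
      by (simp add: adj_alg_simps(4))
  next
    case False
    have "S = (\<lambda>x. inverse c \<odot> (c \<odot> S x))" using False S by (simp add: sm_assoc[symmetric])
    then have "nrm \<A> S \<le> cmod (inverse c) * nrm \<A> (\<lambda>x. c \<odot> S x)"
      using smle[OF adj_alg_closed(3)[OF S S], of "inverse c" c] by simp
    then have "cmod c * nrm \<A> S \<le> nrm \<A> (\<lambda>x. c \<odot> S x)"
      using False by (simp add: norm_divide field_simps)
    then show ?thesis using smle[OF S, of c] by (simp add: adj_alg_simps(4))
  qed
  show "nrm \<A> (star \<A> S \<otimes>\<^bsub>\<A>\<^esub> S) = (nrm \<A> S)\<^sup>2"
  proof (rule antisym)
    let ?T = "star \<A> S"
    note pS = adj_pair_star[OF S]
    have "nrm \<A> ?T \<le> nrm \<A> S" by (rule op_nrm_le[OF n0 adj_bound[OF pS cS(3)]])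
    then have "nrm \<A> ?T * nrm \<A> S \<le> nrm \<A> S * nrm \<A> S" using n0 by (rule mult_right_mono)
    moreover have "nrm \<A> (\<lambda>x. ?T (S x)) \<le> nrm \<A> ?T * nrm \<A> S"
      using op_nrm_nonneg[OF adj_carrierD(3)[OF adj_closed[OF S]]] n0
      by (intro op_nrm_le mult_bound adj_closed S) auto
    ultimately show "nrm \<A> (star \<A> S \<otimes>\<^bsub>\<A>\<^esub> S) \<le> (nrm \<A> S)\<^sup>2" by (simp add: adj_alg_simps(2) power2_eq_square)
    let ?K = "nrm \<A> (\<lambda>x. ?T (S x))"
    note c2 = adj_carrierD[OF adj_alg_closed(1)[OF adj_closed[OF S] S]]
    have K: "0 \<le> ?K" by (rule op_nrm_nonneg[OF c2(3)])
    \<comment> \<open>The inner product of \<open>S x\<close> with itself equals that of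
      \<open>x\<close> with \<open>?T (S x)\<close>, so its norm is at most \<open>?K\<close> times
      the square of \<open>nrm B x\<close>.\<close>
    have "nrm \<A> S \<le> sqrt ?K"
    proof (rule op_nrm_le)
      fix x assume x: "x \<in> X"
      have "(nrm B (S x))\<^sup>2 = nrm B (star B (S x) \<otimes> S x)" using S by (simp add: cstar_identity)
      also have "star B (S x) \<otimes> S x = star B x \<otimes> ?T (S x)" using adj_pairD(5)[OF pS x] S by simp
      also have "nrm B \<dots> \<le> nrm B x * nrm B (?T (S x))"
        using nrm_mult[of "star B x" "?T (S x)"] x adj_closed[OF S] by simp
      also have "\<dots> \<le> nrm B x * (?K * nrm B x)" using x by (intro mult_left_mono op_bound[OF c2(3)] nrm_nonneg) auto
      also have "\<dots> = (sqrt ?K * nrm B x)\<^sup>2" using K by (simp add: power2_eq_square algebra_simps)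
      finally show "nrm B (S x) \<le> sqrt ?K * nrm B x"
        by (rule power2_le_imp_le) (use K x in \<open>auto intro!: mult_nonneg_nonneg nrm_nonneg\<close>)
    qed (use K in auto)
    then have "(nrm \<A> S)\<^sup>2 \<le> ?K" using n0 K by (metis real_sqrt_le_iff real_sqrt_abs abs_of_nonneg)
    then show "(nrm \<A> S)\<^sup>2 \<le> nrm \<A> (star \<A> S \<otimes>\<^bsub>\<A>\<^esub> S)" by (simp add: adj_alg_simps(2))
  qed
  assume T: "T \<in> carrier \<A>"
  have n1: "0 \<le> nrm \<A> T" by (rule op_nrm_nonneg[OF adj_carrierD(3)[OF T]])
  show "nrm \<A> (S \<oplus>\<^bsub>\<A>\<^esub> T) \<le> nrm \<A> S + nrm \<A> T"
    unfolding adj_alg_simps(3) using n0 n1 add_bound[OF S T] by (intro op_nrm_le) auto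
  show "nrm \<A> (S \<otimes>\<^bsub>\<A>\<^esub> T) \<le> nrm \<A> S * nrm \<A> T"
    unfolding adj_alg_simps(2) using n0 n1 mult_bound[OF S T] by (intro op_nrm_le) auto
qed

lemma mult_eqI:
  assumes "S \<in> carrier \<A>" "T \<in> carrier \<A>" "U \<in> carrier \<A>" "\<And>x. x \<in> X \<Longrightarrow> S (T x) = U x"
  shows "S \<otimes>\<^bsub>\<A>\<^esub> T = U"
proof -
  interpret D: star_algebra \<A> by (rule star_algebra_adj)
  show ?thesis by (rule op_ext[OF D.mult_closed]) (use assms in \<open>simp_all add: adj_alg_simps(2)\<close>)
qed

lemma mult_zeroI:
  assumes "S \<in> carrier \<A>" "T \<in> carrier \<A>" "\<And>x. x \<in> X \<Longrightarrow> S (T x) = \<zero>"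
  shows "S \<otimes>\<^bsub>\<A>\<^esub> T = \<zero>\<^bsub>\<A>\<^esub>"
proof -
  interpret D: star_algebra \<A> by (rule star_algebra_adj)
  show ?thesis by (rule mult_eqI[OF assms(1,2) D.M.zero_closed]) (use assms(3) in \<open>simp add: adj_alg_simps(5)\<close>)
qed

lemma adj_finsum_apply:
  assumes "\<And>i. i \<in> I \<Longrightarrow> f i \<in> carrier \<A>"
  shows "finsum \<A> f I x = finsum B (\<lambda>i. f i x) I"
proof -
  interpret D: star_algebra \<A> by (rule star_algebra_adj)
  show ?thesis
  proof (cases "finite I")
    case True
    then show ?thesis using assms
    proof (induction I)
      case (insert i I)
      have "finsum \<A> f (insert i I) = f i \<oplus>\<^bsub>\<A>\<^esub> finsum \<A> f I"
        using insert by (intro D.M.finsum_insert) auto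
      moreover have "finsum B (\<lambda>i. f i x) (insert i I) = f i x \<oplus> finsum B (\<lambda>i. f i x) I"
        using insert by (intro M.finsum_insert) auto
      ultimately show ?case using insert by (simp add: adj_alg_simps)
    qed (simp add: adj_alg_simps)
  qed (simp add: adj_alg_simps)
qed

lemma adj_minus_apply: "S \<in> carrier \<A> \<Longrightarrow> T \<in> carrier \<A> \<Longrightarrow> (S \<ominus>\<^bsub>\<A>\<^esub> T) x = S x \<ominus> T x"
proof -
  interpret D: star_algebra \<A> by (rule star_algebra_adj)
  show "S \<in> carrier \<A> \<Longrightarrow> T \<in> carrier \<A> \<Longrightarrow> (S \<ominus>\<^bsub>\<A>\<^esub> T) x = S x \<ominus> T x"
    by (simp add: D.minus_sm minus_sm) (simp add: adj_alg_simps)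
qed

text \<open>Associativity moves \<open>b\<close> across the inner product, and nondegeneracy turns
  this into a formula for the adjoint.\<close>

lemma star_left_mult:
  assumes T: "T \<in> carrier \<A>" and b: "b \<in> carrier B" "\<And>x. x \<in> X \<Longrightarrow> T x = b \<otimes> x"
    "\<And>x. x \<in> X \<Longrightarrow> star B b \<otimes> x \<in> X" and x: "x \<in> X"
  shows "star \<A> T x = star B b \<otimes> x"
proof -
  note a = adj_pairD[OF adj_pair_star[OF T]]
  show ?thesis
  proof (rule nondegenerate)
    fix y assume y: "y \<in> X"
    have "star B y \<otimes> star \<A> T x = star B (b \<otimes> y) \<otimes> x" using a(5)[OF y x] b(2)[OF y] by simp
    also have "\<dots> = star B y \<otimes> (star B b \<otimes> x)" using b(1) x y by (simp add: star_mult mult_assoc)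
    finally show "star B y \<otimes> star \<A> T x = star B y \<otimes> (star B b \<otimes> x)" .
  qed (use a b x in auto)
qed

end

section \<open>Operators given by partial isometries between orthogonal projections\<close>

locale orthogonal_projections = cstar_algebra B for B (structure) +
  fixes V :: "'i set" and q :: "'i \<Rightarrow> 'a"
  assumes q_closed [simp]: "w \<in> V \<Longrightarrow> q w \<in> carrier B"
    and q_star [simp]: "w \<in> V \<Longrightarrow> star B (q w) = q w"
    and q_idem [simp]: "w \<in> V \<Longrightarrow> q w \<otimes> q w = q w"
    and q_orth: "\<lbrakk>w \<in> V; w' \<in> V; w \<noteq> w'\<rbrakk> \<Longrightarrow> q w \<otimes> q w' = \<zero>"
begin

text \<open>The algebraic direct sum of the right ideals \<open>q w \<otimes> B\<close>. It is
  deliberately not closed: with finitely many components per element, sums of operators indexed by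
  \<open>V\<close> are finite at every point.\<close>

definition fin_module :: "'a set" where
  "fin_module = {x \<in> carrier B. finite {w \<in> V. q w \<otimes> x \<noteq> \<zero>} \<and> fsum (\<lambda>w. q w \<otimes> x) V = x}"

abbreviation "X \<equiv> fin_module"

lemma fin_moduleD:
  assumes "x \<in> X"
  shows "x \<in> carrier B" "finite {w \<in> V. q w \<otimes> x \<noteq> \<zero>}" "fsum (\<lambda>w. q w \<otimes> x) V = x"
  using assms by (auto simp: fin_module_def)

lemma q_q: "\<lbrakk>w \<in> V; w' \<in> V; x \<in> carrier B\<rbrakk> \<Longrightarrow> q w \<otimes> (q w' \<otimes> x) = (if w = w' then q w \<otimes> x else \<zero>)"
  using mult_assoc[of "q w" "q w'" x] by (auto simp: q_orth)

sublocale cstar_subspace B X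
proof unfold_locales
  show "X \<subseteq> carrier B" by (auto simp: fin_module_def)
  show "\<zero> \<in> X" by (simp add: fin_module_def fsum_zero cong: conj_cong)
next
  fix x y assume x: "x \<in> X" and y: "y \<in> X"
  note d = fin_moduleD[OF x] fin_moduleD[OF y]
  have e: "q w \<otimes> (x \<oplus> y) = q w \<otimes> x \<oplus> q w \<otimes> y" if "w \<in> V" for w using that d by (simp add: distrib_left)
  have "finite {w \<in> V. q w \<otimes> (x \<oplus> y) \<noteq> \<zero>}"
    by (rule finite_subset[OF _ finite_UnI[OF d(2,5)]]) (auto simp: e)
  moreover have "fsum (\<lambda>w. q w \<otimes> (x \<oplus> y)) V = x \<oplus> y"
  proof -
    have "fsum (\<lambda>w. q w \<otimes> (x \<oplus> y)) V = fsum (\<lambda>w. q w \<otimes> x \<oplus> q w \<otimes> y) V"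
      using d by (intro fsum_cong) (auto simp: e)
    also have "\<dots> = x \<oplus> y" using d by (subst fsum_add[symmetric]) auto
    finally show ?thesis .
  qed
  ultimately show "x \<oplus> y \<in> X" using d by (simp add: fin_module_def)
next
  fix x c assume x: "x \<in> X"
  note d = fin_moduleD[OF x]
  have e: "q w \<otimes> (c \<odot> x) = c \<odot> (q w \<otimes> x)" if "w \<in> V" for w using that d by (simp add: smult_mult_right)
  have "finite {w \<in> V. q w \<otimes> (c \<odot> x) \<noteq> \<zero>}"
    by (rule finite_subset[OF _ d(2)]) (auto simp: e)
  moreover have "fsum (\<lambda>w. q w \<otimes> (c \<odot> x)) V = c \<odot> x"
  proof -
    have "fsum (\<lambda>w. q w \<otimes> (c \<odot> x)) V = fsum (\<lambda>w. c \<odot> (q w \<otimes> x)) V"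
      using d by (intro fsum_cong) (auto simp: e)
    also have "\<dots> = c \<odot> x" using d by (subst smult_fsum[symmetric]) auto
    finally show ?thesis .
  qed
  ultimately show "c \<odot> x \<in> X" using d by (simp add: fin_module_def)
qed

text \<open>An element is the sum of its components \<open>q w \<otimes> x\<close>. Identities
  between operators are checked one component at a time through this rule.\<close>

lemma fin_module_eqI:
  assumes "x \<in> X" "y \<in> X" "\<And>w. w \<in> V \<Longrightarrow> q w \<otimes> x = q w \<otimes> y" shows "x = y"
proof -
  have "fsum (\<lambda>w. q w \<otimes> x) V = fsum (\<lambda>w. q w \<otimes> y) V"
    by (rule fsum_cong) (use assms fin_moduleD(1) in auto)
  then show ?thesis by (simp only: fin_moduleD(3)[OF assms(1)] fin_moduleD(3)[OF assms(2)])
qed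

lemma fin_moduleI:
  assumes "x \<in> carrier B" "w \<in> V" "q w \<otimes> x = x" shows "x \<in> X"
proof -
  have z: "q w' \<otimes> x = \<zero>" if "w' \<in> V" "w' \<noteq> w" for w'
    using q_q[OF that(1) assms(2,1)] that assms(3) by simp
  then have "{w \<in> V. q w \<otimes> x \<noteq> \<zero>} \<subseteq> {w}" by auto
  then have "finite {w \<in> V. q w \<otimes> x \<noteq> \<zero>}" by (rule finite_subset) simp
  moreover have "fsum (\<lambda>w. q w \<otimes> x) V = q w \<otimes> x"
    by (rule fsum_single) (use assms(1,2) z in auto)
  ultimately show ?thesis using assms(1,3) unfolding fin_module_def by simp
qed

lemma finsum_X: "(\<And>i. i \<in> I \<Longrightarrow> f i \<in> X) \<Longrightarrow> finsum B f I \<in> X"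
proof (induction I rule: infinite_finite_induct)
  case (insert i I)
  have "finsum B f (insert i I) = f i \<oplus> finsum B f I"
    using insert by (intro M.finsum_insert) auto
  then show ?case using insert by simp
qed simp_all

text \<open>The possibly infinite sum of the \<open>u w\<close>, taken pointwise on
  \<open>X\<close>. The family is left arbitrary because the same notation serves for the adjoints
  \<open>star B (u w)\<close>.\<close>

definition strict_sum :: "'i set \<Rightarrow> ('i \<Rightarrow> 'a) \<Rightarrow> 'a \<Rightarrow> 'a" where
  "strict_sum D u x = (if x \<in> X then fsum (\<lambda>w. u w \<otimes> x) D else \<zero>)"

text \<open>Each \<open>u w\<close> is a partial isometry with source projection exactly
  \<open>q w\<close> and range below \<open>q (k w)\<close>, not necessarily equal to it.
  Injectivity of \<open>k\<close> makes the ranges orthogonal, so the sum is again a partial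
  isometry.\<close>

definition column_isometry :: "'i set \<Rightarrow> ('i \<Rightarrow> 'i) \<Rightarrow> ('i \<Rightarrow> 'a) \<Rightarrow> bool" where
  "column_isometry D k u \<longleftrightarrow> D \<subseteq> V \<and> k ` D \<subseteq> V \<and> inj_on k D \<and>
     (\<forall>w\<in>D. u w \<in> carrier B \<and> star B (u w) \<otimes> u w = q w \<and> u w \<otimes> q w = u w \<and> q (k w) \<otimes> u w = u w)"

lemma column_isometry_id: "D \<subseteq> V \<Longrightarrow> column_isometry D (\<lambda>w. w) q"
  by (auto simp: column_isometry_def)

context
  fixes D k u assumes iso: "column_isometry D k u"
begin

lemma isoD:
  "w \<in> D \<Longrightarrow> w \<in> V" "w \<in> D \<Longrightarrow> k w \<in> V" "\<lbrakk>w \<in> D; w' \<in> D\<rbrakk> \<Longrightarrow> k w = k w' \<longleftrightarrow> w = w'"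
  "w \<in> D \<Longrightarrow> u w \<in> carrier B" "w \<in> D \<Longrightarrow> star B (u w) \<otimes> u w = q w"
  "w \<in> D \<Longrightarrow> u w \<otimes> q w = u w" "w \<in> D \<Longrightarrow> q (k w) \<otimes> u w = u w"
  using iso by (auto simp: column_isometry_def inj_on_def)

lemma column_closed [simp]: "w \<in> D \<Longrightarrow> u w \<in> carrier B" "w \<in> D \<Longrightarrow> w \<in> V" "w \<in> D \<Longrightarrow> k w \<in> V"
  by (auto simp: isoD)

lemma star_u_q: "w \<in> D \<Longrightarrow> star B (u w) \<otimes> q (k w) = star B (u w)"
  using star_mult[of "q (k w)" "u w"] isoD(7) by simp

lemma q_star_u: "w \<in> D \<Longrightarrow> q w \<otimes> star B (u w) = star B (u w)"
  using star_mult[of "u w" "q w"] isoD(6) by simp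

lemma u_x: "\<lbrakk>w \<in> D; x \<in> carrier B\<rbrakk> \<Longrightarrow> u w \<otimes> x = u w \<otimes> (q w \<otimes> x)"
  using mult_assoc[of "u w" "q w" x] isoD(6) by simp

lemma star_u_x: "\<lbrakk>w \<in> D; x \<in> carrier B\<rbrakk> \<Longrightarrow> star B (u w) \<otimes> x = star B (u w) \<otimes> (q (k w) \<otimes> x)"
  using mult_assoc[of "star B (u w)" "q (k w)" x] star_u_q by simp

lemma q_u_x:
  assumes "w \<in> D" "w' \<in> V" "x \<in> carrier B"
  shows "q w' \<otimes> (u w \<otimes> x) = (if w' = k w then u w \<otimes> x else \<zero>)"
proof -
  have "u w \<otimes> x = q (k w) \<otimes> (u w \<otimes> x)" using assms isoD(7) mult_assoc[of "q (k w)" "u w" x] by simp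
  then show ?thesis using q_q[of w' "k w" "u w \<otimes> x"] assms by auto
qed

lemma q_star_u_x:
  assumes "w \<in> D" "w' \<in> V" "x \<in> carrier B"
  shows "q w' \<otimes> (star B (u w) \<otimes> x) = (if w' = w then star B (u w) \<otimes> x else \<zero>)"
proof -
  have "star B (u w) \<otimes> x = q w \<otimes> (star B (u w) \<otimes> x)"
    using assms q_star_u mult_assoc[of "q w" "star B (u w)" x] by simp
  then show ?thesis using q_q[of w' w "star B (u w) \<otimes> x"] assms by auto
qed

lemma u_x_X: "w \<in> D \<Longrightarrow> x \<in> carrier B \<Longrightarrow> u w \<otimes> x \<in> X"
  by (rule fin_moduleI[of _ "k w"]) (auto simp: q_u_x)

lemma star_u_x_X: "w \<in> D \<Longrightarrow> x \<in> carrier B \<Longrightarrow> star B (u w) \<otimes> x \<in> X"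
  by (rule fin_moduleI[of _ w]) (auto simp: q_star_u_x)

lemma fin_u: assumes "x \<in> X" shows "finite {w \<in> D. u w \<otimes> x \<noteq> \<zero>}"
proof (rule finite_subset[OF _ fin_moduleD(2)[OF assms]])
  have "q w \<otimes> x \<noteq> \<zero>" if "w \<in> D" "u w \<otimes> x \<noteq> \<zero>" for w
    using that assms u_x[of w x] by auto
  then show "{w \<in> D. u w \<otimes> x \<noteq> \<zero>} \<subseteq> {w \<in> V. q w \<otimes> x \<noteq> \<zero>}" by auto
qed

text \<open>The term at \<open>w\<close> sees only the component of \<open>x\<close> at
  \<open>k w\<close>, so injectivity of \<open>k\<close> transports the finiteness of the set of
  components back to \<open>D\<close>.\<close>

lemma fin_star_u: assumes "x \<in> X" shows "finite {w \<in> D. star B (u w) \<otimes> x \<noteq> \<zero>}"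
proof (rule finite_imageD[of k])
  have "q (k w) \<otimes> x \<noteq> \<zero>" if "w \<in> D" "star B (u w) \<otimes> x \<noteq> \<zero>" for w
    using that assms star_u_x[of w x] by auto
  then show "finite (k ` {w \<in> D. star B (u w) \<otimes> x \<noteq> \<zero>})"
    by (intro finite_subset[OF _ fin_moduleD(2)[OF assms]]) auto
  show "inj_on k {w \<in> D. star B (u w) \<otimes> x \<noteq> \<zero>}" using isoD(3) by (auto simp: inj_on_def)
qed

lemma strict_sum_X: "strict_sum D u x \<in> X" "strict_sum D (\<lambda>w. star B (u w)) x \<in> X"
  unfolding strict_sum_def fsum_def by (auto intro!: finsum_X u_x_X star_u_x_X)

lemma mult_strict_sum:
  assumes "m \<in> carrier B" "x \<in> X"
  shows "m \<otimes> strict_sum D u x = fsum (\<lambda>w. m \<otimes> (u w \<otimes> x)) D"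
    "m \<otimes> strict_sum D (\<lambda>w. star B (u w)) x = fsum (\<lambda>w. m \<otimes> (star B (u w) \<otimes> x)) D"
  unfolding strict_sum_def using assms fin_u fin_star_u by (auto simp: mult_fsum)

text \<open>Orthogonality of the \<open>q w\<close>, together with injectivity of \<open>k\<close>,
  leaves at most one term of the sum under a given projection.\<close>

lemma q_strict_sum:
  assumes "x \<in> X"
  shows "w \<in> D \<Longrightarrow> q (k w) \<otimes> strict_sum D u x = u w \<otimes> x"
    "w' \<in> V \<Longrightarrow> w' \<notin> k ` D \<Longrightarrow> q w' \<otimes> strict_sum D u x = \<zero>"
    "w \<in> D \<Longrightarrow> q w \<otimes> strict_sum D (\<lambda>w. star B (u w)) x = star B (u w) \<otimes> x"
    "w' \<in> V \<Longrightarrow> w' \<notin> D \<Longrightarrow> q w' \<otimes> strict_sum D (\<lambda>w. star B (u w)) x = \<zero>"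
proof -
  show "q (k w) \<otimes> strict_sum D u x = u w \<otimes> x" if "w \<in> D"
    using that assms by (subst mult_strict_sum, simp_all) (subst fsum_single[of w], auto simp: q_u_x isoD(3))
  show "q w' \<otimes> strict_sum D u x = \<zero>" if "w' \<in> V" "w' \<notin> k ` D"
    using that assms by (subst mult_strict_sum) (auto simp: q_u_x intro!: fsum_zero)
  show "q w \<otimes> strict_sum D (\<lambda>w. star B (u w)) x = star B (u w) \<otimes> x" if "w \<in> D"
    using that assms by (subst mult_strict_sum, simp_all) (subst fsum_single[of w], auto simp: q_star_u_x)
  show "q w' \<otimes> strict_sum D (\<lambda>w. star B (u w)) x = \<zero>" if "w' \<in> V" "w' \<notin> D"
    using that assms by (subst mult_strict_sum) (auto simp: q_star_u_x intro!: fsum_zero)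
qed

lemma star_u_strict_sum: "\<lbrakk>w \<in> D; x \<in> X\<rbrakk> \<Longrightarrow> star B (u w) \<otimes> strict_sum D u x = q w \<otimes> x"
  using star_u_x[of w "strict_sum D u x"] strict_sum_X(1)[of x] q_strict_sum(1)[of x w] isoD(5)[of w]
    mult_assoc[of "star B (u w)" "u w" x] by simp

lemma u_star_strict_sum: "\<lbrakk>w \<in> D; x \<in> X\<rbrakk> \<Longrightarrow> u w \<otimes> strict_sum D (\<lambda>w. star B (u w)) x = u w \<otimes> (star B (u w) \<otimes> x)"
  using u_x[of w "strict_sum D (\<lambda>w. star B (u w)) x"] strict_sum_X(2)[of x] q_strict_sum(3)[of x w] by simp

lemma strict_sum_pair: "adj_pair B X (strict_sum D u) (strict_sum D (\<lambda>w. star B (u w)))"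
  unfolding adj_pair_def
proof (intro conjI ballI)
  fix x y assume x: "x \<in> X" and y: "y \<in> X"
  have "star B (strict_sum D u x) \<otimes> y = fsum (\<lambda>w. star B (u w \<otimes> x)) D \<otimes> y"
    using x fin_u[OF x] by (simp add: strict_sum_def star_fsum)
  also have "\<dots> = fsum (\<lambda>w. star B (u w \<otimes> x) \<otimes> y) D"
  proof (rule fsum_mult)
    have "{w \<in> D. star B (u w \<otimes> x) \<noteq> \<zero>} \<subseteq> {w \<in> D. u w \<otimes> x \<noteq> \<zero>}" by auto
    then show "finite {w \<in> D. star B (u w \<otimes> x) \<noteq> \<zero>}" using fin_u[OF x] finite_subset by blast
  qed (use x y in auto)
  also have "\<dots> = fsum (\<lambda>w. star B x \<otimes> (star B (u w) \<otimes> y)) D"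
    using x y by (intro fsum_cong) (auto simp: star_mult mult_assoc)
  also have "\<dots> = star B x \<otimes> strict_sum D (\<lambda>w. star B (u w)) y" using x y by (subst mult_strict_sum) auto
  finally show "star B (strict_sum D u x) \<otimes> y = star B x \<otimes> strict_sum D (\<lambda>w. star B (u w)) y" .
next
  show "strict_sum D u ` X \<subseteq> X" "strict_sum D (\<lambda>w. star B (u w)) ` X \<subseteq> X" using strict_sum_X by blast+
qed (simp add: strict_sum_def)

text \<open>Under \<open>star B (u w)\<close> only the component of the inner sum at
  \<open>k w\<close> survives, which is \<open>u w \<otimes> x\<close>; the product of the two
  partial isometries is the source projection \<open>q w\<close>.\<close>

lemma strict_sum_isometry: "x \<in> X \<Longrightarrow> strict_sum D (\<lambda>w. star B (u w)) (strict_sum D u x) = strict_sum D q x"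
  unfolding strict_sum_def[of D "\<lambda>w. star B (u w)"] strict_sum_def[of D q]
  using strict_sum_X(1)[of x] star_u_strict_sum[of _ x] by (auto intro!: fsum_cong)

end

lemma strict_sum_strict_sum_q:
  assumes iso: "column_isometry D k u" and x: "x \<in> X"
  shows "strict_sum D u (strict_sum D q x) = strict_sum D u x"
proof -
  have D: "D \<subseteq> V" using iso by (simp add: column_isometry_def)
  note id = column_isometry_id[OF D]
  have y: "strict_sum D q x \<in> X" by (rule strict_sum_X(1)[OF id])
  have "u w \<otimes> strict_sum D q x = u w \<otimes> x" if w: "w \<in> D" for w
    using u_x[OF iso w, of "strict_sum D q x"] u_x[OF iso w, of x] q_strict_sum(1)[OF id x w] x y by simp
  then show ?thesis unfolding strict_sum_def[of D u] using x y isoD(4)[OF iso] by (auto intro!: fsum_cong)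
qed

lemma strict_sum_star_q: "D \<subseteq> V \<Longrightarrow> strict_sum D (\<lambda>w. star B (q w)) = strict_sum D q"
  unfolding strict_sum_def by (intro ext) (auto intro!: fsum_cong dest: subsetD)

text \<open>The sum of the \<open>q w\<close> acts as a self-adjoint idempotent \<open>P\<close>. So
  the square of the norm of \<open>P x\<close> is the norm of the inner product of \<open>x\<close>
  with \<open>P x\<close>, and one factor cancels.\<close>

lemma strict_sum_q_bound:
  assumes D: "D \<subseteq> V" and x: "x \<in> X" shows "nrm B (strict_sum D q x) \<le> nrm B x"
proof (cases "nrm B (strict_sum D q x) = 0")
  case False
  note id = column_isometry_id[OF D]
  let ?y = "strict_sum D q x"
  have y: "?y \<in> X" by (rule strict_sum_X(1)[OF id])
  note s = strict_sum_star_q[OF D]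
  have "nrm B ?y * nrm B ?y = nrm B (star B ?y \<otimes> ?y)" using y by (simp add: cstar_identity power2_eq_square)
  also have "star B ?y \<otimes> ?y = star B x \<otimes> strict_sum D q ?y"
    using adj_pairD(5)[OF strict_sum_pair[OF id] x y] by (simp add: s)
  also have "strict_sum D q ?y = ?y" using strict_sum_isometry[OF id x] by (simp add: s)
  also have "nrm B (star B x \<otimes> ?y) \<le> nrm B x * nrm B ?y" using nrm_mult[of "star B x" ?y] x y by simp
  finally show ?thesis using False nrm_nonneg[of ?y] y by simp
qed (use nrm_nonneg x in simp)

text \<open>The operator composed with its adjoint is the projection onto the components in
  \<open>D\<close>, so the square of the norm of its value at \<open>x\<close> is bounded through
  \<open>strict_sum_q_bound\<close>.\<close>

lemma strict_sum_bound:
  assumes iso: "column_isometry D k u" and x: "x \<in> X" shows "nrm B (strict_sum D u x) \<le> nrm B x"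
proof -
  have D: "D \<subseteq> V" using iso by (simp add: column_isometry_def)
  let ?y = "strict_sum D u x"
  have y: "?y \<in> X" by (rule strict_sum_X(1)[OF iso])
  have z: "strict_sum D q x \<in> X" by (rule strict_sum_X(1)[OF column_isometry_id[OF D]])
  have "(nrm B ?y)\<^sup>2 = nrm B (star B x \<otimes> strict_sum D q x)"
    using cstar_identity[of ?y] y adj_pairD(5)[OF strict_sum_pair[OF iso] x y] strict_sum_isometry[OF iso x] by simp
  also have "\<dots> \<le> nrm B x * nrm B (strict_sum D q x)" using nrm_mult[of "star B x" "strict_sum D q x"] x z by simp
  also have "\<dots> \<le> nrm B x * nrm B x" using x by (intro mult_left_mono strict_sum_q_bound[OF D]) (auto intro: nrm_nonneg)
  finally have "(nrm B ?y)\<^sup>2 \<le> (nrm B x)\<^sup>2" by (simp only: power2_eq_square)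
  then show ?thesis by (rule power2_le_imp_le) (use x in \<open>auto intro: nrm_nonneg\<close>)
qed

lemma strict_sum_carrier: "column_isometry D k u \<Longrightarrow> strict_sum D u \<in> carrier \<A>"
  using adj_carrierI[OF strict_sum_pair, of D k u 1] strict_sum_bound by simp

lemma star_strict_sum: "column_isometry D k u \<Longrightarrow> star \<A> (strict_sum D u) = strict_sum D (\<lambda>w. star B (u w))"
  by (rule star_eq[OF strict_sum_pair])

end

section \<open>The paths in \<open>F1\<close> and \<open>F2\<close>\<close>

locale ideal_setup = wf_digraph E for E :: "('v, 'e) pre_digraph" +
  fixes H S :: "'v set"
  assumes her: "hereditary E H" and breaking: "S \<subseteq> breaking_vertices E H"
begin

definition F where "F = F1 E H S \<union> F2 E H S"
abbreviation "\<G> \<equiv> ideal_graph E H S"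

lemma hereditaryD: "e \<in> arcs E \<Longrightarrow> tail E e \<in> H \<Longrightarrow> head E e \<in> H"
  using her by (auto simp: hereditary_def)

lemma S_facts:
  assumes "v \<in> S"
  shows "v \<in> verts E" "v \<notin> H" "infinite (out_arcs E v)" "finite (exit_arcs E H v)"
  using assms breaking hereditaryD by (auto simp: breaking_vertices_def exit_arcs_def)

lemma HS_verts [simp]: "v \<in> H \<Longrightarrow> v \<in> verts E" "v \<in> S \<Longrightarrow> v \<in> verts E"
  using her S_facts by (auto simp: hereditary_def)

lemma pos_paths_Cons:
  "e # \<alpha> \<in> pos_paths E \<longleftrightarrow> e \<in> arcs E \<and> (\<alpha> = [] \<or> \<alpha> \<in> pos_paths E \<and> tail E (hd \<alpha>) = head E e)"
proof -
  have pp: "f # \<beta> \<in> pos_paths E \<longleftrightarrow> f \<in> arcs E \<and> (\<exists>v. awalk (head E f) \<beta> v)" for f \<beta>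
    unfolding pos_paths_def using awalk_Cons_iff by blast
  show ?thesis
  proof (cases \<alpha>)
    case Nil
    then show ?thesis unfolding pp using awalk_Nil_iff[of "head E e" "head E e"] by auto
  next
    case (Cons f \<beta>)
    then show ?thesis unfolding Cons pp using awalk_Cons_iff by auto
  qed
qed

lemma F_Nil [simp]: "[] \<notin> F"
  by (auto simp: F_def F1_def F2_def pos_paths_def)

lemma F_single: "[e] \<in> F \<longleftrightarrow> e \<in> arcs E \<and> (head E e \<in> H \<and> tail E e \<notin> H \<union> S \<or> head E e \<in> S)"
  by (auto simp: F_def F1_def F2_def pos_paths_Cons)

text \<open>Both conditions on a path concern its last edge only, so prefixing an edge respects
  them. This is what lets every edge of \<open>E\<close> act on the path vertices.\<close>

lemma F_Cons: "\<alpha> \<noteq> [] \<Longrightarrow> e # \<alpha> \<in> F \<longleftrightarrow> e \<in> arcs E \<and> \<alpha> \<in> F \<and> tail E (hd \<alpha>) = head E e"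
  by (auto simp: F_def F1_def F2_def pos_paths_Cons)

lemma F_induct [consumes 1, case_names single Cons]:
  assumes "\<alpha> \<in> F"
    and "\<And>e. [e] \<in> F \<Longrightarrow> e \<in> arcs E \<Longrightarrow> P [e]"
    and "\<And>e \<alpha>. e # \<alpha> \<in> F \<Longrightarrow> e \<in> arcs E \<Longrightarrow> \<alpha> \<in> F \<Longrightarrow> \<alpha> \<noteq> [] \<Longrightarrow> tail E (hd \<alpha>) = head E e \<Longrightarrow> P \<alpha> \<Longrightarrow> P (e # \<alpha>)"
  shows "P \<alpha>"
  using assms(1)
proof (induction \<alpha>)
  case Nil
  then show ?case using F_Nil by simp
next
  case (Cons e \<alpha>)
  show ?case
  proof (cases "\<alpha> = []")
    case True
    then show ?thesis using assms(2) Cons.prems F_single by simp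
  next
    case False
    then show ?thesis using assms(3) Cons F_Cons by simp
  qed
qed

lemma F_cases [consumes 1, case_names single Cons]:
  assumes "\<alpha> \<in> F"
  obtains e where "\<alpha> = [e]" "[e] \<in> F" "e \<in> arcs E"
    | e \<beta> where "\<alpha> = e # \<beta>" "e \<in> arcs E" "\<beta> \<in> F" "\<beta> \<noteq> []" "tail E (hd \<beta>) = head E e"
  using assms by (induction \<alpha> rule: F_induct) blast+

lemma F_not_Nil [simp]: "\<alpha> \<in> F \<Longrightarrow> \<alpha> \<noteq> []"
  using F_Nil by blast

lemma F_hd [simp]: "\<alpha> \<in> F \<Longrightarrow> hd \<alpha> \<in> arcs E"
  by (erule F_cases) auto

lemma F_tl: "\<alpha> \<in> F \<Longrightarrow> tl \<alpha> \<noteq> [] \<Longrightarrow> tl \<alpha> \<in> F"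
  by (erule F_cases) auto

lemma F_head_last: "\<alpha> \<in> F \<Longrightarrow> head E (last \<alpha>) \<in> H \<union> S"
  by (auto simp: F_def F1_def F2_def)

text \<open>Heredity would keep a path that starts in \<open>H\<close> inside \<open>H\<close>. Its
  last edge would then start in \<open>H\<close>, which excludes the first kind of path, and end in
  \<open>H\<close>, which is disjoint from \<open>S\<close> and excludes the second.\<close>

lemma F_tail: "\<alpha> \<in> F \<Longrightarrow> tail E (hd \<alpha>) \<notin> H"
proof (induction \<alpha> rule: F_induct)
  case (single e)
  then show ?case using hereditaryD[of e] S_facts(2) unfolding F_single by auto
next
  case (Cons e \<alpha>)
  then show ?case using hereditaryD[of e] by auto
qed

text \<open>Out of a vertex of \<open>S\<close> a path begins with one of the finitely many edges
  that the gap projection removes: a single edge from \<open>S\<close> can only end in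
  \<open>S\<close>, and a longer path continues from a vertex outside \<open>H\<close> by
  \<open>F_tail\<close>.\<close>

lemma F_tail_S: "\<alpha> \<in> F \<Longrightarrow> tail E (hd \<alpha>) \<in> S \<Longrightarrow> head E (hd \<alpha>) \<notin> H"
proof (induction \<alpha> rule: F_induct)
  case (single e)
  then show ?case using S_facts(2) unfolding F_single by auto
next
  case (Cons e \<alpha>)
  then show ?case using F_tail[of \<alpha>] by auto
qed

lemma ideal_graph_simps [simp]:
  "Inl v \<in> verts \<G> \<longleftrightarrow> v \<in> H \<union> S" "Inr \<alpha> \<in> verts \<G> \<longleftrightarrow> \<alpha> \<in> F"
  "Inl e \<in> arcs \<G> \<longleftrightarrow> e \<in> arcs E \<and> (tail E e \<in> H \<or> tail E e \<in> S \<and> head E e \<in> H)" "Inr \<alpha> \<in> arcs \<G> \<longleftrightarrow> \<alpha> \<in> F"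
  "tail \<G> (Inl e) = Inl (tail E e)" "tail \<G> (Inr \<alpha>) = Inr \<alpha>"
  "head \<G> (Inl e) = Inl (head E e)" "head \<G> (Inr \<alpha>) = Inl (head E (last \<alpha>))"
  by (auto simp: ideal_graph_def F_def)

lemma wf_ideal_graph: "wf_digraph \<G>"
proof
  fix a assume "a \<in> arcs \<G>"
  then show "tail \<G> a \<in> verts \<G>" "head \<G> a \<in> verts \<G>"
    using F_head_last hereditaryD by (cases a; auto)+
qed

lemma out_arcs_Inr: "\<alpha> \<in> F \<Longrightarrow> out_arcs \<G> (Inr \<alpha>) = {Inr \<alpha>}"
proof -
  assume "\<alpha> \<in> F"
  then have "a \<in> out_arcs \<G> (Inr \<alpha>) \<longleftrightarrow> a = Inr \<alpha>" for a by (cases a) auto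
  then show ?thesis by blast
qed

lemma out_arcs_H: "v \<in> H \<Longrightarrow> out_arcs \<G> (Inl v) = Inl ` out_arcs E v"
proof -
  assume "v \<in> H"
  then have "a \<in> out_arcs \<G> (Inl v) \<longleftrightarrow> a \<in> Inl ` out_arcs E v" for a by (cases a) auto
  then show ?thesis by blast
qed

text \<open>A breaking vertex emits infinitely many edges and only finitely many of them miss
  \<open>H\<close>; all the others survive in the ideal graph. Hence no summation relation has to be
  verified at the vertices of \<open>S\<close>.\<close>

lemma not_regular_S: "v \<in> S \<Longrightarrow> \<not> regular_vertex \<G> (Inl v)"
proof
  assume v: "v \<in> S" and "regular_vertex \<G> (Inl v)"
  then have "finite (Inl -` out_arcs \<G> (Inl v) :: 'e set)"
    by (auto simp: regular_vertex_def intro!: finite_vimageI)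
  then have "finite (Inl -` out_arcs \<G> (Inl v) \<union> exit_arcs E H v)" using S_facts(4)[OF v] by simp
  moreover have "out_arcs E v \<subseteq> Inl -` out_arcs \<G> (Inl v) \<union> exit_arcs E H v"
    using v by (auto simp: exit_arcs_def)
  ultimately show False using S_facts(3)[OF v] finite_subset by blast
qed

end

section \<open>The Cuntz-Krieger family of the ideal\<close>

text \<open>
  The vertex \<open>Inl v\<close> of the ideal graph is represented by \<open>p v\<close> or, for \<open>v \<in> S\<close>, by the gap projection;
  an edge \<open>Inr \<alpha>\<close> by \<open>s_\<alpha>\<close> cut down by the projection of its range, and the vertex \<open>Inr \<alpha>\<close> by the
  range projection of that partial isometry.
\<close>

definition corner_proj ::
  "('v, 'e) pre_digraph \<Rightarrow> 'v set \<Rightarrow> 'v set \<Rightarrow> 'a normed_star_alg \<Rightarrow> ('v \<Rightarrow> 'a) \<Rightarrow> ('e \<Rightarrow> 'a) \<Rightarrow> 'v \<Rightarrow> 'a" where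
  "corner_proj E H S A p s v = (if v \<in> S
     then p v \<ominus>\<^bsub>A\<^esub> finsum A (\<lambda>e. s e \<otimes>\<^bsub>A\<^esub> star A (s e)) (exit_arcs E H v) else p v)"

definition path_isometry ::
  "('v, 'e) pre_digraph \<Rightarrow> 'v set \<Rightarrow> 'v set \<Rightarrow> 'a normed_star_alg \<Rightarrow> ('v \<Rightarrow> 'a) \<Rightarrow> ('e \<Rightarrow> 'a) \<Rightarrow> 'e list \<Rightarrow> 'a" where
  "path_isometry E H S A p s \<alpha> =
     foldr (\<lambda>e x. s e \<otimes>\<^bsub>A\<^esub> x) \<alpha> (corner_proj E H S A p s (head E (last \<alpha>)))"

definition ideal_p ::
  "('v, 'e) pre_digraph \<Rightarrow> 'v set \<Rightarrow> 'v set \<Rightarrow> 'a normed_star_alg \<Rightarrow> ('v \<Rightarrow> 'a) \<Rightarrow> ('e \<Rightarrow> 'a) \<Rightarrow> 'v + 'e list \<Rightarrow> 'a" where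
  "ideal_p E H S A p s = case_sum (corner_proj E H S A p s)
     (\<lambda>\<alpha>. path_isometry E H S A p s \<alpha> \<otimes>\<^bsub>A\<^esub> star A (path_isometry E H S A p s \<alpha>))"

definition ideal_s ::
  "('v, 'e) pre_digraph \<Rightarrow> 'v set \<Rightarrow> 'v set \<Rightarrow> 'a normed_star_alg \<Rightarrow> ('v \<Rightarrow> 'a) \<Rightarrow> ('e \<Rightarrow> 'a) \<Rightarrow> 'e + 'e list \<Rightarrow> 'a" where
  "ideal_s E H S A p s = case_sum s (path_isometry E H S A p s)"

lemma path_isometry_Cons:
  "\<alpha> \<noteq> [] \<Longrightarrow> path_isometry E H S A p s (e # \<alpha>) = s e \<otimes>\<^bsub>A\<^esub> path_isometry E H S A p s \<alpha>"
  "path_isometry E H S A p s [e] = s e \<otimes>\<^bsub>A\<^esub> corner_proj E H S A p s (head E e)"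
  by (simp_all add: path_isometry_def)

context star_algebra begin

lemma minus_closed [simp]: "\<lbrakk>x \<in> carrier A; y \<in> carrier A\<rbrakk> \<Longrightarrow> x \<ominus> y \<in> carrier A"
  by (rule M.minus_closed)

lemma mult_minus: "\<lbrakk>x \<in> carrier A; y \<in> carrier A; z \<in> carrier A\<rbrakk> \<Longrightarrow> x \<otimes> (y \<ominus> z) = x \<otimes> y \<ominus> x \<otimes> z"
  by (simp add: minus_sm distrib_left smult_mult_right)

lemma minus_mult: "\<lbrakk>x \<in> carrier A; y \<in> carrier A; z \<in> carrier A\<rbrakk> \<Longrightarrow> (x \<ominus> y) \<otimes> z = x \<otimes> z \<ominus> y \<otimes> z"
  by (simp add: minus_sm distrib_right smult_mult_left)

end

section \<open>Multiplication rules in a Cuntz-Krieger family\<close>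

locale ck_algebra = wf_digraph E + star_algebra A
  for E :: "('v, 'e) pre_digraph" and A :: "'a normed_star_alg" (structure) +
  fixes p s assumes ck: "ck_family E A p s"
begin

lemma p_closed [simp]: "v \<in> verts E \<Longrightarrow> p v \<in> carrier A"
  and p_star [simp]: "v \<in> verts E \<Longrightarrow> star A (p v) = p v"
  and p_idem [simp]: "v \<in> verts E \<Longrightarrow> p v \<otimes> p v = p v"
  and p_orth: "v \<in> verts E \<Longrightarrow> w \<in> verts E \<Longrightarrow> v \<noteq> w \<Longrightarrow> p v \<otimes> p w = \<zero>"
  and s_closed [simp]: "e \<in> arcs E \<Longrightarrow> s e \<in> carrier A"
  using ck by (auto simp: ck_family_def is_projection_def is_partial_isometry_def)

lemma ck_sum: "regular_vertex E v \<Longrightarrow> p v = finsum A (\<lambda>e. s e \<otimes> star A (s e)) (out_arcs E v)"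
  using ck by (simp add: ck_family_def)

lemma s_pi: "e \<in> arcs E \<Longrightarrow> s e \<otimes> (star A (s e) \<otimes> s e) = s e"
  using ck by (auto simp: ck_family_def is_partial_isometry_def mult_assoc)

text \<open>Orthogonality is given for the range projections. Writing each partial isometry as its
  range projection times itself carries it over to the product of \<open>star A (s e)\<close> and
  \<open>s f\<close>.\<close>

lemma s_s: assumes e: "e \<in> arcs E" and f: "f \<in> arcs E"
  shows "star A (s e) \<otimes> s f = (if e = f then p (head E e) else \<zero>)"
proof (cases "e = f")
  case True
  then show ?thesis using ck e by (simp add: ck_family_def)
next
  case False
  have se: "star A (s e) = star A (s e) \<otimes> (s e \<otimes> star A (s e))"
    using arg_cong[OF s_pi[OF e], of "star A"] e by (simp add: star_mult mult_assoc)
  have sf: "s f = (s f \<otimes> star A (s f)) \<otimes> s f" using s_pi[OF f] f by (simp add: mult_assoc)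
  have z: "(s e \<otimes> star A (s e)) \<otimes> (s f \<otimes> star A (s f)) = \<zero>"
    using ck e f False by (simp add: ck_family_def)
  have "star A (s e) \<otimes> s f = (star A (s e) \<otimes> (s e \<otimes> star A (s e))) \<otimes> ((s f \<otimes> star A (s f)) \<otimes> s f)"
    using se sf by simp
  also have "\<dots> = star A (s e) \<otimes> (((s e \<otimes> star A (s e)) \<otimes> (s f \<otimes> star A (s f))) \<otimes> s f)"
    using e f by (simp add: mult_assoc)
  finally show ?thesis using z e f False by simp
qed

lemma p_s: assumes v: "v \<in> verts E" and e: "e \<in> arcs E"
  shows "p v \<otimes> s e = (if v = tail E e then s e else \<zero>)"
proof -
  have "p (tail E e) \<otimes> (s e \<otimes> star A (s e)) = s e \<otimes> star A (s e)"
    using ck e by (simp add: ck_family_def proj_le_def)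
  then have "p (tail E e) \<otimes> (s e \<otimes> star A (s e)) \<otimes> s e = s e"
    using s_pi[OF e] e by (simp add: mult_assoc)
  then have "p (tail E e) \<otimes> s e = s e" using s_pi[OF e] e by (simp add: mult_assoc)
  moreover from this have "p v \<otimes> s e = (p v \<otimes> p (tail E e)) \<otimes> s e" using v e by (simp add: mult_assoc)
  ultimately show ?thesis using v e by (auto simp: p_orth)
qed

lemma s_p: assumes v: "v \<in> verts E" and e: "e \<in> arcs E"
  shows "s e \<otimes> p v = (if v = head E e then s e else \<zero>)"
proof -
  have h: "s e \<otimes> p (head E e) = s e" using s_pi[OF e] s_s[OF e e] by simp
  then have "s e \<otimes> p v = s e \<otimes> (p (head E e) \<otimes> p v)" using v e mult_assoc[of "s e" "p (head E e)" "p v"] by simp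
  then show ?thesis using v e h by (auto simp: p_orth)
qed

lemma s_s_x: "\<lbrakk>e \<in> arcs E; f \<in> arcs E; x \<in> carrier A\<rbrakk>
    \<Longrightarrow> star A (s e) \<otimes> (s f \<otimes> x) = (if e = f then p (head E e) \<otimes> x else \<zero>)"
  using mult_assoc[of "star A (s e)" "s f" x] s_s[of e f] by auto

lemma p_s_x: "\<lbrakk>v \<in> verts E; e \<in> arcs E; x \<in> carrier A\<rbrakk>
    \<Longrightarrow> p v \<otimes> (s e \<otimes> x) = (if v = tail E e then s e \<otimes> x else \<zero>)"
  using mult_assoc[of "p v" "s e" x] p_s[of v e] by auto

lemma star_s_p: "\<lbrakk>v \<in> verts E; e \<in> arcs E\<rbrakk> \<Longrightarrow> star A (s e) \<otimes> p v = (if v = tail E e then star A (s e) else \<zero>)"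
  using star_mult[of "p v" "s e"] p_s[of v e] by auto

lemma p_star_s: "\<lbrakk>v \<in> verts E; e \<in> arcs E\<rbrakk> \<Longrightarrow> p v \<otimes> star A (s e) = (if v = head E e then star A (s e) else \<zero>)"
  using star_mult[of "s e" "p v"] s_p[of v e] by auto

end

section \<open>Orthogonality of corner projections and path isometries\<close>

locale ck_ideal = ideal_setup E H S + ck_algebra E A p s
  for E :: "('v, 'e) pre_digraph" and H S and A :: "'a normed_star_alg" (structure) and p s
begin

abbreviation "Q \<equiv> corner_proj E H S A p s"
abbreviation "T \<equiv> path_isometry E H S A p s"

definition gap_sum where "gap_sum v = finsum A (\<lambda>e. s e \<otimes> star A (s e)) (exit_arcs E H v)"

lemma exit_arcs_iff [simp]: "e \<in> exit_arcs E H v \<longleftrightarrow> e \<in> arcs E \<and> tail E e = v \<and> head E e \<notin> H"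
  by (auto simp: exit_arcs_def)

lemma gap_closed [simp]: "gap_sum v \<in> carrier A"
  unfolding gap_sum_def by (rule M.finsum_closed) auto

lemma Q_eq: "Q v = (if v \<in> S then p v \<ominus> gap_sum v else p v)"
  by (simp add: corner_proj_def gap_sum_def)

lemma gap_star [simp]: "star A (gap_sum v) = gap_sum v"
  unfolding gap_sum_def by (subst star_finsum) (auto simp: star_mult intro!: M.finsum_cong')

lemma gap_s: assumes v: "v \<in> S" and e: "e \<in> arcs E"
  shows "gap_sum v \<otimes> s e = (if e \<in> exit_arcs E H v then s e else \<zero>)"
proof -
  have t: "(s f \<otimes> star A (s f)) \<otimes> s e = (if f = e then s e else \<zero>)" if "f \<in> exit_arcs E H v" for f
    using that e by (simp add: mult_assoc s_s s_p)
  have g: "gap_sum v \<otimes> s e = finsum A (\<lambda>f. (s f \<otimes> star A (s f)) \<otimes> s e) (exit_arcs E H v)"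
    unfolding gap_sum_def using e by (intro finsum_mult) auto
  show ?thesis
  proof (cases "e \<in> exit_arcs E H v")
    case True
    then show ?thesis unfolding g using S_facts(4)[OF v] e t by (subst finsum_single[of _ e]) auto
  next
    case False
    then have "gap_sum v \<otimes> s e = finsum A (\<lambda>f. \<zero>) (exit_arcs E H v)"
      unfolding g using e t by (intro M.finsum_cong') auto
    then have "gap_sum v \<otimes> s e = \<zero>" by simp
    then show ?thesis using False by (simp only: if_False)
  qed
qed

lemma gap_gap [simp]: assumes v: "v \<in> S" shows "gap_sum v \<otimes> gap_sum v = gap_sum v"
proof -
  have "gap_sum v \<otimes> gap_sum v = finsum A (\<lambda>f. gap_sum v \<otimes> (s f \<otimes> star A (s f))) (exit_arcs E H v)"
    unfolding gap_sum_def[of v] by (subst mult_finsum) (auto simp: gap_sum_def[symmetric])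
  also have "\<dots> = gap_sum v" unfolding gap_sum_def[of v]
    using v by (intro M.finsum_cong') (auto simp: mult_assoc[symmetric] gap_s gap_sum_def[symmetric])
  finally show ?thesis .
qed

lemma p_gap: assumes w: "w \<in> verts E" shows "p w \<otimes> gap_sum v = (if w = v then gap_sum v else \<zero>)"
proof -
  have "p w \<otimes> gap_sum v = finsum A (\<lambda>f. p w \<otimes> (s f \<otimes> star A (s f))) (exit_arcs E H v)"
    unfolding gap_sum_def by (rule mult_finsum) (use w in auto)
  also have "\<dots> = finsum A (\<lambda>f. if w = v then s f \<otimes> star A (s f) else \<zero>) (exit_arcs E H v)"
  proof (rule M.finsum_cong')
    fix f assume "f \<in> exit_arcs E H v"
    then have f: "f \<in> arcs E" "tail E f = v" by auto
    then show "p w \<otimes> (s f \<otimes> star A (s f)) = (if w = v then s f \<otimes> star A (s f) else \<zero>)"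
      using p_s_x[OF w f(1), of "star A (s f)"] by simp
  qed auto
  finally show ?thesis by (cases "w = v") (simp_all add: gap_sum_def)
qed

lemma gap_p: assumes w: "w \<in> verts E" shows "gap_sum v \<otimes> p w = (if w = v then gap_sum v else \<zero>)"
proof -
  have "gap_sum v \<otimes> p w = star A (p w \<otimes> gap_sum v)" using w by (simp add: star_mult)
  then show ?thesis unfolding p_gap[OF w] by (cases "w = v") simp_all
qed

lemma Q_closed [simp]: "v \<in> verts E \<Longrightarrow> Q v \<in> carrier A"
  by (simp add: Q_eq)

lemma Q_star [simp]: "v \<in> verts E \<Longrightarrow> star A (Q v) = Q v"
  by (simp add: Q_eq star_diff)

lemma Q_p: "v \<in> verts E \<Longrightarrow> w \<in> verts E \<Longrightarrow> Q v \<otimes> p w = (if v = w then Q v else \<zero>)"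
  by (auto simp: Q_eq minus_mult gap_p p_orth)

lemma p_Q: "v \<in> verts E \<Longrightarrow> w \<in> verts E \<Longrightarrow> p w \<otimes> Q v = (if v = w then Q v else \<zero>)"
  by (auto simp: Q_eq mult_minus p_gap p_orth)

text \<open>At a vertex of \<open>H\<close> heredity sends every edge into \<open>H\<close>; at a
  vertex of \<open>S\<close> the gap sum removes the others. What survives is exactly the set of
  edges of \<open>E\<close> kept in the ideal graph.\<close>

lemma Q_s: "\<lbrakk>v \<in> H \<union> S; e \<in> arcs E\<rbrakk> \<Longrightarrow> Q v \<otimes> s e = (if tail E e = v \<and> head E e \<in> H then s e else \<zero>)"
  using S_facts(2)[of v] hereditaryD[of e]
  by (auto simp: Q_eq minus_mult gap_s p_s)

lemma Q_Q: assumes v: "v \<in> H \<union> S" and w: "w \<in> H \<union> S"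
  shows "Q v \<otimes> Q w = (if v = w then Q v else \<zero>)"
proof (cases "v = w")
  case True
  have "(p v \<ominus> gap_sum v) \<otimes> (p v \<ominus> gap_sum v) = p v \<ominus> gap_sum v" if "v \<in> S"
    using that by (simp add: minus_mult mult_minus p_gap gap_p)
  then show ?thesis using True v by (auto simp: Q_eq)
next
  case False
  have "Q v \<otimes> Q w = (Q v \<otimes> p w) \<otimes> Q w" using v w mult_assoc[of "Q v" "p w" "Q w"] by (auto simp: p_Q)
  then show ?thesis using False v w by (auto simp: Q_p)
qed

lemma F_head_last_verts [simp]: "\<alpha> \<in> F \<Longrightarrow> head E (last \<alpha>) \<in> verts E"
  using F_head_last[of \<alpha>] by auto

lemma T_single: "T [e] = s e \<otimes> Q (head E e)"
  and T_Cons: "\<alpha> \<noteq> [] \<Longrightarrow> T (e # \<alpha>) = s e \<otimes> T \<alpha>"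
  by (simp_all add: path_isometry_Cons)

lemma T_closed [simp]: "\<alpha> \<in> F \<Longrightarrow> T \<alpha> \<in> carrier A"
  by (induction \<alpha> rule: F_induct) (auto simp: T_single T_Cons)

lemma T_hd: "\<alpha> \<in> F \<Longrightarrow> \<exists>y\<in>carrier A. T \<alpha> = s (hd \<alpha>) \<otimes> y"
  by (induction \<alpha> rule: F_induct) (auto simp: T_single T_Cons)

lemma p_T: "v \<in> verts E \<Longrightarrow> \<alpha> \<in> F \<Longrightarrow> p v \<otimes> T \<alpha> = (if v = tail E (hd \<alpha>) then T \<alpha> else \<zero>)"
  using T_hd[of \<alpha>] by (auto simp: p_s_x)

text \<open>Only the first edge of \<alpha> matters. By \<open>F_tail\<close> it does not start in
  \<open>H\<close>, and by \<open>F_tail_S\<close> it is removed by the gap projection if it starts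
  in \<open>S\<close>.\<close>

lemma Q_T: assumes v: "v \<in> H \<union> S" and a: "\<alpha> \<in> F" shows "Q v \<otimes> T \<alpha> = \<zero>"
proof -
  obtain y where y: "y \<in> carrier A" "T \<alpha> = s (hd \<alpha>) \<otimes> y" using T_hd[OF a] by blast
  have "Q v \<otimes> T \<alpha> = (Q v \<otimes> s (hd \<alpha>)) \<otimes> y" using v a y by (auto simp: mult_assoc)
  also have "Q v \<otimes> s (hd \<alpha>) = \<zero>" using Q_s[OF v F_hd[OF a]] F_tail[OF a] F_tail_S[OF a] v by auto
  finally show ?thesis using y by simp
qed

lemma T_Q: "\<alpha> \<in> F \<Longrightarrow> T \<alpha> \<otimes> Q (head E (last \<alpha>)) = T \<alpha>"
proof (induction \<alpha> rule: F_induct)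
  case (single e)
  then show ?case using F_head_last[of "[e]"] by (auto simp: T_single mult_assoc Q_Q)
next
  case (Cons e \<alpha>)
  then show ?case by (simp add: T_Cons mult_assoc)
qed

lemma star_s_T:
  assumes "e \<in> arcs E" "\<alpha> \<in> F"
  shows "star A (s e) \<otimes> T \<alpha> = (if e = hd \<alpha> then if tl \<alpha> = [] then Q (head E e) else T (tl \<alpha>) else \<zero>)"
  using assms(2,1)
proof (cases \<alpha> rule: F_cases)
  case (single f)
  then show ?thesis using assms by (auto simp: T_single s_s_x p_Q)
next
  case (Cons f \<beta>)
  then show ?thesis using assms by (auto simp: T_Cons s_s_x p_T)
qed

lemma star_T_Q: "v \<in> H \<union> S \<Longrightarrow> \<alpha> \<in> F \<Longrightarrow> star A (T \<alpha>) \<otimes> Q v = \<zero>"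
  using star_mult[of "Q v" "T \<alpha>"] Q_T[of v \<alpha>] by auto

text \<open>Equal first edges are peeled off one by one. A path that ends in \<open>S\<close> may be
  a proper initial segment of another path in \<open>F\<close>; the product then does not vanish
  because of the edges but because its corner projection kills the rest of the longer path, by
  \<open>Q_T\<close> or its adjoint \<open>star_T_Q\<close>.\<close>

lemma T_T: "\<lbrakk>\<alpha> \<in> F; \<beta> \<in> F\<rbrakk> \<Longrightarrow> star A (T \<alpha>) \<otimes> T \<beta> = (if \<alpha> = \<beta> then Q (head E (last \<alpha>)) else \<zero>)"
proof (induction \<alpha> arbitrary: \<beta> rule: F_induct)
  case (single e)
  have h: "head E e \<in> H \<union> S" using F_head_last[OF single(1)] by simp
  then have hv: "head E e \<in> verts E" by auto
  have b: "[e] = \<beta> \<longleftrightarrow> e = hd \<beta> \<and> tl \<beta> = []" using F_not_Nil[OF single(3)] by (cases \<beta>) auto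
  have "star A (T [e]) \<otimes> T \<beta> = Q (head E e) \<otimes> (star A (s e) \<otimes> T \<beta>)"
    using single(2,3) hv by (simp add: T_single star_mult mult_assoc)
  also have "\<dots> = (if [e] = \<beta> then Q (head E e) else \<zero>)"
    unfolding b star_s_T[OF single(2,3)] using h hv F_tl[OF single(3)] by (auto simp: Q_Q Q_T)
  finally show ?case by auto
next
  case (Cons e \<alpha>)
  have b: "e # \<alpha> = \<beta> \<longleftrightarrow> e = hd \<beta> \<and> tl \<beta> = \<alpha>" using F_not_Nil[OF Cons.prems] by (cases \<beta>) auto
  have h: "e = hd \<beta> \<Longrightarrow> tl \<beta> = [] \<Longrightarrow> head E e \<in> H \<union> S"
    using F_head_last[OF Cons.prems] F_not_Nil[OF Cons.prems] by (cases \<beta>) auto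
  have "star A (T (e # \<alpha>)) \<otimes> T \<beta> = star A (T \<alpha>) \<otimes> (star A (s e) \<otimes> T \<beta>)"
    using Cons.hyps Cons.prems by (simp add: T_Cons star_mult mult_assoc)
  also have "\<dots> = (if e # \<alpha> = \<beta> then Q (head E (last \<alpha>)) else \<zero>)"
    unfolding b star_s_T[OF Cons.hyps(2) Cons.prems]
    using h Cons.hyps Cons.IH[of "tl \<beta>"] F_tl[OF Cons.prems] star_T_Q[of "head E e" \<alpha>] by auto
  finally show ?case using Cons.hyps by auto
qed

abbreviation "q \<equiv> ideal_p E H S A p s"
abbreviation "t \<equiv> ideal_s E H S A p s"

lemma qt_simps [simp]: "q (Inl v) = Q v" "q (Inr \<alpha>) = T \<alpha> \<otimes> star A (T \<alpha>)" "t (Inl e) = s e" "t (Inr \<alpha>) = T \<alpha>"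
  by (simp_all add: ideal_p_def ideal_s_def)

lemma t_closed: "a \<in> arcs \<G> \<Longrightarrow> t a \<in> carrier A"
  by (cases a) auto

lemma q_closed: "w \<in> verts \<G> \<Longrightarrow> q w \<in> carrier A"
  by (cases w) auto

lemma star_t_t:
  assumes "a \<in> arcs \<G>" shows "star A (t a) \<otimes> t a = q (head \<G> a)"
proof (cases a)
  case (Inl e)
  then have "head E e \<in> H" using assms hereditaryD by auto
  then have "head E e \<notin> S" using S_facts(2) by blast
  then show ?thesis using Inl assms by (simp add: s_s Q_eq)
next
  case (Inr \<alpha>)
  then show ?thesis using assms by (simp add: T_T)
qed

lemma t_q:
  assumes "a \<in> arcs \<G>" shows "t a \<otimes> q (head \<G> a) = t a"
proof (cases a)
  case (Inl e)
  then have "head E e \<in> H" using assms hereditaryD by auto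
  then have "head E e \<notin> S" using S_facts(2) by blast
  then show ?thesis using Inl assms by (simp add: s_p Q_eq)
next
  case (Inr \<alpha>)
  then show ?thesis using assms by (simp add: T_Q)
qed

lemma q_q:
  assumes "w \<in> verts \<G>" "w' \<in> verts \<G>"
  shows "q w \<otimes> q w' = (if w = w' then q w else \<zero>)"
proof (cases w; cases w')
  fix v v' assume "w = Inl v" "w' = Inl v'"
  then show ?thesis using assms Q_Q by simp
next
  fix v \<beta> assume w: "w = Inl v" "w' = Inr \<beta>"
  then have "Q v \<otimes> (T \<beta> \<otimes> star A (T \<beta>)) = (Q v \<otimes> T \<beta>) \<otimes> star A (T \<beta>)" using assms by (auto simp: mult_assoc)
  then show ?thesis using w assms Q_T[of v \<beta>] by simp
next
  fix \<alpha> v assume w: "w = Inr \<alpha>" "w' = Inl v"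
  then have "(T \<alpha> \<otimes> star A (T \<alpha>)) \<otimes> Q v = T \<alpha> \<otimes> (star A (T \<alpha>) \<otimes> Q v)" using assms by (auto simp: mult_assoc)
  then show ?thesis using w assms star_T_Q[of v \<alpha>] by simp
next
  fix \<alpha> \<beta> assume w: "w = Inr \<alpha>" "w' = Inr \<beta>"
  then have "q w \<otimes> q w' = T \<alpha> \<otimes> ((star A (T \<alpha>) \<otimes> T \<beta>) \<otimes> star A (T \<beta>))" using assms by (simp add: mult_assoc)
  also have "\<dots> = (if \<alpha> = \<beta> then (T \<alpha> \<otimes> Q (head E (last \<alpha>))) \<otimes> star A (T \<alpha>) else \<zero>)"
    using w assms by (auto simp: T_T mult_assoc)
  finally show ?thesis using w assms by (auto simp: T_Q)
qed

lemma q_star: "w \<in> verts \<G> \<Longrightarrow> star A (q w) = q w"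
  by (cases w) (auto simp: star_mult)

lemma q_t: "w \<in> verts \<G> \<Longrightarrow> a \<in> arcs \<G> \<Longrightarrow> w = tail \<G> a \<Longrightarrow> q w \<otimes> t a = t a"
  using Q_s[of "tail E _"] hereditaryD by (cases a) (auto simp: mult_assoc T_T T_Q)

theorem ck_family_ideal: "ck_family \<G> A q t"
proof -
  interpret G: wf_digraph \<G> by (rule wf_ideal_graph)
  have pi: "t a \<otimes> (star A (t a) \<otimes> t a) = t a" if "a \<in> arcs \<G>" for a
    using that by (simp add: star_t_t t_q)
  have tt: "star A (t a) \<otimes> t b = \<zero>" if a: "a \<in> arcs \<G>" and b: "b \<in> arcs \<G>" and ab: "a \<noteq> b" for a b
  proof (cases "tail \<G> a = tail \<G> b")
    case True
    \<comment> \<open>A path vertex emits a single edge, so two distinct edges with a common source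
      both come from \<open>E\<close>.\<close>
    then show ?thesis using a b ab by (cases a; cases b) (auto simp: s_s)
  next
    case False
    have w: "tail \<G> a \<in> verts \<G>" "tail \<G> b \<in> verts \<G>" using a b by auto
    note c = t_closed[OF a] t_closed[OF b] q_closed[OF w(1)] q_closed[OF w(2)]
    \<comment> \<open>With different sources, insert the two vertex projections between the factors
      and use that they are orthogonal.\<close>
    have "star A (t a) \<otimes> t b = star A (q (tail \<G> a) \<otimes> t a) \<otimes> (q (tail \<G> b) \<otimes> t b)"
      using a b w by (simp add: q_t)
    also have "\<dots> = star A (t a) \<otimes> ((q (tail \<G> a) \<otimes> q (tail \<G> b)) \<otimes> t b)"
      using c w by (simp add: star_mult mult_assoc q_star)
    also have "\<dots> = \<zero>" unfolding q_q[OF w] using False c by simp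
    finally show ?thesis .
  qed
  have rg: "proj_le A (t a \<otimes> star A (t a)) (q (tail \<G> a))" if a: "a \<in> arcs \<G>" for a
  proof -
    have w: "tail \<G> a \<in> verts \<G>" using a by auto
    note c = t_closed[OF a] q_closed[OF w]
    have l: "q (tail \<G> a) \<otimes> (t a \<otimes> star A (t a)) = t a \<otimes> star A (t a)"
      using c q_t[OF w a refl] by (simp add: mult_assoc[symmetric])
    have "star A (q (tail \<G> a) \<otimes> (t a \<otimes> star A (t a))) = t a \<otimes> star A (t a)"
      unfolding l using c by (simp add: star_mult)
    then have "(t a \<otimes> star A (t a)) \<otimes> q (tail \<G> a) = t a \<otimes> star A (t a)"
      using c w by (simp add: star_mult q_star mult_assoc)
    then show ?thesis using l by (simp add: proj_le_def)
  qed
  have sm: "q w = finsum A (\<lambda>a. t a \<otimes> star A (t a)) (out_arcs \<G> w)" if r: "regular_vertex \<G> w" for w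
  proof (cases w)
    case (Inl v)
    \<comment> \<open>The vertices of \<open>S\<close> are infinite emitters, and a vertex of
      \<open>H\<close> keeps all its edges. So the relation here is the one of \<open>E\<close> at
      \<open>v\<close>.\<close>
    then have v: "v \<in> H" using r not_regular_S by (auto simp: regular_vertex_def)
    then have vS: "v \<notin> S" using S_facts(2) by blast
    have rE: "regular_vertex E v"
      using r v unfolding Inl regular_vertex_def out_arcs_H[OF v] by (auto dest: finite_imageD)
    have "finsum A (\<lambda>a. t a \<otimes> star A (t a)) (out_arcs \<G> w) = finsum A (\<lambda>e. s e \<otimes> star A (s e)) (out_arcs E v)"
      unfolding Inl out_arcs_H[OF v] by (subst M.finsum_reindex) (auto simp: comp_def)
    then show ?thesis using ck_sum[OF rE] Inl vS by (simp add: Q_eq)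
  next
    case (Inr \<alpha>)
    then have a: "\<alpha> \<in> F" using r by (auto simp: regular_vertex_def)
    show ?thesis unfolding Inr out_arcs_Inr[OF a] using a by simp
  qed
  show ?thesis
    unfolding ck_family_def is_projection_def is_partial_isometry_def
  proof (intro conjI ballI allI impI)
    fix a b assume a: "a \<in> arcs \<G>" and b: "b \<in> arcs \<G>" and ab: "a \<noteq> b"
    have "(t a \<otimes> star A (t a)) \<otimes> (t b \<otimes> star A (t b)) = t a \<otimes> ((star A (t a) \<otimes> t b) \<otimes> star A (t b))"
      using t_closed[OF a] t_closed[OF b] by (simp add: mult_assoc)
    then show "(t a \<otimes> star A (t a)) \<otimes> (t b \<otimes> star A (t b)) = \<zero>"
      using tt[OF a b ab] t_closed[OF a] t_closed[OF b] by simp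
  qed (use pi rg sm q_closed t_closed q_star q_q star_t_t in \<open>simp_all add: mult_assoc\<close>)
qed

end

section \<open>The action of the graph on a module over the algebra of the ideal graph\<close>

locale ideal_action = ideal_setup E H S + cstar_algebra B
  for E :: "('v, 'e) pre_digraph" and H S and B :: "'a normed_star_alg" (structure) +
  fixes q t assumes ckG: "ck_family (ideal_graph E H S) B q t"
begin

sublocale G: ck_algebra "ideal_graph E H S" B q t
  using wf_ideal_graph ckG by (intro ck_algebra.intro star_algebra_axioms ck_algebra_axioms.intro)

sublocale orthogonal_projections B "verts (ideal_graph E H S)" q
  by unfold_locales (auto intro: G.p_orth)

text \<open>A path vertex is regular with one outgoing edge, so its summation relation has a single
  term.\<close>

lemma q_Inr: "\<alpha> \<in> F \<Longrightarrow> q (Inr \<alpha>) = t (Inr \<alpha>) \<otimes> star B (t (Inr \<alpha>))"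
  using G.ck_sum[of "Inr \<alpha>"] by (simp add: regular_vertex_def out_arcs_Inr)

text \<open>
  An edge \<open>e\<close> of \<open>E\<close> acts as the strict sum, over the vertices \<open>w\<close> of the ideal graph that lie over
  \<open>head E e\<close>, of partial isometries \<open>shift_op e w\<close> from \<open>q w\<close> into \<open>q (shift e w)\<close>.
\<close>

definition start :: "'v + 'e list \<Rightarrow> 'v" where
  "start w = (case w of Inl v \<Rightarrow> v | Inr \<alpha> \<Rightarrow> tail E (hd \<alpha>))"

text \<open>In C*(E) the projection of a vertex \<open>w\<close> of the ideal graph lies below the
  one of \<open>start w\<close>. So the projection of \<open>v\<close> has to act as the sum of the
  \<open>q w\<close> over this fibre.\<close>

definition fibre :: "'v \<Rightarrow> ('v + 'e list) set" where
  "fibre v = {w \<in> verts \<G>. start w = v}"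

text \<open>The generator that plays the part of \<open>s_e\<close> times the corner projection at
  \<open>head E e\<close>: the edge itself if the ideal graph keeps it, otherwise the path of length
  one.\<close>

definition lift :: "'e \<Rightarrow> 'e + 'e list" where
  "lift e = (if tail E e \<in> H \<union> S \<and> head E e \<in> H then Inl e else Inr [e])"

definition shift :: "'e \<Rightarrow> 'v + 'e list \<Rightarrow> 'v + 'e list" where
  "shift e w = (case w of Inl v \<Rightarrow> tail \<G> (lift e) | Inr \<alpha> \<Rightarrow> Inr (e # \<alpha>))"

text \<open>For a path vertex this copies the identity s_e T_\<alpha> = T_{e\<alpha>}, multiplied on
  the right by the adjoint of T_\<alpha>, which turns it into a formula about elements of
  \<open>B\<close> alone.\<close>

definition shift_op :: "'e \<Rightarrow> 'v + 'e list \<Rightarrow> 'a" where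
  "shift_op e w = (case w of Inl v \<Rightarrow> t (lift e) | Inr \<alpha> \<Rightarrow> t (Inr (e # \<alpha>)) \<otimes> star B (t (Inr \<alpha>)))"

lemma start_simps [simp]: "start (Inl v) = v" "start (Inr \<alpha>) = tail E (hd \<alpha>)"
  by (simp_all add: start_def)

lemma shift_simps [simp]: "shift e (Inl v) = tail \<G> (lift e)" "shift e (Inr \<alpha>) = Inr (e # \<alpha>)"
  "shift_op e (Inl v) = t (lift e)" "shift_op e (Inr \<alpha>) = t (Inr (e # \<alpha>)) \<otimes> star B (t (Inr \<alpha>))"
  by (simp_all add: shift_def shift_op_def)

lemma fibre_verts: "fibre v \<subseteq> verts \<G>"
  by (auto simp: fibre_def)

lemma lift_arc: "e \<in> arcs E \<Longrightarrow> head E e \<in> H \<union> S \<Longrightarrow> lift e \<in> arcs \<G> \<and> head \<G> (lift e) = Inl (head E e)"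
  by (auto simp: lift_def F_single)

lemma lift_single: "[e] \<in> F \<Longrightarrow> lift e = Inr [e]"
  using S_facts(2) by (auto simp: lift_def F_single)

lemma fibre_cases:
  assumes "w \<in> fibre (head E e)" "e \<in> arcs E"
  obtains "w = Inl (head E e)" "head E e \<in> H \<union> S" "lift e \<in> arcs \<G>" "head \<G> (lift e) = w"
    | \<alpha> where "w = Inr \<alpha>" "\<alpha> \<in> F" "e # \<alpha> \<in> F" "tail E (hd \<alpha>) = head E e"
proof (cases w)
  case (Inl v)
  then have "v = head E e" "v \<in> H \<union> S" using assms(1) by (auto simp: fibre_def)
  then show thesis using that(1) lift_arc[OF assms(2)] Inl by simp
next
  case (Inr \<alpha>)
  then have "\<alpha> \<in> F" "tail E (hd \<alpha>) = head E e" using assms(1) by (auto simp: fibre_def)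
  then show thesis using that(2) Inr F_Cons[of \<alpha> e] assms(2) by simp
qed

lemma lift_tail: "tail \<G> (lift e) = (if tail E e \<in> H \<union> S \<and> head E e \<in> H then Inl (tail E e) else Inr [e])"
  by (simp add: lift_def)

lemma path_isom: "\<alpha> \<in> F \<Longrightarrow> star B (t (Inr \<alpha>)) \<otimes> t (Inr \<alpha>) = q (Inl (head E (last \<alpha>)))"
  using G.s_s[of "Inr \<alpha>" "Inr \<alpha>"] by simp

text \<open>The shift is injective since a corner vertex goes to a corner vertex or to a path of
  length one, whereas a path goes to a longer path. The range of \<open>shift_op e w\<close> can be
  smaller than \<open>q (shift e w)\<close> only when \<open>lift e\<close> is an edge kept from
  \<open>E\<close>.\<close>

lemma shift_isometry:
  assumes e: "e \<in> arcs E"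
  shows "column_isometry (fibre (head E e)) (shift e) (shift_op e)"
proof -
  have "shift e w \<in> verts \<G> \<and> shift_op e w \<in> carrier B \<and> star B (shift_op e w) \<otimes> shift_op e w = q w
      \<and> shift_op e w \<otimes> q w = shift_op e w \<and> q (shift e w) \<otimes> shift_op e w = shift_op e w"
    if "w \<in> fibre (head E e)" for w
    using that e
  proof (cases w rule: fibre_cases)
    case 1
    then have "tail \<G> (lift e) \<in> verts \<G>" "head \<G> (lift e) \<in> verts \<G>" by auto
    with 1 show ?thesis using G.s_s[of "lift e" "lift e"] G.s_p[of w "lift e"] G.p_s[of "tail \<G> (lift e)" "lift e"]
      by simp
  next
    case (2 \<alpha>)
    let ?a = "t (Inr (e # \<alpha>))" let ?b = "t (Inr \<alpha>)"
    have r: "Inl (head E (last \<alpha>)) \<in> verts \<G>" using F_head_last[OF 2(2)] by simp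
    have c: "?a \<in> carrier B" "?b \<in> carrier B" using 2 by auto
    have aa: "star B ?a \<otimes> ?a = q (Inl (head E (last \<alpha>)))" using path_isom[OF 2(3)] 2 by simp
    have "star B (?a \<otimes> star B ?b) \<otimes> (?a \<otimes> star B ?b) = ?b \<otimes> ((star B ?a \<otimes> ?a) \<otimes> star B ?b)"
      using c by (simp add: star_mult mult_assoc)
    \<comment> \<open>The paths \<alpha> and e\<alpha> end with the same edge, so their partial
      isometries share the source projection, which \<open>star B ?b\<close> absorbs.\<close>
    also have "\<dots> = ?b \<otimes> star B ?b" unfolding aa using r 2 by (simp add: G.p_star_s)
    finally show ?thesis using 2 c r
      by (simp add: q_Inr[symmetric] mult_assoc G.star_s_p G.p_s_x)
  qed
  moreover have "inj_on (shift e) (fibre (head E e))"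
  proof (rule inj_onI)
    fix w w' assume w: "w \<in> fibre (head E e)" and w': "w' \<in> fibre (head E e)" and "shift e w = shift e w'"
    then show "w = w'"
      by (cases w rule: fibre_cases[OF _ e]; cases w' rule: fibre_cases[OF _ e]) (auto simp: lift_tail split: if_splits)
  qed
  ultimately show ?thesis using fibre_verts by (auto simp: column_isometry_def)
qed

section \<open>The operators of vertices and edges of the original graph\<close>

definition Pop where "Pop v = strict_sum (fibre v) q"
definition Sop where "Sop e = strict_sum (fibre (head E e)) (shift_op e)"

lemma Pop_isometry: "column_isometry (fibre v) (\<lambda>w. w) q"
  by (rule column_isometry_id[OF fibre_verts])

lemma Pop_carrier [simp]: "Pop v \<in> carrier \<A>"
  unfolding Pop_def by (rule strict_sum_carrier[OF Pop_isometry])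

lemma Sop_carrier [simp]: "e \<in> arcs E \<Longrightarrow> Sop e \<in> carrier \<A>"
  unfolding Sop_def by (rule strict_sum_carrier[OF shift_isometry])

interpretation D: star_algebra \<A> by (rule star_algebra_adj)

lemma q_Pop: "w \<in> verts \<G> \<Longrightarrow> x \<in> X \<Longrightarrow> q w \<otimes> Pop v x = (if start w = v then q w \<otimes> x else \<zero>)"
  unfolding Pop_def using q_strict_sum(1)[OF Pop_isometry, where x = x] q_strict_sum(2)[OF Pop_isometry, where x = x]
  by (cases "w \<in> fibre v") (auto simp: fibre_def)

lemma Pop_Pop: "x \<in> X \<Longrightarrow> Pop v (Pop w x) = (if v = w then Pop v x else \<zero>)"
  by (rule fin_module_eqI) (auto simp: q_Pop)

lemma star_Sop: "e \<in> arcs E \<Longrightarrow> star \<A> (Sop e) = strict_sum (fibre (head E e)) (\<lambda>w. star B (shift_op e w))"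
  unfolding Sop_def by (rule star_strict_sum[OF shift_isometry])

lemma start_shift: "start (shift e w) = tail E e"
  by (cases w) (auto simp: lift_tail)

lemma q_Sop_zero: "\<lbrakk>e \<in> arcs E; w \<in> verts \<G>; start w \<noteq> tail E e; x \<in> X\<rbrakk> \<Longrightarrow> q w \<otimes> Sop e x = \<zero>"
  unfolding Sop_def using start_shift by (intro q_strict_sum(2)[OF shift_isometry]) auto

lemma Pop_Sop: assumes e: "e \<in> arcs E" and x: "x \<in> X" shows "Pop (tail E e) (Sop e x) = Sop e x"
  by (rule fin_module_eqI) (use assms q_Sop_zero in \<open>auto simp: q_Pop\<close>)

lemma Sop_Sop: assumes e: "e \<in> arcs E" and x: "x \<in> X" shows "star \<A> (Sop e) (Sop e x) = Pop (head E e) x"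
  unfolding star_Sop[OF e] Pop_def unfolding Sop_def by (rule strict_sum_isometry[OF shift_isometry[OF e] x])

lemma Sop_Pop: assumes e: "e \<in> arcs E" and x: "x \<in> X" shows "Sop e (Pop (head E e) x) = Sop e x"
  unfolding Pop_def Sop_def by (rule strict_sum_strict_sum_q[OF shift_isometry[OF e] x])

text \<open>Shifts by different edges can meet only at a corner vertex, since path vertices remember
  their first edge. There both operators are edges kept from \<open>E\<close>, whose partial
  isometries have orthogonal ranges.\<close>

lemma Sop_orth:
  assumes e: "e \<in> arcs E" and f: "f \<in> arcs E" and ef: "e \<noteq> f" and x: "x \<in> X"
  shows "star \<A> (Sop e) (Sop f x) = \<zero>"
proof -
  have y: "Sop f x \<in> X" using f by simp
  have "star B (shift_op e w) \<otimes> Sop f x = \<zero>" if w: "w \<in> fibre (head E e)" for w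
  proof -
    note we = isoD[OF shift_isometry[OF e] w]
    have "star B (shift_op e w) \<otimes> (q (shift e w) \<otimes> Sop f x) = \<zero>"
    proof (cases "shift e w \<in> shift f ` fibre (head E f)")
      case True
      then obtain w' where w': "w' \<in> fibre (head E f)" "shift e w = shift f w'" by blast
      have "star B (shift_op e w) \<otimes> shift_op f w' = \<zero>"
        using w w' ef by (cases w rule: fibre_cases[OF _ e]; cases w' rule: fibre_cases[OF _ f])
          (auto simp: lift_def G.s_s split: if_splits)
      then show ?thesis using w' x f we isoD(4)[OF shift_isometry[OF f] w'(1)]
        by (simp add: Sop_def q_strict_sum(1)[OF shift_isometry[OF f] x w'(1)] mult_assoc[symmetric])
    next
      case False
      then show ?thesis using q_strict_sum(2)[OF shift_isometry[OF f] x, of "shift e w"] we x by (simp add: Sop_def)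
    qed
    then show ?thesis using star_u_x[OF shift_isometry[OF e] w, of "Sop f x"] y by simp
  qed
  then show ?thesis unfolding star_Sop[OF e] strict_sum_def using y by (auto intro!: fsum_zero)
qed

text \<open>The range projection of the operator of \<open>e\<close>, component by component: it
  contains the whole component of every path that begins with \<open>e\<close>, and at a corner
  vertex only the range of the kept edge \<open>e\<close>. Summed over edges this yields both the
  summation relation and the gap projections.\<close>

lemma q_Sop_star:
  assumes e: "e \<in> arcs E" and w: "w \<in> verts \<G>" and x: "x \<in> X"
  shows "q w \<otimes> Sop e (star \<A> (Sop e) x) = (case w of
      Inl v \<Rightarrow> if v = tail E e \<and> head E e \<in> H then t (Inl e) \<otimes> (star B (t (Inl e)) \<otimes> x) else \<zero>
    | Inr \<alpha> \<Rightarrow> if hd \<alpha> = e then q w \<otimes> x else \<zero>)"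
proof -
  note iso = shift_isometry[OF e]
  let ?u = "shift_op e" let ?D = "fibre (head E e)"
  have y: "star \<A> (Sop e) x \<in> X" using e by (intro op_closed D.star_closed) simp
  have hit: "q w \<otimes> Sop e (star \<A> (Sop e) x) = ?u w0 \<otimes> (star B (?u w0) \<otimes> x)"
    if "w0 \<in> ?D" "shift e w0 = w" for w0
    using q_strict_sum(1)[OF iso y that(1)] that u_star_strict_sum[OF iso that(1) x] by (simp add: Sop_def star_Sop[OF e, unfolded Sop_def])
  have miss: "q w \<otimes> Sop e (star \<A> (Sop e) x) = \<zero>" if "w \<notin> shift e ` ?D"
    using q_strict_sum(2)[OF iso y w that] by (simp add: Sop_def)
  show ?thesis
  proof (cases w)
    case (Inl v)
    show ?thesis
    proof (cases "v = tail E e \<and> head E e \<in> H")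
      case True
      have "Inl (head E e) \<in> ?D" using True by (simp add: fibre_def)
      moreover have l: "lift e = Inl e" using True w Inl by (simp add: lift_def)
      ultimately show ?thesis using hit[of "Inl (head E e)"] Inl True by simp
    next
      case False
      then have "w \<noteq> shift e w0" if "w0 \<in> ?D" for w0 using Inl by (cases w0) (auto simp: lift_tail)
      then show ?thesis using miss Inl False by auto
    qed
  next
    case (Inr \<alpha>)
    then have a: "\<alpha> \<in> F" using w by simp
    show ?thesis
    proof (cases "hd \<alpha> = e")
      case True
      show ?thesis using a
      proof (cases \<alpha> rule: F_cases)
        case (single f)
        then have f: "f = e" using True by simp
        have "head E e \<in> H \<union> S" using F_head_last[OF a] single f by simp
        then have "Inl (head E e) \<in> ?D" by (simp add: fibre_def)
        then show ?thesis using hit[of "Inl (head E e)"] lift_single single f Inr x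
          by (simp add: q_Inr mult_assoc)
      next
        case (Cons f \<beta>)
        then have f: "f = e" using True by simp
        have b: "Inr \<beta> \<in> ?D" using Cons f by (simp add: fibre_def)
        let ?a = "t (Inr \<alpha>)" let ?b = "t (Inr \<beta>)"
        have r: "Inl (head E (last \<beta>)) \<in> verts \<G>" using F_head_last[OF Cons(3)] by simp
        have c: "?a \<in> carrier B" "?b \<in> carrier B" using Cons a by auto
        have "(?a \<otimes> star B ?b) \<otimes> (star B (?a \<otimes> star B ?b) \<otimes> x) = ?a \<otimes> ((star B ?b \<otimes> ?b) \<otimes> (star B ?a \<otimes> x))"
          using c x by (simp add: star_mult mult_assoc)
        also have "\<dots> = (?a \<otimes> q (Inl (head E (last \<beta>)))) \<otimes> (star B ?a \<otimes> x)"
          using c x r by (simp add: path_isom[OF Cons(3)] mult_assoc)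
        also have "?a \<otimes> q (Inl (head E (last \<beta>))) = ?a" using G.s_p[OF r, of "Inr \<alpha>"] a Cons by simp
        also have "?a \<otimes> (star B ?a \<otimes> x) = q w \<otimes> x" using Inr a x by (simp add: q_Inr mult_assoc)
        finally show ?thesis using hit[OF b] Inr Cons(1) f by simp
      qed
    next
      case False
      then have "w \<noteq> shift e w0" if "w0 \<in> ?D" for w0 using Inr by (cases w0) (auto simp: lift_tail)
      then show ?thesis using miss Inr False by auto
    qed
  qed
qed

lemma finsum_Sop_apply:
  assumes I: "I \<subseteq> arcs E" and x: "x \<in> X" and w: "w \<in> verts \<G>"
  shows "q w \<otimes> finsum \<A> (\<lambda>e. Sop e \<otimes>\<^bsub>\<A>\<^esub> star \<A> (Sop e)) I x
    = finsum B (\<lambda>e. q w \<otimes> Sop e (star \<A> (Sop e) x)) I"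
proof -
  have "finsum \<A> (\<lambda>e. Sop e \<otimes>\<^bsub>\<A>\<^esub> star \<A> (Sop e)) I x
      = finsum B (\<lambda>e. (Sop e \<otimes>\<^bsub>\<A>\<^esub> star \<A> (Sop e)) x) I"
    by (rule adj_finsum_apply) (use I in auto)
  also have "\<dots> = finsum B (\<lambda>e. Sop e (star \<A> (Sop e) x)) I" by (simp add: adj_alg_simps(2))
  also have "q w \<otimes> \<dots> = finsum B (\<lambda>e. q w \<otimes> Sop e (star \<A> (Sop e) x)) I"
    by (rule mult_finsum) (use w I in auto)
  finally show ?thesis .
qed

theorem ck_family_action: "ck_family E \<A> Pop Sop"
proof -
  have Pc: "Pop v \<in> carrier \<A>" for v by simp
  have Pst: "star \<A> (Pop v) = Pop v" for v
    unfolding Pop_def using star_strict_sum[OF Pop_isometry] strict_sum_star_q[OF fibre_verts] by simp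
  have PP: "Pop v \<otimes>\<^bsub>\<A>\<^esub> Pop v = Pop v" for v
    by (rule mult_eqI) (simp_all add: Pop_Pop)
  have PQ: "Pop v \<otimes>\<^bsub>\<A>\<^esub> Pop w = \<zero>\<^bsub>\<A>\<^esub>" if "v \<noteq> w" for v w
    by (rule mult_zeroI) (use that in \<open>simp_all add: Pop_Pop\<close>)
  have SS: "star \<A> (Sop e) \<otimes>\<^bsub>\<A>\<^esub> Sop e = Pop (head E e)" if e: "e \<in> arcs E" for e
    by (rule mult_eqI) (use e in \<open>simp_all add: Sop_Sop\<close>)
  have SP: "Sop e \<otimes>\<^bsub>\<A>\<^esub> Pop (head E e) = Sop e" if e: "e \<in> arcs E" for e
    by (rule mult_eqI) (use e in \<open>simp_all add: Sop_Pop\<close>)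
  have PS: "Pop (tail E e) \<otimes>\<^bsub>\<A>\<^esub> Sop e = Sop e" if e: "e \<in> arcs E" for e
    by (rule mult_eqI) (use e in \<open>simp_all add: Pop_Sop\<close>)
  have St: "star \<A> (Sop e) \<otimes>\<^bsub>\<A>\<^esub> Sop f = \<zero>\<^bsub>\<A>\<^esub>" if e: "e \<in> arcs E" "f \<in> arcs E" "e \<noteq> f" for e f
    by (rule mult_zeroI) (use e in \<open>simp_all add: Sop_orth\<close>)
  have rg: "proj_le \<A> (Sop e \<otimes>\<^bsub>\<A>\<^esub> star \<A> (Sop e)) (Pop (tail E e))" if e: "e \<in> arcs E" for e
  proof -
    have l: "Pop (tail E e) \<otimes>\<^bsub>\<A>\<^esub> (Sop e \<otimes>\<^bsub>\<A>\<^esub> star \<A> (Sop e)) = Sop e \<otimes>\<^bsub>\<A>\<^esub> star \<A> (Sop e)"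
      using e PS[OF e] by (simp add: D.mult_assoc[symmetric])
    have "star \<A> (Sop e) \<otimes>\<^bsub>\<A>\<^esub> Pop (tail E e) = star \<A> (Sop e)"
      using D.star_mult[of "Pop (tail E e)" "Sop e"] PS[OF e] Pst e by simp
    then show ?thesis using l e by (simp add: proj_le_def D.mult_assoc)
  qed
  have sm: "Pop v = finsum \<A> (\<lambda>e. Sop e \<otimes>\<^bsub>\<A>\<^esub> star \<A> (Sop e)) (out_arcs E v)" if r: "regular_vertex E v" for v
  proof (rule op_ext)
    have fin: "finite (out_arcs E v)" using r by (simp add: regular_vertex_def)
    show c: "finsum \<A> (\<lambda>e. Sop e \<otimes>\<^bsub>\<A>\<^esub> star \<A> (Sop e)) (out_arcs E v) \<in> carrier \<A>"
      by (rule D.M.finsum_closed) auto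
    fix x assume x: "x \<in> X"
    show "Pop v x = finsum \<A> (\<lambda>e. Sop e \<otimes>\<^bsub>\<A>\<^esub> star \<A> (Sop e)) (out_arcs E v) x"
    proof (rule fin_module_eqI)
      fix w assume w: "w \<in> verts \<G>"
      have I: "out_arcs E v \<subseteq> arcs E" by auto
      have "finsum B (\<lambda>e. q w \<otimes> Sop e (star \<A> (Sop e) x)) (out_arcs E v) = (if start w = v then q w \<otimes> x else \<zero>)"
      proof (cases w)
        \<comment> \<open>Exactly one edge of \<open>E\<close> reaches this component, the first
          edge of \<alpha>, and it leaves \<open>v\<close> precisely when \<open>w\<close> lies over
          \<open>v\<close>.\<close>
        case (Inr \<alpha>)
        then have a: "\<alpha> \<in> F" using w by simp
        show ?thesis
        proof (cases "start w = v")
          case True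
          then have h: "hd \<alpha> \<in> out_arcs E v" using Inr a by simp
          have "finsum B (\<lambda>e. q w \<otimes> Sop e (star \<A> (Sop e) x)) (out_arcs E v) = q w \<otimes> Sop (hd \<alpha>) (star \<A> (Sop (hd \<alpha>)) x)"
            by (rule finsum_single[OF fin h]) (use w x Inr a in \<open>auto simp: q_Sop_star\<close>)
          then show ?thesis using True Inr w x a by (simp add: q_Sop_star)
        next
          case False
          have "finsum B (\<lambda>e. q w \<otimes> Sop e (star \<A> (Sop e) x)) (out_arcs E v) = \<zero>"
            by (rule M.add.finprod_one_eqI) (use False w x Inr in \<open>auto simp: q_Sop_star\<close>)
          then show ?thesis using False by simp
        qed
      next
        case (Inl v')
        show ?thesis
        proof (cases "v' = v")
          case False
          have "finsum B (\<lambda>e. q w \<otimes> Sop e (star \<A> (Sop e) x)) (out_arcs E v) = \<zero>"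
            by (rule M.add.finprod_one_eqI) (use False w x Inl in \<open>auto simp: q_Sop_star\<close>)
          then show ?thesis using False Inl by simp
        next
          case True
          \<comment> \<open>A regular vertex cannot be in \<open>S\<close>. Being in
            \<open>H\<close>, it is regular in the ideal graph with the same edges, and the relation
            there supplies the sum.\<close>
          then have v: "v \<in> H" using w Inl S_facts(3)[of v] r by (auto simp: regular_vertex_def)
          have rG: "regular_vertex \<G> (Inl v)"
            using r v unfolding regular_vertex_def out_arcs_H[OF v] by auto
          have "q (Inl v) = finsum B (\<lambda>e. t (Inl e) \<otimes> star B (t (Inl e))) (out_arcs E v)"
            unfolding G.ck_sum[OF rG] out_arcs_H[OF v]
            by (subst M.finsum_reindex) (use v hereditaryD in \<open>auto simp: comp_def\<close>)
          then have "q w \<otimes> x = finsum B (\<lambda>e. (t (Inl e) \<otimes> star B (t (Inl e))) \<otimes> x) (out_arcs E v)"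
            unfolding Inl True using v x by (simp, subst finsum_mult) auto
          also have "\<dots> = finsum B (\<lambda>e. q w \<otimes> Sop e (star \<A> (Sop e) x)) (out_arcs E v)"
            by (rule M.finsum_cong') (use v w x Inl True hereditaryD in \<open>auto simp: q_Sop_star mult_assoc\<close>)
          finally show ?thesis using Inl True by simp
        qed
      qed
      then show "q w \<otimes> Pop v x = q w \<otimes> finsum \<A> (\<lambda>e. Sop e \<otimes>\<^bsub>\<A>\<^esub> star \<A> (Sop e)) (out_arcs E v) x"
        unfolding finsum_Sop_apply[OF I x w] q_Pop[OF w x] by simp
    qed (use c in auto)
  qed simp
  have orth: "(Sop e \<otimes>\<^bsub>\<A>\<^esub> star \<A> (Sop e)) \<otimes>\<^bsub>\<A>\<^esub> (Sop f \<otimes>\<^bsub>\<A>\<^esub> star \<A> (Sop f)) = \<zero>\<^bsub>\<A>\<^esub>"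
    if e: "e \<in> arcs E" "f \<in> arcs E" "e \<noteq> f" for e f
  proof -
    have "(Sop e \<otimes>\<^bsub>\<A>\<^esub> star \<A> (Sop e)) \<otimes>\<^bsub>\<A>\<^esub> (Sop f \<otimes>\<^bsub>\<A>\<^esub> star \<A> (Sop f))
        = Sop e \<otimes>\<^bsub>\<A>\<^esub> ((star \<A> (Sop e) \<otimes>\<^bsub>\<A>\<^esub> Sop f) \<otimes>\<^bsub>\<A>\<^esub> star \<A> (Sop f))"
      using e by (simp add: D.mult_assoc)
    then show ?thesis using St[OF e] e by simp
  qed
  show ?thesis
    unfolding ck_family_def is_projection_def is_partial_isometry_def
    using Pc Pst PP PQ SS SP rg sm orth by (simp add: D.mult_assoc)
qed

end

section \<open>Homomorphisms from free *-algebras\<close>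

text \<open>Words are products of letters, so induction over words and then over sums leaves no
  freedom beyond the generators. Composites of representations are compared by this rule.\<close>

lemma (in star_algebra) feval_unique:
  assumes hom: "\<phi> \<in> star_hom (free_star_alg G N) A" and f: "f \<in> carrier (free_star_alg G N)"
  shows "\<phi> f = feval (\<lambda>x. \<phi> (free_gen x)) f"
proof -
  let ?F = "free_star_alg G N" let ?g = "\<lambda>x. \<phi> (free_gen x)"
  interpret star_hom_pair ?F A \<phi>
    by (rule star_hom_pair.intro[OF star_algebra_free star_algebra_axioms]) (unfold_locales, rule hom)
  have gc: "x \<in> G \<Longrightarrow> ?g x \<in> carrier A" for x by (intro h(1) free_gen_carrier)
  have letter: "\<phi> (monomial 1 [l]) = leval ?g l" if l: "fst l \<in> G" for l
  proof (cases l)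
    case (Pair x b)
    then have x: "free_gen x \<in> carrier ?F" using l by (simp add: free_gen_carrier)
    have "star ?F (free_gen x) = monomial 1 [(x, True)]"
      unfolding free_gen_mono mono_star by (simp add: adj_word_def)
    then show ?thesis using h(5)[OF x] Pair by (cases b) (simp_all add: free_gen_mono)
  qed
  have word: "\<phi> (monomial 1 w) = weval ?g w" if "w \<in> words G" for w
    using that
  proof (induction w)
    case (Cons l w)
    then have l: "fst l \<in> G" by (auto simp: words_def)
    show ?case
    proof (cases "w = []")
      case True
      then show ?thesis using letter[OF l] by simp
    next
      case False
      then have w: "w \<in> words G" using Cons.prems by (auto simp: words_def)
      have lw: "[l] \<in> words G" using l by (simp add: words_def)
      have "monomial 1 (l # w) = monomial 1 [l] \<otimes>\<^bsub>?F\<^esub> monomial 1 w" by (simp only: mono_mult) simp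
      moreover have "weval ?g (l # w) = leval ?g l \<otimes> weval ?g w"
        by (rule weval_Cons[where G = G]) (use gc False in auto)
      ultimately show ?thesis
        using h(4)[OF mono_carrier[OF lw] mono_carrier[OF w], of 1 1] Cons.IH[OF w] letter[OF l]
        by simp
    qed
  qed (simp add: words_def)
  show ?thesis using f
  proof (induction f rule: free_induct)
    case zero
    then show ?case using h_zero by (simp add: feval_def free_simps)
  next
    case (add f c w)
    have "monomial c w = c \<odot>\<^bsub>?F\<^esub> monomial 1 w" by (simp add: mono_smult)
    then have "\<phi> (monomial c w) = feval ?g (monomial c w)"
      using h(3)[OF mono_carrier[OF add.hyps(2)], of c 1] word[OF add.hyps(2)]
        feval_mono[where g = ?g and G = G, OF gc add.hyps(2), of c] by simp
    then show ?case
      using add h(2)[OF add.hyps(1) mono_carrier[OF add.hyps(2)], of c]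
        feval_add[where g = ?g and G = G, OF gc add.hyps(1) mono_carrier[OF add.hyps(2)], of c] by simp
  qed
qed

lemma (in star_algebra) feval_cong:
  assumes g: "\<And>x. x \<in> G \<Longrightarrow> g x \<in> carrier A" "\<And>x. x \<in> G \<Longrightarrow> g x = g' x"
    and f: "f \<in> carrier (free_star_alg G N)"
  shows "feval g f = feval g' f"
proof -
  have "weval g w = weval g' w" if "fst ` set w \<subseteq> G" for w
    using that
  proof (induction w)
    case (Cons l w)
    then have "leval g l = leval g' l" using g(2) by (cases l) auto
    then show ?case using Cons by (cases w) auto
  qed simp
  then have e: "weval g w = weval g' w" if "w \<in> words G" for w using that by (simp add: words_def)
  have c: "weval g w \<in> carrier A" if "w \<in> words G" for w
    by (rule weval_closed[where G = G]) (use g that in auto)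
  show ?thesis unfolding feval_def
    by (rule M.finsum_cong') (use f e c in \<open>auto simp: free_simps(1) Pi_iff subset_iff\<close>)
qed

lemma star_hom_compose:
  "\<lbrakk>\<phi> \<in> star_hom A B; \<psi> \<in> star_hom B C\<rbrakk> \<Longrightarrow> (\<lambda>x. \<psi> (\<phi> x)) \<in> star_hom A C"
  by (simp add: star_hom_def)

lemma star_hom_free_norm: "star_hom (free_star_alg G N) A = star_hom (free_star_alg G M) A"
  by (simp add: star_hom_def free_star_alg_def)

section \<open>The ideal family acts by left multiplication\<close>

context ideal_setup begin

text \<open>The formula is a *-polynomial in the values of \<open>p\<close> and \<open>s\<close>,
  and *-homomorphisms preserve such expressions. The values are arbitrary so that free generators
  qualify: the ideal family can be formed in the free algebra of \<open>E\<close> and pushed forward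
  to C*(E) as well as to the operators.\<close>

lemma corner_proj_natural:
  assumes A: "star_algebra A" and B: "star_algebra B" and hom: "\<phi> \<in> star_hom A B"
    and p: "\<And>v. v \<in> verts E \<Longrightarrow> p v \<in> carrier A" and s: "\<And>e. e \<in> arcs E \<Longrightarrow> s e \<in> carrier A"
    and v: "v \<in> H \<union> S"
  shows "corner_proj E H S B (\<lambda>v. \<phi> (p v)) (\<lambda>e. \<phi> (s e)) v = \<phi> (corner_proj E H S A p s v)"
    and "corner_proj E H S A p s v \<in> carrier A"
proof -
  interpret star_hom_pair A B \<phi>
    by (rule star_hom_pair.intro[OF A B]) (unfold_locales, rule hom)
  have ex: "e \<in> exit_arcs E H v \<Longrightarrow> e \<in> arcs E" for e by (simp add: exit_arcs_def)
  have ss: "e \<in> exit_arcs E H v \<Longrightarrow> s e \<otimes>\<^bsub>A\<^esub> star A (s e) \<in> carrier A" for e using s ex by simp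
  have fs: "finsum A (\<lambda>e. s e \<otimes>\<^bsub>A\<^esub> star A (s e)) (exit_arcs E H v) \<in> carrier A"
    using ss by (intro A.M.finsum_closed) auto
  show "corner_proj E H S A p s v \<in> carrier A" using p v fs by (auto simp: corner_proj_def)
  show "corner_proj E H S B (\<lambda>v. \<phi> (p v)) (\<lambda>e. \<phi> (s e)) v = \<phi> (corner_proj E H S A p s v)"
  proof (cases "v \<in> S")
    case True
    have "\<phi> (finsum A (\<lambda>e. s e \<otimes>\<^bsub>A\<^esub> star A (s e)) (exit_arcs E H v))
        = finsum B (\<lambda>e. \<phi> (s e \<otimes>\<^bsub>A\<^esub> star A (s e))) (exit_arcs E H v)"
      by (rule h_finsum[OF S_facts(4)[OF True] ss])
    also have "\<dots> = finsum B (\<lambda>e. \<phi> (s e) \<otimes>\<^bsub>B\<^esub> star B (\<phi> (s e))) (exit_arcs E H v)"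
      using s ex h(1) by (intro B.M.finsum_cong') (auto simp: h)
    finally show ?thesis using True v fs p by (simp add: corner_proj_def h_minus)
  qed (simp add: corner_proj_def)
qed

lemma path_isometry_natural:
  assumes A: "star_algebra A" and B: "star_algebra B" and hom: "\<phi> \<in> star_hom A B"
    and p: "\<And>v. v \<in> verts E \<Longrightarrow> p v \<in> carrier A" and s: "\<And>e. e \<in> arcs E \<Longrightarrow> s e \<in> carrier A"
    and a: "\<alpha> \<in> F"
  shows "path_isometry E H S B (\<lambda>v. \<phi> (p v)) (\<lambda>e. \<phi> (s e)) \<alpha> = \<phi> (path_isometry E H S A p s \<alpha>)
    \<and> path_isometry E H S A p s \<alpha> \<in> carrier A"
proof -
  interpret star_hom_pair A B \<phi>
    by (rule star_hom_pair.intro[OF A B]) (unfold_locales, rule hom)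
  note n = corner_proj_natural[where p = p and s = s, OF A B hom p s]
  show ?thesis using a
  proof (induction \<alpha> rule: F_induct)
    case (single e)
    then have "head E e \<in> H \<union> S" using F_head_last[of "[e]"] by simp
    then show ?case using n[of "head E e"] single(2) s by (simp add: path_isometry_Cons h)
  next
    case (Cons e \<alpha>)
    then show ?case using s by (simp add: path_isometry_Cons h)
  qed
qed

abbreviation ideal_gens :: "'a normed_star_alg \<Rightarrow> ('v \<Rightarrow> 'a) \<Rightarrow> ('e \<Rightarrow> 'a) \<Rightarrow> ('v + 'e list) + ('e + 'e list) \<Rightarrow> 'a" where
  "ideal_gens A p s \<equiv> case_sum (ideal_p E H S A p s) (ideal_s E H S A p s)"

abbreviation "\<G>_gens \<equiv> Inl ` verts \<G> \<union> Inr ` arcs \<G>"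

lemma ideal_gens_natural:
  assumes A: "star_algebra A" and B: "star_algebra B" and hom: "\<phi> \<in> star_hom A B"
    and p: "\<And>v. v \<in> verts E \<Longrightarrow> p v \<in> carrier A" and s: "\<And>e. e \<in> arcs E \<Longrightarrow> s e \<in> carrier A"
    and z: "z \<in> \<G>_gens"
  shows "ideal_gens B (\<lambda>v. \<phi> (p v)) (\<lambda>e. \<phi> (s e)) z = \<phi> (ideal_gens A p s z)"
    and "ideal_gens A p s z \<in> carrier A"
proof -
  interpret star_hom_pair A B \<phi>
    by (rule star_hom_pair.intro[OF A B]) (unfold_locales, rule hom)
  note n = corner_proj_natural[where p = p and s = s, OF A B hom p s]
    path_isometry_natural[where p = p and s = s, OF A B hom p s]
  have "ideal_gens B (\<lambda>v. \<phi> (p v)) (\<lambda>e. \<phi> (s e)) z = \<phi> (ideal_gens A p s z) \<and> ideal_gens A p s z \<in> carrier A"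
    using z
  proof
    assume "z \<in> Inl ` verts \<G>"
    then obtain w where "z = Inl w" "w \<in> verts \<G>" by blast
    then show ?thesis using n by (cases w) (auto simp: ideal_p_def h)
  next
    assume "z \<in> Inr ` arcs \<G>"
    then obtain a where "z = Inr a" "a \<in> arcs \<G>" by blast
    then show ?thesis using n s by (cases a) (auto simp: ideal_s_def)
  qed
  then show "ideal_gens B (\<lambda>v. \<phi> (p v)) (\<lambda>e. \<phi> (s e)) z = \<phi> (ideal_gens A p s z)"
    and "ideal_gens A p s z \<in> carrier A" by auto
qed

end

section \<open>The composite representation is left multiplication\<close>

context ideal_action begin

interpretation D: star_algebra \<A> by (rule star_algebra_adj)

interpretation I: ck_ideal E H S \<A> Pop Sop
  by (intro ck_ideal.intro ck_algebra.intro ck_algebra_axioms.intro ideal_setup_axioms wf_digraph_axioms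
    star_algebra_adj ck_family_action)

lemma X_mult_right: assumes x: "x \<in> X" and y: "y \<in> carrier B" shows "x \<otimes> y \<in> X"
proof -
  have "x \<otimes> y = fsum (\<lambda>w. q w \<otimes> x) (verts \<G>) \<otimes> y" using fin_moduleD(3)[OF x] by simp
  also have "\<dots> = finsum B (\<lambda>w. (q w \<otimes> x) \<otimes> y) {w \<in> verts \<G>. q w \<otimes> x \<noteq> \<zero>}"
    unfolding fsum_def by (rule finsum_mult) (use x y in auto)
  also have "\<dots> \<in> X"
    by (rule finsum_X, rule_tac w = i in fin_moduleI) (use x y in \<open>auto simp: mult_assoc q_q\<close>)
  finally show ?thesis .
qed

lemma q_X: "w \<in> verts \<G> \<Longrightarrow> x \<in> carrier B \<Longrightarrow> q w \<otimes> x \<in> X"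
  by (rule fin_moduleI[of _ w]) (auto simp: q_q)

lemma t_X: "a \<in> arcs \<G> \<Longrightarrow> x \<in> carrier B \<Longrightarrow> t a \<otimes> x \<in> X"
  by (rule fin_moduleI[of _ "tail \<G> a"]) (auto simp: G.p_s_x)

lemma star_t_X: "a \<in> arcs \<G> \<Longrightarrow> x \<in> carrier B \<Longrightarrow> star B (t a) \<otimes> x \<in> X"
  by (rule fin_moduleI[of _ "head \<G> a"]) (auto simp: mult_assoc[symmetric] G.p_star_s)

text \<open>No path in \<open>F\<close> starts in \<open>H\<close>, so the fibre over
  \<open>v\<close> consists of the corner vertex alone.\<close>

lemma Pop_H: "v \<in> H \<Longrightarrow> x \<in> X \<Longrightarrow> Pop v x = q (Inl v) \<otimes> x"
proof (rule fin_module_eqI)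
  fix w assume v: "v \<in> H" and x: "x \<in> X" and w: "w \<in> verts \<G>"
  have "start w = v \<longleftrightarrow> w = Inl v" using w v F_tail by (cases w) auto
  then show "q w \<otimes> Pop v x = q w \<otimes> (q (Inl v) \<otimes> x)" using v w x by (simp add: q_Pop q_q)
qed (auto intro!: q_X)

text \<open>For \<open>v\<close> in \<open>S\<close> the fibre consists of the corner vertex and of
  paths that begin with an exit edge. The range projections of the exit edges cover the latter, so
  the gap projection retains the corner vertex only.\<close>

lemma corner_apply: assumes v: "v \<in> H \<union> S" and x: "x \<in> X" shows "I.Q v x = q (Inl v) \<otimes> x"
proof (cases "v \<in> S")
  case False
  then show ?thesis using v x Pop_H by (auto simp: corner_proj_def)
next
  case True
  let ?f = "finsum \<A> (\<lambda>e. Sop e \<otimes>\<^bsub>\<A>\<^esub> star \<A> (Sop e)) (exit_arcs E H v)"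
  have f: "?f \<in> carrier \<A>" by (rule D.M.finsum_closed) auto
  have Q: "I.Q v x = Pop v x \<ominus> ?f x" using True f by (simp add: corner_proj_def adj_minus_apply)
  show ?thesis unfolding Q
  proof (rule fin_module_eqI)
    fix w assume w: "w \<in> verts \<G>"
    have I: "exit_arcs E H v \<subseteq> arcs E" by auto
    have fin: "finite (exit_arcs E H v)" by (rule S_facts(4)[OF True])
    \<comment> \<open>By \<open>q_Sop_star\<close> a path component is covered by its first edge,
      which \<open>F_tail_S\<close> shows to be an exit edge; corner components receive nothing
      because exit edges do not end in \<open>H\<close>.\<close>
    have "q w \<otimes> ?f x = (if start w = v \<and> w \<noteq> Inl v then q w \<otimes> x else \<zero>)"
    proof (cases w)
      case (Inl v')
      have "finsum B (\<lambda>e. q w \<otimes> Sop e (star \<A> (Sop e) x)) (exit_arcs E H v) = \<zero>"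
        by (rule M.add.finprod_one_eqI) (use w x Inl in \<open>auto simp: q_Sop_star\<close>)
      then show ?thesis unfolding finsum_Sop_apply[OF I x w] using Inl by auto
    next
      case (Inr \<alpha>)
      then have a: "\<alpha> \<in> F" using w by simp
      show ?thesis
      proof (cases "start w = v")
        case eq: True
        then have h: "hd \<alpha> \<in> exit_arcs E H v" using Inr a F_tail_S[OF a] True by simp
        have "finsum B (\<lambda>e. q w \<otimes> Sop e (star \<A> (Sop e) x)) (exit_arcs E H v) = q w \<otimes> Sop (hd \<alpha>) (star \<A> (Sop (hd \<alpha>)) x)"
          by (rule finsum_single[OF fin h]) (use w x Inr a in \<open>auto simp: q_Sop_star\<close>)
        then show ?thesis unfolding finsum_Sop_apply[OF I x w] using eq Inr w x a by (simp add: q_Sop_star)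
      next
        case False
        have "finsum B (\<lambda>e. q w \<otimes> Sop e (star \<A> (Sop e) x)) (exit_arcs E H v) = \<zero>"
          by (rule M.add.finprod_one_eqI) (use False w x Inr in \<open>auto simp: q_Sop_star\<close>)
        then show ?thesis unfolding finsum_Sop_apply[OF I x w] using False by simp
      qed
    qed
    moreover have "q w \<otimes> (Pop v x \<ominus> ?f x) = q w \<otimes> Pop v x \<ominus> q w \<otimes> ?f x"
      using w f by (simp add: mult_minus)
    ultimately show "q w \<otimes> (Pop v x \<ominus> ?f x) = q w \<otimes> (q (Inl v) \<otimes> x)"
      using w x v by (auto simp: q_Pop q_q)
  qed (use f x v in \<open>auto intro!: q_X\<close>)
qed

lemma Sop_q:
  assumes e: "e \<in> arcs E" and w: "w \<in> fibre (head E e)" and y: "y \<in> X" "q w \<otimes> y = y"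
  shows "Sop e y = shift_op e w \<otimes> y"
proof -
  note iso = shift_isometry[OF e]
  have z: "shift_op e w' \<otimes> y = \<zero>" if w': "w' \<in> fibre (head E e)" "w' \<noteq> w" for w'
  proof -
    have wv: "w \<in> verts \<G>" "w' \<in> verts \<G>" using w w' fibre_verts by auto
    have "q w' \<otimes> y = \<zero>" using q_q[of w' w y] y wv w' by simp
    then show ?thesis using u_x[OF iso w'(1), of y] y isoD(4)[OF iso w'(1)] by simp
  qed
  show ?thesis unfolding Sop_def strict_sum_def
    using fsum_single[OF w, of "\<lambda>w. shift_op e w \<otimes> y"] z y isoD(4)[OF iso w] by simp
qed

text \<open>The expression telescopes:
  \<open>shift_op e (Inr \<alpha>) \<otimes> t (Inr \<alpha>)\<close> is
  \<open>t (Inr (e # \<alpha>))\<close> times the source projection of \<alpha>, which it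
  absorbs.\<close>

lemma path_apply: assumes "\<alpha> \<in> F" "x \<in> X" shows "I.T \<alpha> x = t (Inr \<alpha>) \<otimes> x"
  using assms
proof (induction \<alpha> rule: F_induct)
  case (single e)
  have h: "head E e \<in> H \<union> S" using F_head_last[OF single(1)] by simp
  then have w: "Inl (head E e) \<in> fibre (head E e)" and wv: "Inl (head E e) \<in> verts \<G>" by (auto simp: fibre_def)
  have "I.T [e] x = Sop e (q (Inl (head E e)) \<otimes> x)"
    using single(3) h by (simp add: I.T_single adj_alg_simps(2) corner_apply)
  also have "\<dots> = shift_op e (Inl (head E e)) \<otimes> (q (Inl (head E e)) \<otimes> x)"
    by (rule Sop_q[OF single(2) w]) (use single(3) wv in \<open>auto intro!: q_X simp: q_q\<close>)
  also have "\<dots> = (t (Inr [e]) \<otimes> q (Inl (head E e))) \<otimes> x"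
    using single wv by (simp add: lift_single mult_assoc)
  also have "t (Inr [e]) \<otimes> q (Inl (head E e)) = t (Inr [e])" using G.s_p[OF wv, of "Inr [e]"] single by simp
  finally show ?case .
next
  case (Cons e \<alpha>)
  let ?b = "t (Inr \<alpha>)"
  have w: "Inr \<alpha> \<in> fibre (head E e)" using Cons.hyps by (simp add: fibre_def)
  have r: "Inl (head E (last \<alpha>)) \<in> verts \<G>" using F_head_last[OF Cons.hyps(3)] by simp
  have y: "?b \<otimes> x \<in> X" using Cons by (intro t_X) auto
  have "I.T (e # \<alpha>) x = Sop e (?b \<otimes> x)" using Cons by (simp add: I.T_Cons adj_alg_simps(2))
  also have "\<dots> = shift_op e (Inr \<alpha>) \<otimes> (?b \<otimes> x)"
    by (rule Sop_q[OF Cons.hyps(2) w y]) (use Cons in \<open>simp add: G.p_s_x\<close>)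
  also have "\<dots> = t (Inr (e # \<alpha>)) \<otimes> ((star B ?b \<otimes> ?b) \<otimes> x)" using Cons by (simp add: mult_assoc)
  also have "\<dots> = (t (Inr (e # \<alpha>)) \<otimes> q (Inl (head E (last \<alpha>)))) \<otimes> x"
    using Cons r by (simp add: path_isom mult_assoc)
  also have "t (Inr (e # \<alpha>)) \<otimes> q (Inl (head E (last \<alpha>))) = t (Inr (e # \<alpha>))"
    using G.s_p[OF r, of "Inr (e # \<alpha>)"] Cons by simp
  finally show ?case .
qed

lemma arc_apply: assumes a: "Inl e \<in> arcs \<G>" and x: "x \<in> X" shows "Sop e x = t (Inl e) \<otimes> x"
proof -
  have e: "e \<in> arcs E" "head E e \<in> H" "lift e = Inl e" using a hereditaryD by (auto simp: lift_def)
  have w: "Inl (head E e) \<in> fibre (head E e)" and wv: "Inl (head E e) \<in> verts \<G>" using e by (auto simp: fibre_def)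
  have "Sop e x = Sop e (q (Inl (head E e)) \<otimes> x)" using Sop_Pop[OF e(1) x] Pop_H[OF e(2) x] by simp
  also have "\<dots> = shift_op e (Inl (head E e)) \<otimes> (q (Inl (head E e)) \<otimes> x)"
    by (rule Sop_q[OF e(1) w]) (use x wv in \<open>auto intro!: q_X simp: q_q\<close>)
  also have "\<dots> = (t (Inl e) \<otimes> q (Inl (head E e))) \<otimes> x" using e a wv x by (simp add: mult_assoc)
  also have "t (Inl e) \<otimes> q (Inl (head E e)) = t (Inl e)" using G.s_p[OF wv a] by simp
  finally show ?thesis .
qed

abbreviation "gens \<equiv> case_sum q t"

lemma gens_closed: "z \<in> \<G>_gens \<Longrightarrow> gens z \<in> carrier B"
  by auto

lemma gens_X: "z \<in> \<G>_gens \<Longrightarrow> x \<in> carrier B \<Longrightarrow> gens z \<otimes> x \<in> X \<and> star B (gens z) \<otimes> x \<in> X"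
  using q_X t_X star_t_X by auto

lemma arcs_apply: "a \<in> arcs \<G> \<Longrightarrow> x \<in> X \<Longrightarrow> I.t a x = t a \<otimes> x"
  using path_apply arc_apply by (cases a) auto

lemma verts_apply: "w \<in> verts \<G> \<Longrightarrow> x \<in> X \<Longrightarrow> I.q w x = q w \<otimes> x"
proof (cases w)
  case (Inl v)
  assume "w \<in> verts \<G>" "x \<in> X"
  then show ?thesis using Inl corner_apply by simp
next
  case (Inr \<alpha>)
  assume "w \<in> verts \<G>" and x: "x \<in> X"
  then have a: "\<alpha> \<in> F" using Inr by simp
  have "star \<A> (I.T \<alpha>) x = star B (t (Inr \<alpha>)) \<otimes> x"
    by (rule star_left_mult) (use a x path_apply star_t_X in auto)
  then show ?thesis using Inr a x star_t_X[of "Inr \<alpha>" x]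
    by (simp add: adj_alg_simps(2) path_apply q_Inr mult_assoc)
qed

lemma ideal_gens_apply:
  assumes z: "z \<in> \<G>_gens" and x: "x \<in> X"
  shows "ideal_gens \<A> Pop Sop z \<in> carrier \<A>" "ideal_gens \<A> Pop Sop z x = gens z \<otimes> x"
    "star \<A> (ideal_gens \<A> Pop Sop z) x = star B (gens z) \<otimes> x"
proof -
  show c: "ideal_gens \<A> Pop Sop z \<in> carrier \<A>" using z I.q_closed I.t_closed by auto
  have m: "ideal_gens \<A> Pop Sop z x = gens z \<otimes> x" if "x \<in> X" for x
    using z that verts_apply arcs_apply by auto
  then show "ideal_gens \<A> Pop Sop z x = gens z \<otimes> x" using x .
  show "star \<A> (ideal_gens \<A> Pop Sop z) x = star B (gens z) \<otimes> x"
    by (rule star_left_mult[OF c gens_closed[OF z] m _ x]) (use gens_X[OF z] in auto)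
qed

abbreviation "op_eval \<equiv> star_algebra.feval \<A> (ideal_gens \<A> Pop Sop)"

text \<open>Generators act as left multiplications, hence so do words and their sums. Membership of
  the value in \<open>X\<close> holds because the leading letter of a word lies under one vertex
  projection and \<open>X\<close> is closed under right multiplication; there are only finitely many
  words.\<close>

lemma op_eval_apply:
  assumes f: "f \<in> carrier (graph_free_alg \<G> N)" and x: "x \<in> X"
  shows "op_eval f x = feval gens f \<otimes> x \<and> feval gens f \<in> X"
proof -
  let ?g = "ideal_gens \<A> Pop Sop"
  have gc: "z \<in> \<G>_gens \<Longrightarrow> ?g z \<in> carrier \<A>" for z using ideal_gens_apply(1)[OF _ X_zero] .
  have Bl: "leval gens l \<in> carrier B" if "fst l \<in> \<G>_gens" for l
    by (rule leval_closed[where G = \<G>_gens]) (use that gens_closed in auto)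
  have letter: "D.leval ?g l x = leval gens l \<otimes> x \<and> leval gens l \<otimes> x \<in> X" if "fst l \<in> \<G>_gens" "x \<in> X" for l x
    using that ideal_gens_apply[of "fst l" x] gens_X[of "fst l" x] by (cases l) auto
  have letterX: "leval gens l \<in> X" if "fst l \<in> \<G>_gens" for l
  proof -
    have "q w \<in> X" if "w \<in> verts \<G>" for w using that by (intro fin_moduleI[of _ w]) auto
    moreover have "t a \<in> X" if "a \<in> arcs \<G>" for a
      using that by (intro fin_moduleI[of _ "tail \<G> a"]) (auto simp: G.p_s)
    moreover have "star B (t a) \<in> X" if "a \<in> arcs \<G>" for a
      using that by (intro fin_moduleI[of _ "head \<G> a"]) (auto simp: G.p_star_s)
    ultimately show ?thesis using that by (cases l) auto
  qed
  have word: "(\<forall>x\<in>X. D.weval ?g w x = weval gens w \<otimes> x) \<and> weval gens w \<in> X" if "w \<in> words \<G>_gens" for w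
    using that
  proof (induction w)
    case (Cons l w)
    then have l: "fst l \<in> \<G>_gens" by (auto simp: words_def)
    show ?case
    proof (cases "w = []")
      case True
      then show ?thesis using letter[OF l] letterX[OF l] by simp
    next
      case False
      then have w: "w \<in> words \<G>_gens" using Cons.prems by (auto simp: words_def)
      have D: "D.weval ?g (l # w) x = D.leval ?g l (D.weval ?g w x)" for x
        using D.weval_Cons[where g = ?g and G = \<G>_gens, OF gc False] by (simp add: adj_alg_simps(2))
      have B: "weval gens (l # w) = leval gens l \<otimes> weval gens w"
        by (rule weval_Cons[where g = gens and G = \<G>_gens, OF gens_closed False])
      have wX: "weval gens w \<in> X" using Cons.IH[OF w] by blast
      show ?thesis unfolding D B
      proof (intro conjI ballI)
        show "leval gens l \<otimes> weval gens w \<in> X" using X_mult_right[OF letterX[OF l]] wX by simp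
        fix x assume x: "x \<in> X"
        have "weval gens w \<otimes> x \<in> X" using X_mult_right[OF wX] x by simp
        then show "D.leval ?g l (D.weval ?g w x) = leval gens l \<otimes> weval gens w \<otimes> x"
          using Cons.IH[OF w] x letter[OF l] Bl[OF l] wX by (simp add: mult_assoc)
      qed
    qed
  qed (simp add: words_def)
  show ?thesis using f
  proof (induction f rule: free_induct)
    case zero
    then show ?case using x by (simp add: D.feval_def feval_def adj_alg_simps(5))
  next
    case (add f c w)
    note m = mono_carrier[OF add.hyps(2), where N = N]
    have "op_eval (monomial c w) x = c \<odot> (weval gens w \<otimes> x)"
      using D.feval_mono[where g = ?g and G = \<G>_gens, OF gc add.hyps(2), of c] word[OF add.hyps(2)] x
      by (simp add: adj_alg_simps(4))
    moreover have "feval gens (monomial c w) = c \<odot> weval gens w"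
      by (rule feval_mono[where g = gens and G = \<G>_gens, OF gens_closed add.hyps(2)])
    ultimately show ?case
      using D.feval_add[where g = ?g and G = \<G>_gens and N = N, OF gc add.hyps(1) m, of c]
        feval_add[where g = gens and G = \<G>_gens and N = N, OF gens_closed add.hyps(1) m, of c]
        add.IH word[OF add.hyps(2)] x
      by (simp add: adj_alg_simps(3) distrib_right smult_mult_left)
  qed
qed

text \<open>Apply the operator to the adjoint of \<open>b = feval gens f\<close>. It lies in
  \<open>X\<close> because it is the value of the adjoint of \<open>f\<close>, and \<open>b\<close>
  times its adjoint has norm the square of the norm of \<open>b\<close>.\<close>

lemma op_eval_nrm:
  assumes f: "f \<in> carrier (graph_free_alg \<G> N)"
  shows "nrm B (feval gens f) \<le> nrm \<A> (op_eval f)"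
proof (cases "nrm B (feval gens f) = 0")
  case True
  interpret DP: pre_cstar_algebra \<A> by (rule pre_cstar_adj)
  have "op_eval f \<in> carrier \<A>"
    by (rule D.feval_closed[where G = \<G>_gens and N = N]) (use ideal_gens_apply(1)[OF _ X_zero] f in auto)
  then show ?thesis using True DP.nrm_nonneg by simp
next
  case False
  let ?b = "feval gens f"
  interpret FS: star_algebra "graph_free_alg \<G> N" by (rule star_algebra_free)
  note hom = feval_hom[where g = gens and G = \<G>_gens and N = N, OF gens_closed]
  have "star B ?b = feval gens (star (graph_free_alg \<G> N) f)"
    using star_homD(5)[OF hom f] by simp
  then have bX: "star B ?b \<in> X" using op_eval_apply[OF FS.star_closed[OF f] X_zero] by simp
  have b: "?b \<in> X" using op_eval_apply[OF f X_zero] by simp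
  have c: "op_eval f \<in> carrier \<A>"
    by (rule D.feval_closed[where G = \<G>_gens and N = N]) (use ideal_gens_apply(1)[OF _ X_zero] f in auto)
  have "nrm B ?b * nrm B ?b = nrm B (star B (star B ?b) \<otimes> star B ?b)"
    using b by (subst cstar_identity) (auto simp: power2_eq_square)
  also have "\<dots> = nrm B (op_eval f (star B ?b))" using op_eval_apply[OF f bX] b by simp
  also have "\<dots> \<le> nrm \<A> (op_eval f) * nrm B (star B ?b)"
    by (rule op_bound[OF adj_carrierD(3)[OF c] bX])
  finally show ?thesis using False b nrm_nonneg[of ?b] by simp
qed

end

section \<open>Closures and the completion of an isometrically embedded algebra\<close>

lemma (in star_algebra) ck_family_cong:
  assumes wf: "wf_digraph E" and ck: "ck_family E A p s"
    and p: "\<And>v. v \<in> verts E \<Longrightarrow> p' v = p v" and s: "\<And>e. e \<in> arcs E \<Longrightarrow> s' e = s e"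
  shows "ck_family E A p' s'"
proof -
  interpret wf_digraph E by (rule wf)
  have sc: "e \<in> arcs E \<Longrightarrow> s e \<in> carrier A" for e
    using ck by (auto simp: ck_family_def is_partial_isometry_def)
  have "finsum A (\<lambda>e. s' e \<otimes> star A (s' e)) (out_arcs E v) = finsum A (\<lambda>e. s e \<otimes> star A (s e)) (out_arcs E v)" for v
    by (rule M.finsum_cong') (use s sc in auto)
  then show ?thesis using ck p s by (simp add: ck_family_def regular_vertex_def)
qed

text \<open>The norm pulled back along \<phi> is one of the seminorms whose supremum is the
  universal norm. Completeness of \<open>A\<close> does not enter, so the operators on
  \<open>X\<close> are an admissible target.\<close>

lemma pullback_nrm_le:
  assumes wf: "wf_digraph E" and A: "pre_cstar_algebra A" and hom: "\<phi> \<in> star_hom (graph_free_alg E N) A"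
    and ck: "ck_family E A (\<lambda>v. \<phi> (vgen v)) (\<lambda>e. \<phi> (egen e))"
    and f: "f \<in> carrier (graph_free_alg E N)"
  shows "nrm A (\<phi> f) \<le> nrm (graph_normed_alg E) f"
proof -
  interpret P: pre_cstar_algebra A by fact
  let ?N = "\<lambda>f. nrm A (\<phi> f)"
  have hom': "\<phi> \<in> star_hom (graph_free_alg E ?N) A" using hom star_hom_free_norm by blast
  interpret star_hom_pair "graph_free_alg E ?N" A \<phi>
    by (rule star_hom_pair.intro[OF star_algebra_free P.star_algebra_axioms]) (unfold_locales, rule hom')
  have "pre_cstar_algebra (graph_free_alg E ?N)"
    by (rule pre_cstar_algebra.intro[OF star_algebra_free], rule pre_cstar_algebra_axioms.intro)
       (simp_all add: free_simps(7) h P.nrm_nonneg P.nrm_triangle P.nrm_smult P.nrm_mult P.cstar_identity)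
  moreover have "?N (x \<ominus>\<^bsub>graph_free_alg E ?N\<^esub> y) = 0" if r: "ckrel E (graph_free_alg E ?N) x y" for x y
  proof -
    have "\<phi> x = \<phi> y" using ck_family_iff[OF wf P.star_algebra_axioms hom'] ck r by blast
    then show ?thesis using ckrel_carrier[OF wf r] by (simp add: h_minus h)
  qed
  ultimately have "?N \<in> graph_seminorms E" using graph_seminorms_iff[OF wf] by blast
  then have "?N f \<le> (SUP N\<in>graph_seminorms E. N f)" by (rule uN_upper[OF wf f])
  then show ?thesis by (simp add: graph_normed_alg_def free_simps(7))
qed

section \<open>Sequential closures of subsets of a C*-algebra\<close>

context cstar_algebra begin

definition seq_closure :: "'a set \<Rightarrow> 'a set" where
  "seq_closure D = {y \<in> carrier A. \<exists>Y. range Y \<subseteq> D \<and> converges_to A Y y}"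

lemma seq_closureI: "y \<in> carrier A \<Longrightarrow> (\<And>n. Y n \<in> D) \<Longrightarrow> converges_to A Y y \<Longrightarrow> y \<in> seq_closure D"
  by (auto simp: seq_closure_def)

lemma seq_closure_carrier [simp]: "y \<in> seq_closure D \<Longrightarrow> y \<in> carrier A"
  by (simp add: seq_closure_def)

lemma seq_closure_subset: "D \<subseteq> carrier A \<Longrightarrow> y \<in> D \<Longrightarrow> y \<in> seq_closure D"
  by (rule seq_closureI[where Y = "\<lambda>n. y"]) (auto simp: converges_to_def)

lemma seq_closure_iff:
  assumes D: "D \<subseteq> carrier A"
  shows "y \<in> seq_closure D \<longleftrightarrow> y \<in> carrier A \<and> (\<forall>\<epsilon>>0. \<exists>x\<in>D. nrm A (x \<ominus> y) < \<epsilon>)"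
proof (intro iffI conjI allI impI)
  fix \<epsilon> :: real assume "y \<in> seq_closure D" and e: "\<epsilon> > 0"
  then obtain Y where Y: "range Y \<subseteq> D" "(\<lambda>n. nrm A (Y n \<ominus> y)) \<longlonglongrightarrow> 0"
    unfolding seq_closure_def converges_to_def by blast
  have "\<forall>\<^sub>F n in sequentially. nrm A (Y n \<ominus> y) < \<epsilon>" using order_tendstoD(2)[OF Y(2) e] .
  then obtain n where "nrm A (Y n \<ominus> y) < \<epsilon>" by (auto simp: eventually_sequentially)
  then show "\<exists>x\<in>D. nrm A (x \<ominus> y) < \<epsilon>" using Y by blast
next
  assume h: "y \<in> carrier A \<and> (\<forall>\<epsilon>>0. \<exists>x\<in>D. nrm A (x \<ominus> y) < \<epsilon>)"
  then have "\<exists>x\<in>D. nrm A (x \<ominus> y) < 1 / Suc n" for n by simp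
  then obtain Y where Y: "\<And>n. Y n \<in> D" "\<And>n. nrm A (Y n \<ominus> y) < 1 / Suc n" by metis
  have "(\<lambda>n. nrm A (Y n \<ominus> y)) \<longlonglongrightarrow> 0"
  proof (rule real_tendsto_sandwich[where f = "\<lambda>n. 0" and h = "\<lambda>n. 1 / Suc n"])
    show "(\<lambda>n. 1 / real (Suc n)) \<longlonglongrightarrow> 0" by (rule LIMSEQ_Suc[OF lim_inverse_n'])
    show "\<forall>\<^sub>F n in sequentially. 0 \<le> nrm A (Y n \<ominus> y)"
      using Y(1) D h by (intro always_eventually allI nrm_nonneg minus_closed) auto
    show "\<forall>\<^sub>F n in sequentially. nrm A (Y n \<ominus> y) \<le> 1 / Suc n" using Y(2) by (intro always_eventually allI less_imp_le)
  qed simp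
  then show "y \<in> seq_closure D" using h Y(1) by (intro seq_closureI[of _ Y]) (auto simp: converges_to_def)
qed simp

lemma seq_closure_lim:
  assumes D: "D \<subseteq> carrier A" and X: "\<And>n. X n \<in> seq_closure D" and l: "l \<in> carrier A" "converges_to A X l"
  shows "l \<in> seq_closure D"
  unfolding seq_closure_iff[OF D]
proof (intro conjI allI impI l(1))
  fix \<epsilon> :: real assume e: "\<epsilon> > 0"
  have "\<forall>\<^sub>F n in sequentially. nrm A (X n \<ominus> l) < \<epsilon> / 2"
    using order_tendstoD(2)[OF l(2)[unfolded converges_to_def], of "\<epsilon> / 2"] e by simp
  then obtain n where n: "nrm A (X n \<ominus> l) < \<epsilon> / 2" by (auto simp: eventually_sequentially)
  obtain x where x: "x \<in> D" "nrm A (x \<ominus> X n) < \<epsilon> / 2"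
    using X[of n] e unfolding seq_closure_iff[OF D] by (meson half_gt_zero)
  then have "nrm A (x \<ominus> l) < \<epsilon>"
    using nrm_diff_triangle[of x "X n" l] n D l(1) X[of n] by auto
  then show "\<exists>x\<in>D. nrm A (x \<ominus> l) < \<epsilon>" using x(1) by blast
qed

text \<open>The Lipschitz estimate is asked for only towards the limit point \<open>y\<close>, and
  values on \<open>D\<close> need only lie in the closure of \<open>D'\<close>. The latter allows
  the lemma to be used twice in a row, once per argument.\<close>

lemma seq_closure_map:
  assumes D: "D \<subseteq> carrier A" and D': "D' \<subseteq> carrier A" and y: "y \<in> seq_closure D"
    and F: "\<And>x. x \<in> D \<Longrightarrow> F x \<in> seq_closure D'" "F y \<in> carrier A"
    and lip: "\<And>x. x \<in> D \<Longrightarrow> nrm A (F x \<ominus> F y) \<le> K * nrm A (x \<ominus> y)"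
  shows "F y \<in> seq_closure D'"
proof -
  obtain Y where Y: "\<And>n. Y n \<in> D" "(\<lambda>n. nrm A (Y n \<ominus> y)) \<longlonglongrightarrow> 0"
    using y unfolding seq_closure_def converges_to_def by blast
  have FY: "F (Y n) \<in> carrier A" for n using F(1)[OF Y(1)] by (rule seq_closure_carrier)
  have lim: "(\<lambda>n. nrm A (F (Y n) \<ominus> F y)) \<longlonglongrightarrow> 0"
  proof (rule real_tendsto_sandwich[where f = "\<lambda>n. 0" and h = "\<lambda>n. K * nrm A (Y n \<ominus> y)"])
    show "(\<lambda>n. K * nrm A (Y n \<ominus> y)) \<longlonglongrightarrow> 0" by (rule tendsto_mult_right_zero[OF Y(2)])
    show "\<forall>\<^sub>F n in sequentially. 0 \<le> nrm A (F (Y n) \<ominus> F y)"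
      using F(2) FY by (intro always_eventually allI nrm_nonneg minus_closed) auto
    show "\<forall>\<^sub>F n in sequentially. nrm A (F (Y n) \<ominus> F y) \<le> K * nrm A (Y n \<ominus> y)"
      by (intro always_eventually allI lip Y(1))
  qed simp
  show ?thesis
    by (rule seq_closure_lim[OF D', of "\<lambda>n. F (Y n)"]) (use F(1)[OF Y(1)] F(2) lim in \<open>simp_all add: converges_to_def\<close>)
qed

lemma nrm_mult_diff_left: "\<lbrakk>a \<in> carrier A; x \<in> carrier A; y \<in> carrier A\<rbrakk> \<Longrightarrow> nrm A (a \<otimes> x \<ominus> a \<otimes> y) \<le> nrm A a * nrm A (x \<ominus> y)"
  using nrm_mult[of a "x \<ominus> y"] by (simp add: mult_minus)

lemma nrm_mult_diff_right: "\<lbrakk>a \<in> carrier A; x \<in> carrier A; y \<in> carrier A\<rbrakk> \<Longrightarrow> nrm A (x \<otimes> a \<ominus> y \<otimes> a) \<le> nrm A a * nrm A (x \<ominus> y)"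
  using nrm_mult[of "x \<ominus> y" a] by (simp add: minus_mult mult.commute)

lemma nrm_add_diff: "\<lbrakk>a \<in> carrier A; x \<in> carrier A; y \<in> carrier A\<rbrakk> \<Longrightarrow> nrm A ((a \<oplus> x) \<ominus> (a \<oplus> y)) = nrm A (x \<ominus> y)"
  by (simp add: add_diff)

lemma seq_closure_add:
  assumes D: "D \<subseteq> carrier A" and add: "\<And>x y. \<lbrakk>x \<in> D; y \<in> D\<rbrakk> \<Longrightarrow> x \<oplus> y \<in> D"
    and x: "x \<in> seq_closure D" and y: "y \<in> seq_closure D"
  shows "x \<oplus> y \<in> seq_closure D"
proof -
  \<comment> \<open>One summand at a time: the first stays in \<open>D\<close> while the second runs
    to its limit, and then the first one moves.\<close>
  have 1: "a \<oplus> y \<in> seq_closure D" if a: "a \<in> D" for a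
  proof (rule seq_closure_map[OF D D y, where F = "\<lambda>z. a \<oplus> z" and K = 1])
    show "z \<in> D \<Longrightarrow> a \<oplus> z \<in> seq_closure D" for z using add[OF a] by (intro seq_closure_subset[OF D])
  qed (use a D y in \<open>auto simp: nrm_add_diff subset_iff\<close>)
  show ?thesis
  proof (rule seq_closure_map[OF D D x, where F = "\<lambda>z. z \<oplus> y" and K = 1])
    show "nrm A ((z \<oplus> y) \<ominus> (x \<oplus> y)) \<le> 1 * nrm A (z \<ominus> x)" if "z \<in> D" for z
      using that D x y by (auto simp: add_diff subset_iff)
  qed (use 1 x y in auto)
qed

lemma seq_closure_smult:
  assumes D: "D \<subseteq> carrier A" and sm: "\<And>x. x \<in> D \<Longrightarrow> c \<odot> x \<in> D" and x: "x \<in> seq_closure D"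
  shows "c \<odot> x \<in> seq_closure D"
  by (rule seq_closure_map[OF D D x, where K = "cmod c"])
    (use sm x D in \<open>auto simp: sm_diff nrm_smult subset_iff intro!: seq_closure_subset[OF D]\<close>)

lemma seq_closure_star:
  assumes D: "D \<subseteq> carrier A" and st: "\<And>x. x \<in> D \<Longrightarrow> star A x \<in> D" and x: "x \<in> seq_closure D"
  shows "star A x \<in> seq_closure D"
  by (rule seq_closure_map[OF D D x, where K = 1])
    (use st x D in \<open>auto simp: star_diff[symmetric] subset_iff intro!: seq_closure_subset[OF D]\<close>)

lemma seq_closure_mult_left:
  assumes D: "D \<subseteq> carrier A" and a: "a \<in> carrier A" "\<And>x. x \<in> D \<Longrightarrow> a \<otimes> x \<in> seq_closure D" and x: "x \<in> seq_closure D"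
  shows "a \<otimes> x \<in> seq_closure D"
  by (rule seq_closure_map[OF D D x, where K = "nrm A a"])
    (use a x D in \<open>auto simp: subset_iff intro!: nrm_mult_diff_left\<close>)

end

text \<open>An isometry makes a sequence Cauchy exactly when its image is, and equivalent to another
  exactly when the images are. So limit points of the image correspond to classes of Cauchy
  sequences, and completeness of \<open>C\<close> provides a point for every class.\<close>

lemma completion_isomorphic:
  assumes A: "pre_cstar_algebra A" and C: "cstar_algebra C" and hom: "\<psi> \<in> star_hom A C"
    and iso: "\<And>x. x \<in> carrier A \<Longrightarrow> nrm C (\<psi> x) = nrm A x"
  shows "cstar_isomorphic (C\<lparr>carrier := cstar_algebra.seq_closure C (\<psi> ` carrier A)\<rparr>) (completion A)"
proof -
  interpret A: pre_cstar_algebra A by fact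
  interpret C: cstar_algebra C by fact
  interpret star_hom_pair A C \<psi>
    by (rule star_hom_pair.intro[OF A.star_algebra_axioms C.star_algebra_axioms]) (unfold_locales, rule hom)
  let ?J = "C.seq_closure (\<psi> ` carrier A)"
  have dist: "nrm C (\<psi> x \<ominus>\<^bsub>C\<^esub> \<psi> y) = nrm A (x \<ominus>\<^bsub>A\<^esub> y)" if "x \<in> carrier A" "y \<in> carrier A" for x y
    using iso[of "x \<ominus>\<^bsub>A\<^esub> y"] that by (simp add: h_minus)
  have cauchy: "(\<lambda>n. \<psi> (Z n)) \<in> cauchy_seqs C \<longleftrightarrow> Z \<in> cauchy_seqs A" if "\<And>n. Z n \<in> carrier A" for Z
    using that h(1) by (auto simp: cauchy_seqs_def dist)
  define lim where "lim Z y \<longleftrightarrow> Z \<in> cauchy_seqs A \<and> y \<in> carrier C \<and> C.eqv (\<lambda>n. \<psi> (Z n)) (\<lambda>n. y)" for Z y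
  have limD: "(\<lambda>n. \<psi> (Z n)) \<in> cauchy_seqs C" "(\<lambda>n. y) \<in> cauchy_seqs C" "C.eqv (\<lambda>n. \<psi> (Z n)) (\<lambda>n. y)"
    "Z \<in> cauchy_seqs A" "Z n \<in> carrier A" "\<psi> (Z n) \<in> carrier C" "y \<in> carrier C" if "lim Z y" for Z y n
    using that cauchy A.cauchy_carrier h(1) by (auto simp: lim_def)
  have J: "y \<in> ?J \<longleftrightarrow> (\<exists>Z. lim Z y)" for y
  proof
    assume "y \<in> ?J"
    then obtain Y where y: "y \<in> carrier C" and Y: "range Y \<subseteq> \<psi> ` carrier A" "converges_to C Y y"
      unfolding C.seq_closure_def by blast
    then have "\<forall>n. \<exists>z\<in>carrier A. Y n = \<psi> z" by blast
    then obtain Z where Z: "\<And>n. Z n \<in> carrier A" "\<And>n. Y n = \<psi> (Z n)" by metis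
    have cv: "(\<lambda>n. nrm C (\<psi> (Z n) \<ominus>\<^bsub>C\<^esub> y)) \<longlonglongrightarrow> 0" using Y(2) by (simp add: converges_to_def Z(2))
    have "Z \<in> cauchy_seqs A"
    proof (rule A.cauchyI[OF Z(1)])
      fix e :: real assume e: "e > 0"
      obtain M where M: "\<forall>n\<ge>M. norm (nrm C (\<psi> (Z n) \<ominus>\<^bsub>C\<^esub> y) - 0) < e / 2" using LIMSEQ_D[OF cv, of "e / 2"] e by auto
      have "nrm A (Z m \<ominus>\<^bsub>A\<^esub> Z n) < e" if "m \<ge> M" "n \<ge> M" for m n
      proof -
        have "nrm A (Z m \<ominus>\<^bsub>A\<^esub> Z n) = nrm C (\<psi> (Z m) \<ominus>\<^bsub>C\<^esub> \<psi> (Z n))" using Z by (simp add: dist)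
        also have "\<dots> \<le> nrm C (\<psi> (Z m) \<ominus>\<^bsub>C\<^esub> y) + nrm C (\<psi> (Z n) \<ominus>\<^bsub>C\<^esub> y)"
          using C.nrm_diff_triangle[OF h(1)[OF Z(1)] y h(1)[OF Z(1)]] C.nrm_diff_swap[OF h(1)[OF Z(1)] y] by metis
        also have "\<dots> < e / 2 + e / 2" using M that by (intro add_strict_mono) fastforce+
        finally show ?thesis by simp
      qed
      then show "\<exists>M. \<forall>m\<ge>M. \<forall>n\<ge>M. nrm A (Z m \<ominus>\<^bsub>A\<^esub> Z n) < e" by blast
    qed
    then show "\<exists>Z. lim Z y" using y cv by (auto simp: lim_def C.eqv_def)
  next
    assume "\<exists>Z. lim Z y"
    then obtain Z where "lim Z y" by blast
    then show "y \<in> ?J" using limD[of Z y]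
      by (intro C.seq_closureI[where Y = "\<lambda>n. \<psi> (Z n)"]) (auto simp: C.eqv_def converges_to_def)
  qed
  \<comment> \<open>All sequences whose images converge to \<open>y\<close> together form one class
    of the completion, so no representative has to be chosen.\<close>
  define \<phi> where "\<phi> y = {Z. lim Z y}" for y
  have phi: "\<phi> y = seq_class A Z" if Z: "lim Z y" for Z y
  proof -
    have "lim W y \<longleftrightarrow> W \<in> cauchy_seqs A \<and> A.eqv Z W" for W
    proof (cases "W \<in> cauchy_seqs A")
      case True
      note d = limD[OF Z] A.cauchy_carrier[OF True] h(1)[OF A.cauchy_carrier[OF True]]
      have "A.eqv Z W \<longleftrightarrow> C.eqv (\<lambda>n. \<psi> (Z n)) (\<lambda>n. \<psi> (W n))" using d by (simp add: A.eqv_def C.eqv_def dist)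
      also have "\<dots> \<longleftrightarrow> C.eqv (\<lambda>n. \<psi> (W n)) (\<lambda>n. y)"
        using d C.eqv_sym[of "\<lambda>n. \<psi> (Z n)" "\<lambda>n. \<psi> (W n)"] C.eqv_sym[of "\<lambda>n. \<psi> (W n)" "\<lambda>n. y"]
          C.eqv_trans[of "\<lambda>n. \<psi> (W n)" "\<lambda>n. \<psi> (Z n)" "\<lambda>n. y"] C.eqv_trans[of "\<lambda>n. \<psi> (Z n)" "\<lambda>n. y" "\<lambda>n. \<psi> (W n)"]
        by blast
      finally show ?thesis using True d by (simp add: lim_def)
    qed (simp add: lim_def)
    then show ?thesis by (simp only: \<phi>_def set_eq_iff mem_Collect_eq A.in_class) simp
  qed
  have "\<phi> \<in> star_hom (C\<lparr>carrier := ?J\<rparr>) (completion A)"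
    unfolding star_hom_def
  proof (intro CollectI conjI ballI allI)
    fix y c assume "y \<in> carrier (C\<lparr>carrier := ?J\<rparr>)"
    then obtain Z where Z: "lim Z y" using J by auto
    note d = limD[OF Z]
    show "\<phi> y \<in> carrier (completion A)" using phi[OF Z] d by (simp add: A.compl_carrier)
    have "lim (\<lambda>n. c \<odot>\<^bsub>A\<^esub> Z n) (c \<odot>\<^bsub>C\<^esub> y)"
      using C.eqv_smult[OF d(1-3), of c] d A.cauchy_smult[OF d(4)] by (simp add: lim_def h)
    then show "\<phi> (c \<odot>\<^bsub>C\<lparr>carrier := ?J\<rparr>\<^esub> y) = c \<odot>\<^bsub>completion A\<^esub> \<phi> y" using phi Z d by (simp add: A.compl_smult)
    have "lim (\<lambda>n. star A (Z n)) (star C y)"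
      using C.eqv_star[OF d(1-3)] d A.cauchy_star[OF d(4)] by (simp add: lim_def h)
    then show "\<phi> (star (C\<lparr>carrier := ?J\<rparr>) y) = star (completion A) (\<phi> y)" using phi Z d by (simp add: A.compl_star)
    fix y' assume "y' \<in> carrier (C\<lparr>carrier := ?J\<rparr>)"
    then obtain Z' where Z': "lim Z' y'" using J by auto
    note d' = limD[OF Z']
    have "lim (\<lambda>n. Z n \<oplus>\<^bsub>A\<^esub> Z' n) (y \<oplus>\<^bsub>C\<^esub> y')"
      using C.eqv_add[OF d(1) d'(1) d(2) d'(2) d(3) d'(3)] d d' A.cauchy_add[OF d(4) d'(4)] by (simp add: lim_def h)
    then show "\<phi> (y \<oplus>\<^bsub>C\<lparr>carrier := ?J\<rparr>\<^esub> y') = \<phi> y \<oplus>\<^bsub>completion A\<^esub> \<phi> y'"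
      using phi Z Z' d d' by (simp add: A.compl_add)
    have "lim (\<lambda>n. Z n \<otimes>\<^bsub>A\<^esub> Z' n) (y \<otimes>\<^bsub>C\<^esub> y')"
      using C.eqv_mult[OF d(1) d'(1) d(2) d'(2) d(3) d'(3)] d d' A.cauchy_mult[OF d(4) d'(4)] by (simp add: lim_def h)
    then show "\<phi> (y \<otimes>\<^bsub>C\<lparr>carrier := ?J\<rparr>\<^esub> y') = \<phi> y \<otimes>\<^bsub>completion A\<^esub> \<phi> y'"
      using phi Z Z' d d' by (simp add: A.compl_mult)
  qed
  moreover have "bij_betw \<phi> ?J (carrier (completion A))"
    unfolding bij_betw_def
  proof (intro conjI inj_onI subset_antisym subsetI)
    fix y y' assume "y \<in> ?J" "y' \<in> ?J" and eq: "\<phi> y = \<phi> y'"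
    then obtain Z where Z: "lim Z y" using J by blast
    then have Z': "lim Z y'" using eq by (auto simp: \<phi>_def)
    have "C.eqv (\<lambda>n. y) (\<lambda>n. y')"
      using C.eqv_trans[of "\<lambda>n. y" "\<lambda>n. \<psi> (Z n)" "\<lambda>n. y'"] C.eqv_sym[of "\<lambda>n. \<psi> (Z n)" "\<lambda>n. y"] limD[OF Z] limD[OF Z'] by blast
    then have "nrm C (y \<ominus>\<^bsub>C\<^esub> y') = 0" by (simp add: C.eqv_def LIMSEQ_const_iff)
    then show "y = y'" using C.nrm_definite[of "y \<ominus>\<^bsub>C\<^esub> y'"] C.diff_eq_zero[of y y'] limD[OF Z] limD[OF Z'] by blast
  next
    fix U assume "U \<in> \<phi> ` ?J"
    then show "U \<in> carrier (completion A)" using J phi limD(4) by (auto simp: A.compl_carrier)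
  next
    fix U assume "U \<in> carrier (completion A)"
    then obtain Z where Z: "Z \<in> cauchy_seqs A" "U = seq_class A Z" by (auto simp: A.compl_carrier)
    then have "(\<lambda>n. \<psi> (Z n)) \<in> cauchy_seqs C" using cauchy A.cauchy_carrier by blast
    then obtain y where "y \<in> carrier C" "converges_to C (\<lambda>n. \<psi> (Z n)) y" using C.complete by blast
    then have "lim Z y" using Z by (simp add: lim_def C.eqv_def converges_to_def)
    then show "U \<in> \<phi> ` ?J" using phi J Z by blast
  qed
  ultimately show ?thesis unfolding cstar_isomorphic_def by (intro bexI[of _ \<phi>]) simp_all
qed

section \<open>The ideal generated by the family\<close>

text \<open>The condition on words splits off the leading letter and leaves the rest arbitrary. It
  thus suits sets \<open>D\<close> for which control of the leading factor is enough.\<close>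

lemma (in star_algebra) feval_memI:
  assumes g: "\<And>x. x \<in> G \<Longrightarrow> g x \<in> carrier A" and f: "f \<in> carrier (free_star_alg G N)"
    and zero: "\<zero> \<in> D" and add: "\<And>x y. \<lbrakk>x \<in> D; y \<in> D\<rbrakk> \<Longrightarrow> x \<oplus> y \<in> D"
    and smult: "\<And>c x. x \<in> D \<Longrightarrow> c \<odot> x \<in> D"
    and letter: "\<And>l. fst l \<in> G \<Longrightarrow> leval g l \<in> D"
    and word: "\<And>l w. \<lbrakk>fst l \<in> G; w \<in> words G\<rbrakk> \<Longrightarrow> leval g l \<otimes> weval g w \<in> D"
  shows "feval g f \<in> D"
proof -
  have w: "weval g w \<in> D" if "w \<in> words G" for w
  proof (cases w)
    case Nil
    then show ?thesis using that by (simp add: words_def)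
  next
    case (Cons l v)
    then have l: "fst l \<in> G" using that by (auto simp: words_def)
    show ?thesis
    proof (cases "v = []")
      case True
      then show ?thesis using letter[OF l] Cons by simp
    next
      case False
      then have v: "v \<in> words G" using that Cons by (auto simp: words_def)
      have "weval g (l # v) = leval g l \<otimes> weval g v"
        by (rule weval_Cons[where G = G]) (use g False in auto)
      then show ?thesis using word[OF l v] Cons by simp
    qed
  qed
  show ?thesis using f
  proof (induction f rule: free_induct)
    case zero
    then show ?case using assms(3) by (simp add: feval_def)
  next
    case (add f c w)
    have "feval g (f \<oplus>\<^bsub>free_star_alg G N\<^esub> monomial c w) = feval g f \<oplus> feval g (monomial c w)"
      by (rule feval_add[where G = G]) (use g add mono_carrier in auto)
    moreover have "feval g (monomial c w) = c \<odot> weval g w"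
      by (rule feval_mono[where G = G]) (use g add in auto)
    ultimately show ?case using assms(4,5) w add by simp
  qed
qed

section \<open>Products of the generators of C*(E) with the vertex projections of the ideal\<close>

context ck_ideal begin

lemma lifted_arc:
  assumes "e \<in> arcs E" "head E e \<in> H \<union> S"
  shows "[e] \<in> F \<or> head E e \<in> H \<and> Inl e \<in> arcs \<G>"
  using assms by (auto simp: F_single)

context
  fixes D assumes D: "\<And>x y. \<lbrakk>x \<in> D; y \<in> D\<rbrakk> \<Longrightarrow> x \<otimes> y \<in> D" and star: "\<And>x. x \<in> D \<Longrightarrow> star A x \<in> D"
    and zero: "\<zero> \<in> D" and qD: "\<And>w. w \<in> verts \<G> \<Longrightarrow> q w \<in> D" and tD: "\<And>a. a \<in> arcs \<G> \<Longrightarrow> t a \<in> D"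
begin

lemma QD: "v \<in> H \<union> S \<Longrightarrow> Q v \<in> D" using qD[of "Inl v"] by simp
lemma TD: "\<alpha> \<in> F \<Longrightarrow> T \<alpha> \<in> D" using tD[of "Inr \<alpha>"] by simp
lemma sD: "Inl e \<in> arcs \<G> \<Longrightarrow> s e \<in> D" using tD[of "Inl e"] by simp

text \<open>\<open>D\<close> will be the image of the free algebra of the ideal graph. Together with
  the next two lemmas this shows that the generators of C*(E) and their adjoints multiply it into
  itself from the left.\<close>

lemma p_q_mem: assumes v: "v \<in> verts E" and w: "w \<in> verts \<G>" shows "p v \<otimes> q w \<in> D"
proof (cases w)
  case (Inl v')
  then show ?thesis using v w zero QD[of v'] by (auto simp: p_Q)
next
  case (Inr \<alpha>)
  then have "p v \<otimes> q w = (p v \<otimes> T \<alpha>) \<otimes> star A (T \<alpha>)" using v w by (simp add: mult_assoc)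
  then show ?thesis using Inr v w zero TD[of \<alpha>] D star by (auto simp: p_T)
qed

lemma s_q_mem: assumes e: "e \<in> arcs E" and w: "w \<in> verts \<G>" shows "s e \<otimes> q w \<in> D"
proof (cases w)
  case (Inl v)
  then have v: "v \<in> H \<union> S" "v \<in> verts E" using w by auto
  have "s e \<otimes> Q v = (s e \<otimes> p v) \<otimes> Q v" using v e by (simp add: mult_assoc p_Q)
  also have "\<dots> = (if v = head E e then s e \<otimes> Q v else \<zero>)" using v e by (simp add: s_p)
  finally have eq: "s e \<otimes> Q v = (if v = head E e then s e \<otimes> Q v else \<zero>)" .
  show ?thesis
  proof (cases "v = head E e")
    case True
    \<comment> \<open>Here \<open>s e \<otimes> Q v\<close> is a generator of the family: either the
      path of length one, or, for an edge into \<open>H\<close> kept in the ideal graph,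
      \<open>s e\<close> itself.\<close>
    from lifted_arc[OF e] v True consider "[e] \<in> F" | "head E e \<in> H" "Inl e \<in> arcs \<G>" by auto
    then show ?thesis
    proof cases
      case 1
      then show ?thesis using TD[of "[e]"] True Inl by (simp add: T_single)
    next
      case 2
      then have "Q v = p v" using True S_facts(2) by (auto simp: Q_eq)
      then show ?thesis using sD[OF 2(2)] True Inl e v by (simp add: s_p)
    qed
  next
    case False
    then show ?thesis using eq Inl zero by simp
  qed
next
  case (Inr \<alpha>)
  then have a: "\<alpha> \<in> F" using w by simp
  then have te: "tail E (hd \<alpha>) \<in> verts E" by simp
  have "s e \<otimes> T \<alpha> = (s e \<otimes> p (tail E (hd \<alpha>))) \<otimes> T \<alpha>" using a e te by (simp add: mult_assoc p_T)
  also have "\<dots> = (if tail E (hd \<alpha>) = head E e then T (e # \<alpha>) else \<zero>)" using e a te by (simp add: s_p T_Cons)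
  finally have "s e \<otimes> T \<alpha> \<in> D" using zero TD[of "e # \<alpha>"] F_Cons[of \<alpha> e] e a by auto
  moreover have "s e \<otimes> q w = (s e \<otimes> T \<alpha>) \<otimes> star A (T \<alpha>)" using Inr e a by (simp add: mult_assoc)
  ultimately show ?thesis using D star TD[OF a] by simp
qed

text \<open>At a corner vertex the product is the adjoint of \<open>Q v \<otimes> s e\<close>, which
  \<open>Q_s\<close> evaluates; at a path vertex the first edge is stripped off, leaving a shorter
  path or a corner projection.\<close>

lemma star_s_q_mem: assumes e: "e \<in> arcs E" and w: "w \<in> verts \<G>" shows "star A (s e) \<otimes> q w \<in> D"
proof (cases w)
  case (Inl v)
  then have v: "v \<in> H \<union> S" "v \<in> verts E" using w by auto
  have "star A (s e) \<otimes> Q v = star A (Q v \<otimes> s e)" using v e by (simp add: star_mult)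
  moreover have "Q v \<otimes> s e \<in> D" unfolding Q_s[OF v(1) e] using v e zero sD[of e] by auto
  ultimately show ?thesis using Inl star by simp
next
  case (Inr \<alpha>)
  then have a: "\<alpha> \<in> F" using w by simp
  have "head E e \<in> H \<union> S" if "e = hd \<alpha>" "tl \<alpha> = []"
    using that F_head_last[OF a] F_not_Nil[OF a] by (cases \<alpha>) auto
  then have "star A (s e) \<otimes> T \<alpha> \<in> D" unfolding star_s_T[OF e a]
    using zero QD[of "head E e"] TD[of "tl \<alpha>"] F_tl[OF a] by auto
  moreover have "star A (s e) \<otimes> q w = (star A (s e) \<otimes> T \<alpha>) \<otimes> star A (T \<alpha>)" using Inr e a by (simp add: mult_assoc)
  ultimately show ?thesis using D star TD[OF a] by simp
qed

end

end

context ideal_setup begin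

lemma ideal_gens_cong:
  assumes A: "star_algebra A" and s: "\<And>e. e \<in> arcs E \<Longrightarrow> s e \<in> carrier A"
    and p': "\<And>v. v \<in> verts E \<Longrightarrow> p' v = p v" and s': "\<And>e. e \<in> arcs E \<Longrightarrow> s' e = s e"
    and z: "z \<in> \<G>_gens"
  shows "ideal_gens A p' s' z = ideal_gens A p s z"
proof -
  interpret star_algebra A by (rule A)
  have corner: "corner_proj E H S A p' s' v = corner_proj E H S A p s v" if "v \<in> H \<union> S" for v
  proof -
    have "finsum A (\<lambda>e. s' e \<otimes>\<^bsub>A\<^esub> star A (s' e)) (exit_arcs E H v)
        = finsum A (\<lambda>e. s e \<otimes>\<^bsub>A\<^esub> star A (s e)) (exit_arcs E H v)"
      by (rule M.finsum_cong') (use s s' in \<open>auto simp: exit_arcs_def\<close>)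
    then show ?thesis using that p' by (auto simp: corner_proj_def)
  qed
  have path: "path_isometry E H S A p' s' \<alpha> = path_isometry E H S A p s \<alpha>" if "\<alpha> \<in> F" for \<alpha>
    using that
  proof (induction \<alpha> rule: F_induct)
    case (single e)
    then show ?case using corner[of "head E e"] F_head_last[OF single(1)] s' by (simp add: path_isometry_Cons)
  next
    case (Cons e \<alpha>)
    then show ?case using s' by (simp add: path_isometry_Cons)
  qed
  have "ideal_p E H S A p' s' w = ideal_p E H S A p s w" if "w \<in> verts \<G>" for w
    using that corner path by (cases w) (auto simp: ideal_p_def)
  moreover have "ideal_s E H S A p' s' a = ideal_s E H S A p s a" if "a \<in> arcs \<G>" for a
    using that path s' by (cases a) (auto simp: ideal_s_def)
  ultimately show ?thesis using z by auto
qed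

end

section \<open>The map into C*(E) and its isometry\<close>

context ideal_setup begin

abbreviation "C \<equiv> graph_cstar E"

interpretation C: cstar_algebra C
  by (rule cstar_algebra_graph_cstar[OF wf_digraph_axioms])

interpretation K: ck_ideal E H S C "gp E" "gs E"
  by (intro ck_ideal.intro ck_algebra.intro ck_algebra_axioms.intro ideal_setup_axioms wf_digraph_axioms
    C.star_algebra_axioms ck_family_graph_cstar)

abbreviation "FG \<equiv> graph_normed_alg \<G>"
abbreviation "cgens \<equiv> ideal_gens C (gp E) (gs E)"
abbreviation "embedding \<equiv> C.feval cgens"

lemma FG: "FG = graph_free_alg \<G> (nrm FG)"
  by (simp add: graph_normed_alg_def free_simps(7))

lemma FG_pre: "pre_cstar_algebra FG"
  unfolding graph_normed_alg_def by (rule uN_pre[OF wf_ideal_graph])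

lemma cgens_closed: "z \<in> \<G>_gens \<Longrightarrow> cgens z \<in> carrier C"
  using K.q_closed K.t_closed by auto

lemma embedding_hom: "embedding \<in> star_hom FG C"
  by (subst FG) (rule C.feval_hom[where G = \<G>_gens], rule cgens_closed)

lemma embedding_gen: "z \<in> \<G>_gens \<Longrightarrow> embedding (free_gen z) = cgens z"
  by (rule C.feval_gen[where G = \<G>_gens]) (rule cgens_closed)

lemma gen_FG: "z \<in> \<G>_gens \<Longrightarrow> free_gen z \<in> carrier FG"
  by (subst FG) (rule free_gen_carrier)

lemma embedding_nrm_le: assumes f: "f \<in> carrier FG" shows "nrm C (embedding f) \<le> nrm FG f"
proof (rule pullback_nrm_le[OF wf_ideal_graph C.pre_cstar_algebra_axioms])
  show "embedding \<in> star_hom (graph_free_alg \<G> (nrm FG)) C" using embedding_hom FG by simp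
  show "f \<in> carrier (graph_free_alg \<G> (nrm FG))" using f FG by simp
  show "ck_family \<G> C (\<lambda>w. embedding (vgen w)) (\<lambda>a. embedding (egen a))"
    by (rule C.ck_family_cong[OF wf_ideal_graph K.ck_family_ideal]) (use embedding_gen in auto)
qed

text \<open>The universal norm of \<open>f\<close> is the norm of its value in the algebra of the
  ideal graph. That is at most the norm of the corresponding left multiplication, which is
  \<open>\<pi> (\<rho> f)\<close>; its norm is at most the universal norm of \<open>\<rho> f\<close>
  for \<open>E\<close>, and this is the norm of \<open>embedding f\<close>.\<close>

lemma embedding_nrm_ge: assumes f: "f \<in> carrier FG" shows "nrm FG f \<le> nrm C (embedding f)"
proof -
  let ?B = "graph_cstar \<G>"
  let ?FE = "graph_normed_alg E"
  let ?EG = "Inl ` verts E \<union> Inr ` arcs E"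
  have FE: "?FE = graph_free_alg E (nrm ?FE)" by (simp add: graph_normed_alg_def free_simps(7))
  have FE_pre: "pre_cstar_algebra ?FE" unfolding graph_normed_alg_def by (rule uN_pre[OF wf_digraph_axioms])
  interpret FE: pre_cstar_algebra ?FE by (rule FE_pre)
  interpret FGi: pre_cstar_algebra FG by (rule FG_pre)
  interpret B: cstar_algebra ?B by (rule cstar_algebra_graph_cstar[OF wf_ideal_graph])
  interpret Act: ideal_action E H S ?B "gp \<G>" "gs \<G>"
    by (intro ideal_action.intro ideal_action_axioms.intro ideal_setup_axioms B.cstar_algebra_axioms
      ck_family_graph_cstar[OF wf_ideal_graph])
  interpret D: pre_cstar_algebra "adj_alg ?B Act.fin_module" by (rule Act.pre_cstar_adj)
  let ?D = "adj_alg ?B Act.fin_module"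
  have vE: "v \<in> verts E \<Longrightarrow> vgen v \<in> carrier ?FE" and aE: "e \<in> arcs E \<Longrightarrow> egen e \<in> carrier ?FE" for v e
    by (subst FE, rule free_gen_carrier, simp)+
  have gpgs: "(\<lambda>v. const_class ?FE (vgen v)) = gp E" "(\<lambda>e. const_class ?FE (egen e)) = gs E"
    by (simp_all add: fun_eq_iff gp_def gs_def)
  \<comment> \<open>The ideal family consists of *-polynomials in the generators of
    \<open>E\<close>, so the embedding lifts to a map between the free algebras. Both C*(E) and the
    operators on the module can then be reached from the same element
    \<open>\<rho> f\<close>.\<close>
  define \<rho> where "\<rho> = FE.feval (ideal_gens ?FE vgen egen)"
  have constE: "const_class ?FE \<in> star_hom ?FE C"
    using const_hom[OF wf_digraph_axioms FE_pre] by (simp add: graph_cstar_def)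
  have rg: "ideal_gens C (\<lambda>v. const_class ?FE (vgen v)) (\<lambda>e. const_class ?FE (egen e)) z
      = const_class ?FE (ideal_gens ?FE vgen egen z)" "ideal_gens ?FE vgen egen z \<in> carrier ?FE"
    if "z \<in> \<G>_gens" for z
    by (rule ideal_gens_natural[OF FE.star_algebra_axioms C.star_algebra_axioms constE]; use vE aE that in blast)+
  have rho: "\<rho> \<in> star_hom FG ?FE" unfolding \<rho>_def
    by (subst FG) (rule FE.feval_hom[where G = \<G>_gens], rule rg(2))
  have rho_gen: "\<rho> (free_gen z) = ideal_gens ?FE vgen egen z" if "z \<in> \<G>_gens" for z
    unfolding \<rho>_def by (rule FE.feval_gen[where G = \<G>_gens]) (use rg(2) that in auto)
  have rf: "\<rho> f \<in> carrier ?FE" using star_homD(1)[OF rho f] .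
  have embedding_rho: "embedding f = const_class ?FE (\<rho> f)"
  proof -
    have h: "(\<lambda>x. const_class ?FE (\<rho> x)) \<in> star_hom (graph_free_alg \<G> (nrm FG)) C"
      using star_hom_compose[OF rho constE] FG by simp
    have "const_class ?FE (\<rho> f) = C.feval (\<lambda>x. const_class ?FE (\<rho> (free_gen x))) f"
      by (rule C.feval_unique[OF h]) (use f FG in simp)
    also have "\<dots> = embedding f"
    proof (rule C.feval_cong[where G = \<G>_gens and N = "nrm FG"])
      show "const_class ?FE (\<rho> (free_gen x)) = cgens x" if "x \<in> \<G>_gens" for x
        unfolding rho_gen[OF that] using rg(1)[OF that] unfolding gpgs by simp
      then show "const_class ?FE (\<rho> (free_gen x)) \<in> carrier C" if "x \<in> \<G>_gens" for x
        using cgens_closed that by simp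
    qed (use f FG in simp)
    finally show ?thesis by simp
  qed
  \<comment> \<open>The action of \<open>E\<close> on the module, as a representation of the free
    algebra of \<open>E\<close>; completeness of C*(E) is not involved at this level.\<close>
  define \<pi> where "\<pi> = D.feval (case_sum Act.Pop Act.Sop)"
  have pc: "x \<in> ?EG \<Longrightarrow> case_sum Act.Pop Act.Sop x \<in> carrier ?D" for x by auto
  have pi: "\<pi> \<in> star_hom (graph_free_alg E (nrm ?FE)) ?D" unfolding \<pi>_def
    by (rule D.feval_hom[where G = ?EG], rule pc)
  have pi': "\<pi> \<in> star_hom ?FE ?D" using pi FE by simp
  have pi_gen: "\<pi> (free_gen x) = case_sum Act.Pop Act.Sop x" if "x \<in> ?EG" for x
    unfolding \<pi>_def by (rule D.feval_gen[where G = ?EG]) (use pc that in auto)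
  have "nrm ?D (\<pi> (\<rho> f)) \<le> nrm ?FE (\<rho> f)"
  proof (rule pullback_nrm_le[OF wf_digraph_axioms D.pre_cstar_algebra_axioms pi])
    show "\<rho> f \<in> carrier (graph_free_alg E (nrm ?FE))" using rf FE by simp
    show "ck_family E ?D (\<lambda>v. \<pi> (vgen v)) (\<lambda>e. \<pi> (egen e))"
      by (rule D.ck_family_cong[OF wf_digraph_axioms Act.ck_family_action]) (use pi_gen in auto)
  qed
  \<comment> \<open>Both sides are *-homomorphisms on the free algebra of the ideal graph, and they
    agree on generators because the formulas of the ideal family are natural.\<close>
  moreover have "\<pi> (\<rho> f) = D.feval (ideal_gens ?D Act.Pop Act.Sop) f"
  proof -
    have h: "(\<lambda>x. \<pi> (\<rho> x)) \<in> star_hom (graph_free_alg \<G> (nrm FG)) ?D"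
      using star_hom_compose[OF rho pi'] FG by simp
    have "\<pi> (\<rho> f) = D.feval (\<lambda>x. \<pi> (\<rho> (free_gen x))) f"
      by (rule D.feval_unique[OF h]) (use f FG in simp)
    also have "\<dots> = D.feval (ideal_gens ?D Act.Pop Act.Sop) f"
    proof (rule D.feval_cong[where G = \<G>_gens and N = "nrm FG"])
      have n: "ideal_gens ?D (\<lambda>v. \<pi> (vgen v)) (\<lambda>e. \<pi> (egen e)) z = \<pi> (ideal_gens ?FE vgen egen z)"
        if "z \<in> \<G>_gens" for z
        by (rule ideal_gens_natural[OF FE.star_algebra_axioms D.star_algebra_axioms pi']; use vE aE that in blast)
      show "\<pi> (\<rho> (free_gen x)) \<in> carrier ?D" if "x \<in> \<G>_gens" for x
        using star_homD(1)[OF pi'] star_homD(1)[OF rho gen_FG[OF that]] by blast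
      show "\<pi> (\<rho> (free_gen x)) = ideal_gens ?D Act.Pop Act.Sop x" if x: "x \<in> \<G>_gens" for x
      proof -
        have "\<pi> (\<rho> (free_gen x)) = ideal_gens ?D (\<lambda>v. \<pi> (vgen v)) (\<lambda>e. \<pi> (egen e)) x"
          unfolding rho_gen[OF x] using n[OF x] by simp
        also have "\<dots> = ideal_gens ?D Act.Pop Act.Sop x"
          by (rule ideal_gens_cong[OF D.star_algebra_axioms _ _ _ x]) (use pi_gen in auto)
        finally show ?thesis .
      qed
    qed (use f FG in simp)
    finally show ?thesis .
  qed
  moreover have "nrm FG f = nrm ?B (const_class FG f)"
    using FGi.compl_nrm_const[OF f] by (simp add: graph_cstar_def)
  moreover have "const_class FG f = B.feval (case_sum (gp \<G>) (gs \<G>)) f"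
  proof -
    have h: "const_class FG \<in> star_hom (graph_free_alg \<G> (nrm FG)) ?B"
      using const_hom[OF wf_ideal_graph FG_pre] FG by (simp add: graph_cstar_def)
    have "const_class FG f = B.feval (\<lambda>x. const_class FG (free_gen x)) f"
      by (rule B.feval_unique[OF h]) (use f FG in simp)
    also have "(\<lambda>x. const_class FG (free_gen x)) = case_sum (gp \<G>) (gs \<G>)"
      by (auto simp: fun_eq_iff gp_def gs_def split: sum.split)
    finally show ?thesis .
  qed
  moreover have "nrm ?B (B.feval (case_sum (gp \<G>) (gs \<G>)) f) \<le> nrm ?D (D.feval (ideal_gens ?D Act.Pop Act.Sop) f)"
    by (rule Act.op_eval_nrm[where N = "nrm FG"]) (use f FG in simp)
  moreover have "nrm C (embedding f) = nrm ?FE (\<rho> f)"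
    unfolding embedding_rho using FE.compl_nrm_const[OF rf] by (simp add: graph_cstar_def)
  ultimately show ?thesis by simp
qed

section \<open>The closure of the image is the ideal\<close>

abbreviation "J0 \<equiv> embedding ` carrier FG"
abbreviation "J \<equiv> C.seq_closure J0"

interpretation FG: pre_cstar_algebra FG by (rule FG_pre)

lemma J0_carrier: "J0 \<subseteq> carrier C"
  using star_homD(1)[OF embedding_hom] by blast

lemma J0_closed:
  "x \<in> J0 \<Longrightarrow> y \<in> J0 \<Longrightarrow> x \<oplus>\<^bsub>C\<^esub> y \<in> J0" "x \<in> J0 \<Longrightarrow> c \<odot>\<^bsub>C\<^esub> x \<in> J0"
  "x \<in> J0 \<Longrightarrow> y \<in> J0 \<Longrightarrow> x \<otimes>\<^bsub>C\<^esub> y \<in> J0" "x \<in> J0 \<Longrightarrow> star C x \<in> J0" "\<zero>\<^bsub>C\<^esub> \<in> J0"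
proof -
  interpret P: star_hom_pair FG C embedding
    by (rule star_hom_pair.intro[OF FG.star_algebra_axioms C.star_algebra_axioms]) (unfold_locales, rule embedding_hom)
  show "x \<in> J0 \<Longrightarrow> y \<in> J0 \<Longrightarrow> x \<oplus>\<^bsub>C\<^esub> y \<in> J0" "x \<in> J0 \<Longrightarrow> c \<odot>\<^bsub>C\<^esub> x \<in> J0"
    "x \<in> J0 \<Longrightarrow> y \<in> J0 \<Longrightarrow> x \<otimes>\<^bsub>C\<^esub> y \<in> J0" "x \<in> J0 \<Longrightarrow> star C x \<in> J0"
    by (auto simp: P.h(2-5)[symmetric])
  show "\<zero>\<^bsub>C\<^esub> \<in> J0" using P.h_zero[symmetric] by auto
qed

lemma cgens_J0: "z \<in> \<G>_gens \<Longrightarrow> cgens z \<in> J0"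
  using embedding_gen gen_FG by (metis image_eqI)

lemma q_J0: "w \<in> verts \<G> \<Longrightarrow> K.q w \<in> J0" and t_J0: "a \<in> arcs \<G> \<Longrightarrow> K.t a \<in> J0"
  using cgens_J0[of "Inl w"] cgens_J0[of "Inr a"] by auto

lemma letter_J0: "fst l \<in> \<G>_gens \<Longrightarrow> C.leval cgens l \<in> J0"
  using cgens_J0[of "fst l"] J0_closed(4) by (cases l) auto

lemma weval_J0: assumes w: "w \<in> words \<G>_gens" shows "C.weval cgens w \<in> J0"
proof -
  have "embedding (monomial 1 w) = 1 \<odot>\<^bsub>C\<^esub> C.weval cgens w"
    by (rule C.feval_mono[where G = \<G>_gens]) (use cgens_closed w in auto)
  moreover have wc: "C.weval cgens w \<in> carrier C"
    by (rule C.weval_closed[where G = \<G>_gens]) (use cgens_closed w in auto)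
  moreover have "monomial 1 w \<in> carrier FG" by (subst FG) (rule mono_carrier[OF w])
  ultimately show ?thesis by (metis C.sm_one image_eqI)
qed

text \<open>A letter absorbs a vertex projection on its left, so only products with those matter.\<close>

lemma mult_J0:
  assumes a: "a \<in> carrier C" and aq: "\<And>w. w \<in> verts \<G> \<Longrightarrow> a \<otimes>\<^bsub>C\<^esub> K.q w \<in> J0" and x: "x \<in> J0"
  shows "a \<otimes>\<^bsub>C\<^esub> x \<in> J0"
proof -
  have al: "a \<otimes>\<^bsub>C\<^esub> C.leval cgens l \<in> J0" if l: "fst l \<in> \<G>_gens" for l :: "_ \<times> bool"
  proof -
    have "\<exists>w\<in>verts \<G>. K.q w \<otimes>\<^bsub>C\<^esub> C.leval cgens l = C.leval cgens l"
    proof (cases l)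
      case (Pair z b)
      show ?thesis
      proof (cases z)
        case (Inl w)
        then have "w \<in> verts \<G>" using l Pair by auto
        then show ?thesis using Inl Pair K.q_q[of w w] K.q_star[of w] by (intro bexI[of _ w]) auto
      next
        case (Inr d)
        then have d: "d \<in> arcs \<G>" using l Pair by auto
        interpret G: wf_digraph \<G> by (rule wf_ideal_graph)
        note c = K.t_closed[OF d] K.q_closed[OF G.head_in_verts[OF d]]
        have "K.q (head \<G> d) \<otimes>\<^bsub>C\<^esub> star C (K.t d) = star C (K.t d)"
          using arg_cong[OF K.t_q[OF d], of "star C"] c K.q_star[OF G.head_in_verts[OF d]] by (simp add: C.star_mult)
        then show ?thesis using Inr Pair d K.q_t[of "tail \<G> d" d]
          by (cases b) (auto intro: bexI[of _ "head \<G> d"] bexI[of _ "tail \<G> d"])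
      qed
    qed
    then obtain w where w: "w \<in> verts \<G>" "K.q w \<otimes>\<^bsub>C\<^esub> C.leval cgens l = C.leval cgens l" by blast
    have "a \<otimes>\<^bsub>C\<^esub> C.leval cgens l = (a \<otimes>\<^bsub>C\<^esub> K.q w) \<otimes>\<^bsub>C\<^esub> C.leval cgens l"
      using w a K.q_closed[OF w(1)] letter_J0[OF l] J0_carrier C.mult_assoc[of a "K.q w" "C.leval cgens l"] by auto
    then show ?thesis using J0_closed(3)[OF aq[OF w(1)] letter_J0[OF l]] by simp
  qed
  obtain f where f: "f \<in> carrier (graph_free_alg \<G> (nrm FG))" "x = embedding f" using x FG by auto
  have "embedding f \<in> {x \<in> carrier C. a \<otimes>\<^bsub>C\<^esub> x \<in> J0}"
  proof (rule C.feval_memI[where G = \<G>_gens, OF _ f(1)])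
    fix l :: "_ \<times> bool" and w assume l: "fst l \<in> \<G>_gens" and w: "w \<in> words \<G>_gens"
    have c: "C.leval cgens l \<in> carrier C" "C.weval cgens w \<in> carrier C"
      using letter_J0[OF l] weval_J0[OF w] J0_carrier by auto
    have "a \<otimes>\<^bsub>C\<^esub> (C.leval cgens l \<otimes>\<^bsub>C\<^esub> C.weval cgens w) = (a \<otimes>\<^bsub>C\<^esub> C.leval cgens l) \<otimes>\<^bsub>C\<^esub> C.weval cgens w"
      using a c by (simp add: C.mult_assoc)
    then show "C.leval cgens l \<otimes>\<^bsub>C\<^esub> C.weval cgens w \<in> {x \<in> carrier C. a \<otimes>\<^bsub>C\<^esub> x \<in> J0}"
      using J0_closed(3)[OF al[OF l] weval_J0[OF w]] c by simp
  next
    fix l :: "_ \<times> bool" assume l: "fst l \<in> \<G>_gens"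
    show "C.leval cgens l \<in> {x \<in> carrier C. a \<otimes>\<^bsub>C\<^esub> x \<in> J0}" using al[OF l] letter_J0[OF l] J0_carrier by blast
  next
    fix x y assume "x \<in> {x \<in> carrier C. a \<otimes>\<^bsub>C\<^esub> x \<in> J0}" "y \<in> {x \<in> carrier C. a \<otimes>\<^bsub>C\<^esub> x \<in> J0}"
    then show "x \<oplus>\<^bsub>C\<^esub> y \<in> {x \<in> carrier C. a \<otimes>\<^bsub>C\<^esub> x \<in> J0}"
      using J0_closed(1) a by (simp add: C.distrib_left)
  next
    fix c x assume "x \<in> {x \<in> carrier C. a \<otimes>\<^bsub>C\<^esub> x \<in> J0}"
    then show "c \<odot>\<^bsub>C\<^esub> x \<in> {x \<in> carrier C. a \<otimes>\<^bsub>C\<^esub> x \<in> J0}"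
      using J0_closed(2) a by (simp add: C.smult_mult_right)
  qed (use cgens_closed J0_closed(5) a in auto)
  then show ?thesis using f by simp
qed

lemma J_star: "y \<in> J \<Longrightarrow> star C y \<in> J"
  by (rule C.seq_closure_star[OF J0_carrier]) (rule J0_closed)

text \<open>The elements that multiply \<open>J\<close> into itself from the left form a closed
  subalgebra containing the generators and their adjoints, hence everything. Multiplication from the
  right follows by taking adjoints, since \<open>J\<close> is self-adjoint.\<close>

lemma J_ideal:
  assumes a: "a \<in> carrier C" and y: "y \<in> J" shows "a \<otimes>\<^bsub>C\<^esub> y \<in> J" "y \<otimes>\<^bsub>C\<^esub> a \<in> J"
proof -
  define M where "M = {a \<in> carrier C. \<forall>y\<in>J. a \<otimes>\<^bsub>C\<^esub> y \<in> J}"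
  have left: "a \<in> M" if a: "a \<in> carrier C" and aq: "\<And>w. w \<in> verts \<G> \<Longrightarrow> a \<otimes>\<^bsub>C\<^esub> K.q w \<in> J0" for a
    unfolding M_def
  proof (intro CollectI conjI ballI a)
    fix y assume y: "y \<in> J"
    show "a \<otimes>\<^bsub>C\<^esub> y \<in> J"
      by (rule C.seq_closure_mult_left[OF J0_carrier a _ y])
        (rule C.seq_closure_subset[OF J0_carrier mult_J0[OF a aq]])
  qed
  note mem = K.p_q_mem[OF J0_closed(3-5) q_J0 t_J0] K.s_q_mem[OF J0_closed(3-5) q_J0 t_J0]
    K.star_s_q_mem[OF J0_closed(3-5) q_J0 t_J0]
  have gensV: "gp E v \<in> M" if "v \<in> verts E" for v using that by (intro left mem) auto
  have gensE: "gs E e \<in> M" "star C (gs E e) \<in> M" if "e \<in> arcs E" for e using that by (intro left mem; simp)+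
  have Madd: "x \<oplus>\<^bsub>C\<^esub> y \<in> M" if "x \<in> M" "y \<in> M" for x y
    using that C.seq_closure_add[OF J0_carrier J0_closed(1)] by (auto simp: M_def C.distrib_right)
  have Msm: "c \<odot>\<^bsub>C\<^esub> x \<in> M" if "x \<in> M" for c x
    using that C.seq_closure_smult[OF J0_carrier J0_closed(2)] by (auto simp: M_def C.smult_mult_left)
  have Mm: "x \<otimes>\<^bsub>C\<^esub> y \<in> M" if "x \<in> M" "y \<in> M" for x y
    using that by (auto simp: M_def C.mult_assoc)
  have Ml: "l \<in> M" if X: "range X \<subseteq> M" and l: "l \<in> carrier C" "converges_to C X l" for X l
    unfolding M_def
  proof (intro CollectI conjI ballI l(1))
    fix y assume y: "y \<in> J"
    have Xn: "X n \<in> carrier C" "X n \<otimes>\<^bsub>C\<^esub> y \<in> J" for n using X y by (auto simp: M_def)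
    show "l \<otimes>\<^bsub>C\<^esub> y \<in> J"
    proof (rule C.seq_closure_lim[OF J0_carrier Xn(2)])
      have "(\<lambda>n. nrm C (X n \<otimes>\<^bsub>C\<^esub> y \<ominus>\<^bsub>C\<^esub> l \<otimes>\<^bsub>C\<^esub> y)) \<longlonglongrightarrow> 0"
      proof (rule real_tendsto_sandwich[where f = "\<lambda>n. 0" and h = "\<lambda>n. nrm C y * nrm C (X n \<ominus>\<^bsub>C\<^esub> l)"])
        show "(\<lambda>n. nrm C y * nrm C (X n \<ominus>\<^bsub>C\<^esub> l)) \<longlonglongrightarrow> 0"
          using tendsto_mult_right_zero[OF l(2)[unfolded converges_to_def]] .
        show "\<forall>\<^sub>F n in sequentially. 0 \<le> nrm C (X n \<otimes>\<^bsub>C\<^esub> y \<ominus>\<^bsub>C\<^esub> l \<otimes>\<^bsub>C\<^esub> y)"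
          using Xn(1) l(1) y by (intro always_eventually allI C.nrm_nonneg) simp
        show "\<forall>\<^sub>F n in sequentially. nrm C (X n \<otimes>\<^bsub>C\<^esub> y \<ominus>\<^bsub>C\<^esub> l \<otimes>\<^bsub>C\<^esub> y) \<le> nrm C y * nrm C (X n \<ominus>\<^bsub>C\<^esub> l)"
          using Xn(1) l(1) y by (intro always_eventually allI C.nrm_mult_diff_right) simp_all
      qed simp
      then show "converges_to C (\<lambda>n. X n \<otimes>\<^bsub>C\<^esub> y) (l \<otimes>\<^bsub>C\<^esub> y)" by (simp add: converges_to_def)
    qed (use l y in simp)
  qed
  have z: "\<zero>\<^bsub>C\<^esub> \<in> M"
    using C.seq_closure_subset[OF J0_carrier J0_closed(5)] by (auto simp: M_def)
  have Mc: "M \<subseteq> carrier C" by (auto simp: M_def)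
  \<comment> \<open>\<open>M\<close> is not visibly closed under adjoints, which
    \<open>graph_cstar_generated\<close> requires; its self-adjoint part is.\<close>
  let ?D = "{a \<in> carrier C. a \<in> M \<and> star C a \<in> M}"
  have "?D = carrier C"
  proof (rule graph_cstar_generated[OF wf_digraph_axioms])
    fix X l assume X: "range X \<subseteq> ?D" and l: "l \<in> carrier C" "converges_to C X l"
    have Xc: "X n \<in> carrier C" for n using X by auto
    have "converges_to C (\<lambda>n. star C (X n)) (star C l)"
      using l Xc by (simp add: converges_to_def C.star_diff[symmetric])
    then have "star C l \<in> M" using X l by (intro Ml[of "\<lambda>n. star C (X n)"]) auto
    moreover have "l \<in> M" using X l by (intro Ml[of X]) auto
    ultimately show "l \<in> ?D" using l by simp
  qed (use Madd Msm Mm z Mc gensV gensE in \<open>auto simp: C.star_add C.star_smult C.star_mult\<close>)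
  then have M: "a \<in> M" "star C a \<in> M" using a by auto
  have "y \<otimes>\<^bsub>C\<^esub> a = star C (star C a \<otimes>\<^bsub>C\<^esub> star C y)" using a y by (simp add: C.star_mult)
  then show "y \<otimes>\<^bsub>C\<^esub> a \<in> J" using M y J_star by (auto simp: M_def)
  show "a \<otimes>\<^bsub>C\<^esub> y \<in> J" using M y by (auto simp: M_def)
qed

lemma closed_ideal_J: "closed_ideal C J"
  unfolding closed_ideal_def
proof (intro conjI ballI allI impI)
  show "J \<subseteq> carrier C" using C.seq_closure_carrier by blast
  show "\<zero>\<^bsub>C\<^esub> \<in> J" by (rule C.seq_closure_subset[OF J0_carrier J0_closed(5)])
  show "x \<oplus>\<^bsub>C\<^esub> y \<in> J" if "x \<in> J" "y \<in> J" for x y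
    by (rule C.seq_closure_add[OF J0_carrier J0_closed(1) that])
  show "c \<odot>\<^bsub>C\<^esub> x \<in> J" if "x \<in> J" for c x
    by (rule C.seq_closure_smult[OF J0_carrier J0_closed(2) that])
  show "a \<otimes>\<^bsub>C\<^esub> x \<in> J" "x \<otimes>\<^bsub>C\<^esub> a \<in> J" if "a \<in> carrier C" "x \<in> J" for a x
    by (rule J_ideal[OF that])+
  show "l \<in> J" if "l \<in> carrier C" "range X \<subseteq> J \<and> converges_to C X l" for X l
    by (rule C.seq_closure_lim[OF J0_carrier, of X]) (use that in blast)+
qed

lemma corner_gens: "v \<in> H \<Longrightarrow> K.q (Inl v) = gp E v" "v \<in> S \<Longrightarrow> K.q (Inl v) = gap_projection E H v"
  using S_facts(2)[of v] by (auto simp: corner_proj_def gap_projection_def)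

text \<open>Every edge of the ideal graph ends at a corner vertex and absorbs its projection on the
  right. Hence an ideal that contains the corner projections contains all edges, then the
  projections of the path vertices, and finally every word through its leading letter.\<close>

lemma J0_subset_ideal:
  assumes I: "closed_ideal C I" and gens: "gp E ` H \<union> gap_projection E H ` S \<subseteq> I"
  shows "J0 \<subseteq> I"
proof
  fix x assume "x \<in> J0"
  then obtain f where f: "f \<in> carrier (graph_free_alg \<G> (nrm FG))" "x = embedding f" using FG by auto
  interpret G: wf_digraph \<G> by (rule wf_ideal_graph)
  have Ic: "I \<subseteq> carrier C" "\<zero>\<^bsub>C\<^esub> \<in> I" and Ia: "x \<in> I \<Longrightarrow> y \<in> I \<Longrightarrow> x \<oplus>\<^bsub>C\<^esub> y \<in> I" "x \<in> I \<Longrightarrow> c \<odot>\<^bsub>C\<^esub> x \<in> I"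
    and Im: "a \<in> carrier C \<Longrightarrow> x \<in> I \<Longrightarrow> a \<otimes>\<^bsub>C\<^esub> x \<in> I" "a \<in> carrier C \<Longrightarrow> x \<in> I \<Longrightarrow> x \<otimes>\<^bsub>C\<^esub> a \<in> I" for x y a c
    using I by (auto simp: closed_ideal_def)
  have v: "K.q (Inl v) \<in> I" if "v \<in> H \<union> S" for v using that gens corner_gens by auto
  have hd: "K.q (head \<G> a) \<in> I" if "a \<in> arcs \<G>" for a
    using v G.head_in_verts[OF that] by (cases a) auto
  have t: "K.t a \<in> I" "star C (K.t a) \<in> I" if a: "a \<in> arcs \<G>" for a
  proof -
    note c = K.t_closed[OF a] K.q_closed[OF G.head_in_verts[OF a]]
    show "K.t a \<in> I" using Im(1)[OF c(1) hd[OF a]] K.t_q[OF a] by simp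
    have "K.q (head \<G> a) \<otimes>\<^bsub>C\<^esub> star C (K.t a) = star C (K.t a)"
      using arg_cong[OF K.t_q[OF a], of "star C"] c K.q_star[OF G.head_in_verts[OF a]] by (simp add: C.star_mult)
    then show "star C (K.t a) \<in> I" using Im(2)[OF C.star_closed[OF c(1)] hd[OF a]] by simp
  qed
  have q: "K.q w \<in> I" if w: "w \<in> verts \<G>" for w
  proof (cases w)
    case (Inr \<alpha>)
    then show ?thesis using t[of "Inr \<alpha>"] Im(1) w by simp
  qed (use v w in auto)
  have letter: "C.leval cgens l \<in> I" if "fst l \<in> \<G>_gens" for l :: "_ \<times> bool"
    using that q t K.q_star by (cases l) auto
  show "x \<in> I" unfolding f(2)
  proof (rule C.feval_memI[where G = \<G>_gens, OF _ f(1)])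
    fix l :: "_ \<times> bool" and w assume l: "fst l \<in> \<G>_gens" and w: "w \<in> words \<G>_gens"
    show "C.leval cgens l \<otimes>\<^bsub>C\<^esub> C.weval cgens w \<in> I"
      using Im(2)[OF _ letter[OF l]] weval_J0[OF w] J0_carrier by blast
  qed (use cgens_closed letter Ic Ia in auto)
qed

lemma graph_ideal_eq: "graph_ideal E H S = J"
proof
  have "gp E ` H \<union> gap_projection E H ` S \<subseteq> J"
    using corner_gens q_J0[of "Inl _"] C.seq_closure_subset[OF J0_carrier] by force
  then show "graph_ideal E H S \<subseteq> J"
    unfolding graph_ideal_def closed_ideal_gen_def using closed_ideal_J by blast
  show "J \<subseteq> graph_ideal E H S"
    unfolding graph_ideal_def closed_ideal_gen_def
  proof (intro subsetI InterI)
    fix y I assume y: "y \<in> J" and "I \<in> {J. closed_ideal C J \<and> gp E ` H \<union> gap_projection E H ` S \<subseteq> J}"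
    then have I: "closed_ideal C I" "J0 \<subseteq> I" using J0_subset_ideal by auto
    obtain Y where "range Y \<subseteq> J0" "converges_to C Y y" "y \<in> carrier C"
      using y unfolding C.seq_closure_def by blast
    then show "y \<in> I" using I unfolding closed_ideal_def by (meson order_trans)
  qed
qed

theorem graph_ideal_isomorphic: "cstar_isomorphic (graph_ideal_alg E H S) (graph_cstar \<G>)"
proof -
  have "nrm C (embedding f) = nrm FG f" if "f \<in> carrier FG" for f
    using embedding_nrm_le[OF that] embedding_nrm_ge[OF that] by simp
  from completion_isomorphic[OF FG_pre C.cstar_algebra_axioms embedding_hom this]
  show ?thesis by (simp add: graph_ideal_alg_def graph_ideal_eq graph_cstar_def)
qed

end

theorem theorem5p1:
  fixes E :: "('v, 'e) pre_digraph" and H S :: "'v set"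
  assumes "wf_digraph E"
    and "saturated_hereditary E H"
    and "S \<subseteq> breaking_vertices E H"
  shows "cstar_isomorphic (graph_ideal_alg E H S) (graph_cstar (ideal_graph E H S))"
proof -
  interpret ideal_setup E H S
    by (intro ideal_setup.intro ideal_setup_axioms.intro assms)
      (use assms(2) in \<open>simp add: saturated_hereditary_def\<close>)
  show ?thesis by (rule graph_ideal_isomorphic)
qed

end
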